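(* Fix an integer $k\ge 2$ and integers $1\le m_1\le\cdots\le m_k$. There exists $n_0=n_0(m_1,\ldots,m_k)$ such that, for every $n\ge n_0$ and every $n$-vertex tree $T$, \[ R\left(T,K_{m_1,\ldots,m_k}\right)\le (k-1)\bigl(R(T,K_{m_1,m_2})-1\bigr)+m_1 . \]
   Context: All graphs are finite and simple; copies of graphs are ordinary (not necessarily induced) copies. For graphs $J$ and $L$, $R(J,L)$ is the least $N$ such that every red--blue coloring of the edges of $K_N$ contains a red copy of $J$ or a blue copy of $L$. $K_{m_1,\ldots,m_k}$ is the complete $k$-partite graph with part sizes $m_1,\ldots,m_k$. *)

theory Defs
  imports "HOL-Library.Ramsey"
begin

section \<open>Finite simple graphs\<close>

record 'a sgraph =
  vertices :: "'a set"
  edges :: "'a set set"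

definition finite_simple_graph :: "'a sgraph \<Rightarrow> bool" where
  "finite_simple_graph G \<longleftrightarrow> finite (vertices G) \<and> edges G \<subseteq> [vertices G]\<^bsup>2\<^esup>"

definition adj_rel :: "'a sgraph \<Rightarrow> 'a rel" where
  "adj_rel G = {(u, v). {u, v} \<in> edges G}"

definition connected_graph :: "'a sgraph \<Rightarrow> bool" where
  "connected_graph G \<longleftrightarrow>
     vertices G \<noteq> {} \<and> (\<forall>u \<in> vertices G. \<forall>v \<in> vertices G. (u, v) \<in> (adj_rel G)\<^sup>*)"

definition is_cycle :: "'a sgraph \<Rightarrow> 'a list \<Rightarrow> bool" where
  "is_cycle G vs \<longleftrightarrow> length vs \<ge> 3 \<and> distinct vs \<and>
     (\<forall>i < length vs. {vs ! i, vs ! (Suc i mod length vs)} \<in> edges G)"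

definition is_tree :: "'a sgraph \<Rightarrow> bool" where
  "is_tree G \<longleftrightarrow> finite_simple_graph G \<and> connected_graph G \<and> (\<nexists>vs. is_cycle G vs)"

text \<open>Copies are not necessarily induced: non-edges of \<open>J\<close> may be mapped to edges of \<open>H\<close>.\<close>

definition contains_copy :: "'b sgraph \<Rightarrow> 'a sgraph \<Rightarrow> bool" where
  "contains_copy H J \<longleftrightarrow>
     (\<exists>f. inj_on f (vertices J) \<and> f ` vertices J \<subseteq> vertices H \<and>
          (\<forall>e \<in> edges J. f ` e \<in> edges H))"

definition complete_graph :: "nat \<Rightarrow> nat sgraph" where
  "complete_graph N = \<lparr>vertices = {..<N}, edges = [{..<N}]\<^bsup>2\<^esup>\<rparr>"

text \<open>The vertex \<open>(i, j)\<close> is the \<open>j\<close>-th vertex of the \<open>i\<close>-th part; both are counted from \<open>0\<close>.\<close>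

definition complete_multipartite :: "nat list \<Rightarrow> (nat \<times> nat) sgraph" where
  "complete_multipartite ms =
     (let V = {(i, j). i < length ms \<and> j < ms ! i}
      in \<lparr>vertices = V, edges = {{u, v} | u v. u \<in> V \<and> v \<in> V \<and> fst u \<noteq> fst v}\<rparr>)"

section \<open>Ramsey numbers\<close>

datatype colour = Red | Blue

definition colour_class :: "'a sgraph \<Rightarrow> ('a set \<Rightarrow> colour) \<Rightarrow> colour \<Rightarrow> 'a sgraph" where
  "colour_class G c x = \<lparr>vertices = vertices G, edges = {e \<in> edges G. c e = x}\<rparr>"

definition ramsey_arrows :: "nat \<Rightarrow> 'a sgraph \<Rightarrow> 'b sgraph \<Rightarrow> bool" where
  "ramsey_arrows N J L \<longleftrightarrow>
     (\<forall>c. contains_copy (colour_class (complete_graph N) c Red) J \<or>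
          contains_copy (colour_class (complete_graph N) c Blue) L)"

definition ramsey_number :: "'a sgraph \<Rightarrow> 'b sgraph \<Rightarrow> nat" where
  "ramsey_number J L = (LEAST N. ramsey_arrows N J L)"

text \<open>The \<open>LEAST\<close> above is always attained for finite simple graphs.\<close>

lemma contains_copy_if_all_pairs:
  assumes J: "finite_simple_graph J"
    and W: "finite W" "card W = card (vertices J)" "W \<subseteq> vertices H"
    and E: "\<And>x y. x \<in> W \<Longrightarrow> y \<in> W \<Longrightarrow> x \<noteq> y \<Longrightarrow> {x, y} \<in> edges H"
  shows "contains_copy H J"
proof -
  from J have "finite (vertices J)" by (simp add: finite_simple_graph_def)
  then obtain f where f: "bij_betw f (vertices J) W"
    using W finite_same_card_bij by metis
  have "f ` e \<in> edges H" if "e \<in> edges J" for e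
  proof -
    from that J obtain x y where e: "e = {x, y}" "x \<in> vertices J" "y \<in> vertices J" "x \<noteq> y"
      unfolding finite_simple_graph_def by (meson nsets2_E subsetD)
    then have "f x \<in> W" "f y \<in> W" "f x \<noteq> f y"
      using f by (auto simp: bij_betw_def inj_on_def)
    then show ?thesis using E e by simp
  qed
  with f W show ?thesis
    unfolding contains_copy_def bij_betw_def by blast
qed

lemma ex_ramsey_arrows:
  assumes J: "finite_simple_graph J" and L: "finite_simple_graph L"
  shows "\<exists>N. ramsey_arrows N J L"
proof -
  obtain r where r: "\<forall>(V :: nat set) E. finite V \<and> card V \<ge> r \<longrightarrow>
      (\<exists>W \<subseteq> V. card W = card (vertices J) \<and> clique W E \<or> card W = card (vertices L) \<and> indep W E)"
    using ramsey2[of "card (vertices J)" "card (vertices L)"] by (elim exE conjE)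
  have "ramsey_arrows r J L"
    unfolding ramsey_arrows_def
  proof
    fix c
    let ?E = "edges (colour_class (complete_graph r) c Red)"
    obtain W where W: "W \<subseteq> {..<r}"
      "card W = card (vertices J) \<and> clique W ?E \<or> card W = card (vertices L) \<and> indep W ?E"
      using r[rule_format, of "{..<r}" ?E] by (simp only: finite_lessThan card_lessThan) blast
    have fin: "finite W" using W finite_subset by blast
    from W(2) show "contains_copy (colour_class (complete_graph r) c Red) J \<or>
        contains_copy (colour_class (complete_graph r) c Blue) L"
    proof (elim disjE conjE)
      assume "card W = card (vertices J)" "clique W ?E"
      then show ?thesis
        using W(1) fin
        by (intro disjI1 contains_copy_if_all_pairs[OF J, of W])
           (auto simp: colour_class_def complete_graph_def clique_def)
    next
      assume card: "card W = card (vertices L)" and ind: "indep W ?E"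
      have "c {x, y} = Blue" if "x \<in> W" "y \<in> W" "x \<noteq> y" for x y
        using ind that W(1)
        by (cases "c {x, y}") (auto simp: colour_class_def complete_graph_def indep_def)
      then show ?thesis
        using card W(1) fin
        by (intro disjI2 contains_copy_if_all_pairs[OF L, of W])
           (auto simp: colour_class_def complete_graph_def)
    qed
  qed
  then show ?thesis ..
qed

lemma finite_simple_graph_complete_multipartite:
  "finite_simple_graph (complete_multipartite ms)"
proof -
  have "{(i, j). i < length ms \<and> j < ms ! i} = (SIGMA i : {..<length ms}. {..<ms ! i})"
    by auto
  then have "finite {(i, j). i < length ms \<and> j < ms ! i}" by simp
  then show ?thesis
    unfolding finite_simple_graph_def complete_multipartite_def Let_def by auto
qed

text \<open>This excludes truncation in the term \<open>ramsey_number J L - 1\<close> on \<open>nat\<close>.\<close>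

lemma ramsey_number_pos:
  assumes "finite_simple_graph J" "finite_simple_graph L"
    and "vertices J \<noteq> {}" "vertices L \<noteq> {}"
  shows "ramsey_number J L \<ge> 1"
proof -
  have "ramsey_arrows (ramsey_number J L) J L"
    unfolding ramsey_number_def using ex_ramsey_arrows[OF assms(1,2)] by (rule LeastI_ex)
  moreover have "\<not> ramsey_arrows 0 J L"
    using assms(3,4)
    by (auto simp: ramsey_arrows_def contains_copy_def colour_class_def complete_graph_def)
  ultimately show ?thesis
    by (metis One_nat_def Suc_leI not_gr0)
qed

end

theory Submission
  imports Defs Complex_Main
begin

text \<open>
  Call an edge red or blue. For large \<open>n\<close>, a colouring without a red copy of \<open>T\<close> and without a blue
  complete \<open>k\<close>-partite graph with large constant parts is stable: apart from few vertices, it consists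
  of \<open>k - 1\<close> sets \<open>A\<^sub>i\<close> of about \<open>n\<close> vertices, almost completely red inside and almost completely blue
  between each other.  This needs embeddings of an arbitrary tree into a red near-clique that is a
  little too small, together with many outside vertices having many red neighbours in it; the outside
  vertices serve as images of leaves or of inner vertices of bare paths.

  Write \<open>r = R(T, K(m\<^sub>1, m\<^sub>2))\<close>.  If \<open>r\<close> vertices have, for each \<open>j \<noteq> i\<close>, few red neighbours in a
  sizeable part of \<open>A\<^sub>j\<close>, then they contain a blue \<open>K(m\<^sub>1, m\<^sub>2)\<close>, which extends through these parts.
  So let \<open>V\<^sub>i\<close> be the vertices that are mostly red to \<open>A\<^sub>i\<close>, let \<open>C\<close> be the remaining, boundedly
  many vertices, and pick \<open>a\<^sub>i \<in> A\<^sub>i\<close>. If the pattern of \<open>a\<^sub>i\<close> on \<open>C\<close> is not rare, then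
  \<open>|V\<^sub>i| + |{v \<in> C. v is blue to all a\<^sub>j with j \<noteq> i}| \<le> r - 1\<close>.  Summing over \<open>i\<close> and comparing with the
  total number of vertices shows that the vertices of \<open>C\<close> have on average more than one red neighbour
  among the \<open>a\<^sub>i\<close>.  Averaging over the choice of the \<open>a\<^sub>i\<close> gives a vertex with more than \<open>(1 + \<zeta>) n\<close> red
  neighbours in the \<open>A\<^sub>i\<close>, and \<open>T\<close> can be embedded with its centroid at this vertex.

  The threshold that separates \<open>C\<close> from the \<open>V\<^sub>i\<close> is chosen from a finite list of rapidly
  decreasing scales, such that the vertices between this scale and the next one have small total
  blue degree to their own set.
\<close>

section \<open>Parent orders and greedy embedding\<close>

text \<open>The bound is exact in \<open>r\<close>, which is not known explicitly, so no vertex may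
  be lost in the final count, while stability describes the colouring only up to a small multiple of
  \<open>n\<close>. Hence every vertex outside \<open>C\<close> is assigned to a set, and the
  boundedly many misfits in \<open>C\<close> are counted through the representatives
  \<open>a\<^sub>i\<close>: a vertex with no red neighbour among them is counted for every
  \<open>i\<close>, one with a single red neighbour exactly once, all others never. Patterns enter
  because a blue \<open>K(m\<^sub>1, m\<^sub>2)\<close> must be continued by many vertices of each
  \<open>A\<^sub>j\<close> at once. Vertices with the pattern of \<open>a\<^sub>j\<close> behave
  alike on \<open>C\<close>, and a bounded \<open>C\<close> admits boundedly many patterns. Scales
  are needed because a pattern class is much smaller than \<open>A\<^sub>j\<close>: vertices just
  below a fixed threshold could be red to all of it. The centroid matters because its branches have
  at most \<open>n / 2\<close> vertices each, so they can be divided between two groups of sets,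
  none of which has to hold \<open>n\<close> vertices.\<close>

definition parent_order :: "nat \<Rightarrow> (nat \<Rightarrow> nat) \<Rightarrow> bool" where
  "parent_order n p \<longleftrightarrow> 0 < n \<and> (\<forall>i. 0 < i \<and> i < n \<longrightarrow> p i < i)"

lemma ex_subset_card:
  assumes "m \<le> card S"
  shows "\<exists>T. T \<subseteq> S \<and> card T = m"
  using obtain_subset_with_card_n[OF assms] by metis

text \<open>Copies of the tree are injections of \<open>{..<n}\<close> that respect
  \<open>p\<close>, so red trees can be built in any vertex set without mentioning colourings;
  \<open>E\<close> is later red adjacency.\<close>

definition embeds :: "('v \<Rightarrow> 'v \<Rightarrow> bool) \<Rightarrow> nat \<Rightarrow> (nat \<Rightarrow> nat) \<Rightarrow> 'v set \<Rightarrow> bool" where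
  "embeds E n p V \<longleftrightarrow> (\<exists>f. inj_on f {..<n} \<and> f ` {..<n} \<subseteq> V \<and> (\<forall>i. 0 < i \<and> i < n \<longrightarrow> E (f (p i)) (f i)))"

lemma embeds_mono: "embeds E n p V \<Longrightarrow> V \<subseteq> W \<Longrightarrow> embeds E n p W"
  unfolding embeds_def by blast

text \<open>Vertices are placed in increasing order, each \<open>i\<close> inside its own candidate
  set \<open>X i\<close>. Only earlier vertices whose candidate sets meet \<open>X i\<close> can
  block a choice, so vertices sent to different regions do not compete. All red trees constructed
  below come from a suitable choice of \<open>X\<close>.\<close>

lemma embeds_greedy:
  assumes p: "parent_order n p"
    and X: "\<And>i. i < n \<Longrightarrow> X i \<subseteq> V" "\<And>i. i < n \<Longrightarrow> finite (X i)"
    and X0: "X 0 \<noteq> {}"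
    and step: "\<And>i a. \<lbrakk>0 < i; i < n; a \<in> X (p i)\<rbrakk> \<Longrightarrow>
      card {j. j < i \<and> X j \<inter> X i \<noteq> {}} < card {y \<in> X i. E a y}"
  shows "embeds E n p V"
proof -
  have "\<exists>f. inj_on f {..<m} \<and> (\<forall>i<m. f i \<in> X i) \<and> (\<forall>i. 0 < i \<and> i < m \<longrightarrow> E (f (p i)) (f i))"
    if "m \<le> n" for m
    using that
  proof (induction m)
    case 0
    show ?case by simp
  next
    case (Suc m)
    then obtain f where f: "inj_on f {..<m}" "\<forall>i<m. f i \<in> X i"
      "\<forall>i. 0 < i \<and> i < m \<longrightarrow> E (f (p i)) (f i)"
      by auto
    have "\<exists>y. y \<in> X m \<and> (0 < m \<longrightarrow> E (f (p m)) y) \<and> y \<notin> f ` {..<m}"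
    proof (cases "m = 0")
      case True
      then show ?thesis using X0 by auto
    next
      case False
      then have pm: "p m < m" using p Suc.prems by (auto simp: parent_order_def)
      let ?U = "{j. j < m \<and> X j \<inter> X m \<noteq> {}}" and ?Y = "{y \<in> X m. E (f (p m)) y}"
      have "card ?U < card ?Y"
        using step[of m "f (p m)"] False Suc.prems pm f(2) by auto
      moreover have "card (f ` ?U) \<le> card ?U" by (intro card_image_le) auto
      ultimately have "\<not> ?Y \<subseteq> f ` ?U"
        using card_mono[of "f ` ?U" ?Y] by auto
      then obtain y where y: "y \<in> ?Y" "y \<notin> f ` ?U" by blast
      then have "y \<notin> f ` {..<m}" using f(2) by blast
      with y show ?thesis by blast
    qed
    then obtain y where y: "y \<in> X m" "0 < m \<longrightarrow> E (f (p m)) y" "y \<notin> f ` {..<m}" by blast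
    have pm: "p i < m" if "0 < i" "i < Suc m" for i
      using that p Suc.prems by (fastforce simp: parent_order_def)
    have "inj_on (f(m := y)) {..<Suc m}"
      using f(1) y(3) by (auto simp: inj_on_def less_Suc_eq)
    moreover have "\<forall>i<Suc m. (f(m := y)) i \<in> X i"
      using f(2) y(1) by (auto simp: less_Suc_eq)
    moreover have "\<forall>i. 0 < i \<and> i < Suc m \<longrightarrow> E ((f(m := y)) (p i)) ((f(m := y)) i)"
    proof (intro allI impI)
      fix i assume i: "0 < i \<and> i < Suc m"
      with pm have "p i < m" by blast
      then show "E ((f(m := y)) (p i)) ((f(m := y)) i)"
        using f(3) y(2) i by (cases "i = m") auto
    qed
    ultimately show ?case by blast
  qed
  from this[of n] obtain f where "inj_on f {..<n}" "\<forall>i<n. f i \<in> X i"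
      "\<forall>i. 0 < i \<and> i < n \<longrightarrow> E (f (p i)) (f i)"
    by auto
  then show ?thesis unfolding embeds_def using X(1) by blast
qed

text \<open>For irreflexive \<open>E\<close> the vertex \<open>a\<close> itself is one of its at
  most \<open>d\<close> non-neighbours.\<close>

definition near_clique :: "('v \<Rightarrow> 'v \<Rightarrow> bool) \<Rightarrow> nat \<Rightarrow> 'v set \<Rightarrow> bool" where
  "near_clique E d A \<longleftrightarrow> finite A \<and> (\<forall>a \<in> A. card {y \<in> A. \<not> E a y} \<le> d)"

lemma near_clique_subset:
  assumes "near_clique E d A" "B \<subseteq> A"
  shows "near_clique E d B"
proof -
  have "card {y \<in> B. \<not> E a y} \<le> card {y \<in> A. \<not> E a y}" if "a \<in> B" for a
    using assms by (intro card_mono) (auto simp: near_clique_def)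
  then show ?thesis
    using assms finite_subset by (fastforce simp: near_clique_def)
qed

lemma near_clique_nbrs:
  assumes "near_clique E d A" "B \<subseteq> A" "a \<in> A"
  shows "card B \<le> card {y \<in> B. E a y} + d"
proof -
  have "finite B" using assms finite_subset by (auto simp: near_clique_def)
  then have "card B = card {y \<in> B. E a y} + card {y \<in> B. \<not> E a y}"
    by (subst card_Un_disjoint[symmetric]) (auto intro: arg_cong[of _ _ card])
  moreover have "card {y \<in> B. \<not> E a y} \<le> card {y \<in> A. \<not> E a y}"
    using assms by (intro card_mono) (auto simp: near_clique_def)
  ultimately show ?thesis using assms by (fastforce simp: near_clique_def)
qed

lemma embeds_near_clique:
  assumes p: "parent_order n p" and A: "near_clique E d A" "n + d \<le> card A"
  shows "embeds E n p A"
proof (rule embeds_greedy[OF p, where X = "\<lambda>_. A"])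
  fix i a assume i: "0 < i" "i < n" "a \<in> A"
  have "card {j. j < i \<and> A \<inter> A \<noteq> {}} \<le> card {..<i}"
    by (intro card_mono) auto
  then show "card {j. j < i \<and> A \<inter> A \<noteq> {}} < card {y \<in> A. E a y}"
    using near_clique_nbrs[OF A(1) subset_refl i(3)] A(2) i(2) by simp
qed (use A p in \<open>auto simp: near_clique_def parent_order_def\<close>)

text \<open>Recursion along the path to the root; the guard \<open>p i < i\<close> makes it
  terminate for every \<open>p\<close>. It yields the depth of a vertex, the ancestor relation and
  the branch of a vertex at the centroid.\<close>

function parent_rec :: "(nat \<Rightarrow> nat) \<Rightarrow> (nat \<Rightarrow> 'b \<Rightarrow> 'b) \<Rightarrow> 'b \<Rightarrow> nat \<Rightarrow> 'b" where
  "parent_rec p G b i = (if 0 < i \<and> p i < i then G i (parent_rec p G b (p i)) else b)"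
  by auto
termination by (relation "measure (\<lambda>(p, G, b, i). i)") auto

declare parent_rec.simps [simp del]

lemma parent_rec_0 [simp]: "parent_rec p G b 0 = b"
  by (simp add: parent_rec.simps)

lemma parent_rec_parent:
  assumes "parent_order n p" "0 < i" "i < n"
  shows "parent_rec p G b i = G i (parent_rec p G b (p i))"
  using assms by (subst parent_rec.simps) (auto simp: parent_order_def)

section \<open>Parent orders of acyclic connected graphs\<close>

definition joined :: "'a sgraph \<Rightarrow> 'a set \<Rightarrow> 'a \<Rightarrow> 'a \<Rightarrow> bool" where
  "joined T S u v \<longleftrightarrow> (\<exists>xs. xs \<noteq> [] \<and> hd xs = u \<and> last xs = v \<and> distinct xs \<and> set xs \<subseteq> S \<and>
     (\<forall>i. Suc i < length xs \<longrightarrow> {xs ! i, xs ! Suc i} \<in> edges T))"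

lemma joined_insert:
  assumes "joined T S u v" "w \<notin> S" "{v, w} \<in> edges T"
  shows "joined T (insert w S) u w"
proof -
  from assms(1) obtain xs where xs: "xs \<noteq> []" "hd xs = u" "last xs = v" "distinct xs" "set xs \<subseteq> S"
    "\<forall>i. Suc i < length xs \<longrightarrow> {xs ! i, xs ! Suc i} \<in> edges T"
    unfolding joined_def by blast
  have "{(xs @ [w]) ! i, (xs @ [w]) ! Suc i} \<in> edges T" if "Suc i < length (xs @ [w])" for i
  proof (cases "Suc i < length xs")
    case True
    then show ?thesis using xs(6) by (simp add: nth_append)
  next
    case False
    with that have "Suc i = length xs" by simp
    moreover from this have "xs ! i = v" using xs(1,3) by (metis diff_Suc_1 last_conv_nth)
    ultimately show ?thesis using assms(3) by (simp add: nth_append)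
  qed
  then show ?thesis
    unfolding joined_def using xs assms(2) by (intro exI[of _ "xs @ [w]"]) auto
qed

lemma joined_rev: "joined T S u v \<Longrightarrow> joined T S v u"
  unfolding joined_def
proof (elim exE conjE)
  fix xs assume xs: "xs \<noteq> []" "hd xs = u" "last xs = v" "distinct xs" "set xs \<subseteq> S"
    "\<forall>i. Suc i < length xs \<longrightarrow> {xs ! i, xs ! Suc i} \<in> edges T"
  have "{rev xs ! i, rev xs ! Suc i} \<in> edges T" if "Suc i < length xs" for i
    using that xs(6)[rule_format, of "length xs - Suc (Suc i)"]
    by (simp add: rev_nth insert_commute Suc_diff_Suc)
  with xs show "\<exists>xs. xs \<noteq> [] \<and> hd xs = v \<and> last xs = u \<and> distinct xs \<and> set xs \<subseteq> S \<and>
     (\<forall>i. Suc i < length xs \<longrightarrow> {xs ! i, xs ! Suc i} \<in> edges T)"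
    by (intro exI[of _ "rev xs"]) (auto simp: hd_rev last_rev)
qed

lemma joined_mono: "joined T S u v \<Longrightarrow> S \<subseteq> S' \<Longrightarrow> joined T S' u v"
  unfolding joined_def by blast

text \<open>A second neighbour in the joined set would close a cycle.\<close>

lemma unique_neighbour:
  assumes acyclic: "\<nexists>vs. is_cycle T vs" and "joined T S u v" "u \<noteq> v" "w \<notin> S"
    and "{u, w} \<in> edges T" "{v, w} \<in> edges T"
  shows False
proof -
  from assms(2) obtain xs where xs: "xs \<noteq> []" "hd xs = u" "last xs = v" "distinct xs" "set xs \<subseteq> S"
    "\<forall>i. Suc i < length xs \<longrightarrow> {xs ! i, xs ! Suc i} \<in> edges T"
    unfolding joined_def by blast
  let ?ys = "xs @ [w]"
  have "length xs \<noteq> 1" using xs(1-3) \<open>u \<noteq> v\<close> by (auto simp: length_Suc_conv)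
  then have len: "length xs \<ge> 2" using xs(1) by (cases xs) (auto simp: Suc_le_eq)
  have "{?ys ! i, ?ys ! (Suc i mod length ?ys)} \<in> edges T" if "i < length ?ys" for i
  proof -
    consider "Suc i < length xs" | "Suc i = length xs" | "i = length xs" using \<open>i < length ?ys\<close> by force
    then show ?thesis
    proof cases
      case 1
      then show ?thesis using xs(6) by (simp add: nth_append)
    next
      case 2
      then have "xs ! i = v" using xs(1,3) by (metis diff_Suc_1 last_conv_nth)
      then show ?thesis using 2 assms(6) by (simp add: nth_append)
    next
      case 3
      have "xs ! 0 = u" using xs(1,2) by (simp add: hd_conv_nth)
      then show ?thesis using 3 assms(5) xs(1) by (simp add: nth_append insert_commute)
    qed
  qed
  then have "is_cycle T ?ys"
    unfolding is_cycle_def using len xs assms(4) by auto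
  with acyclic show False by blast
qed

lemma rtrancl_leaves_set:
  "(u, v) \<in> r\<^sup>* \<Longrightarrow> u \<in> S \<Longrightarrow> v \<notin> S \<Longrightarrow> \<exists>x y. x \<in> S \<and> y \<notin> S \<and> (x, y) \<in> r"
  by (induction rule: rtrancl_induct) blast+

text \<open>Vertices are added one at a time along an edge that leaves the current set. The
  invariant includes that any two placed vertices are joined by a path inside the placed set; a new
  vertex with two placed neighbours would therefore close a cycle, so its only edge into the set is
  the one to its parent.\<close>

lemma tree_parent_order:
  assumes tree: "is_tree T"
  shows "\<exists>\<phi> p. parent_order (card (vertices T)) p \<and> bij_betw \<phi> {..<card (vertices T)} (vertices T) \<and>
    (\<forall>i. 0 < i \<and> i < card (vertices T) \<longrightarrow> {\<phi> (p i), \<phi> i} \<in> edges T) \<and>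
    (\<forall>e \<in> edges T. \<exists>i. 0 < i \<and> i < card (vertices T) \<and> e = {\<phi> (p i), \<phi> i})"
proof -
  define n where "n = card (vertices T)"
  have T: "finite (vertices T)" "edges T \<subseteq> [vertices T]\<^bsup>2\<^esup>" "connected_graph T" "\<nexists>vs. is_cycle T vs"
    using tree by (auto simp: is_tree_def finite_simple_graph_def)
  then have npos: "n > 0" by (auto simp: n_def connected_graph_def card_gt_0_iff)
  have "\<exists>\<phi> p. inj_on \<phi> {..<m} \<and> \<phi> ` {..<m} \<subseteq> vertices T \<and> (\<forall>i. 0 < i \<and> i < m \<longrightarrow> p i < i) \<and>
      (\<forall>i. 0 < i \<and> i < m \<longrightarrow> {\<phi> (p i), \<phi> i} \<in> edges T) \<and>
      (\<forall>e \<in> edges T. e \<subseteq> \<phi> ` {..<m} \<longrightarrow> (\<exists>i. 0 < i \<and> i < m \<and> e = {\<phi> (p i), \<phi> i})) \<and>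
      (\<forall>u \<in> \<phi> ` {..<m}. \<forall>v \<in> \<phi> ` {..<m}. joined T (\<phi> ` {..<m}) u v)"
    if "1 \<le> m" "m \<le> n" for m
    using that
  proof (induction m rule: nat_induct_at_least)
    case base
    obtain x where x: "x \<in> vertices T" using T(3) by (auto simp: connected_graph_def)
    have "e \<notin> edges T" if "e \<subseteq> {x}" for e
    proof
      assume "e \<in> edges T"
      with T(2) have "card e = 2" by (auto simp: nsets_def)
      with that show False using card_mono[OF _ that] by simp
    qed
    moreover have "joined T {x} x x" unfolding joined_def by (intro exI[of _ "[x]"]) auto
    ultimately show ?case using x
      by (intro exI[of _ "\<lambda>_. x"] exI[of _ "\<lambda>_. 0"]) (auto simp: lessThan_Suc)
  next
    case (Suc m)
    then obtain \<phi> p where IH: "inj_on \<phi> {..<m}" "\<phi> ` {..<m} \<subseteq> vertices T" "\<forall>i. 0 < i \<and> i < m \<longrightarrow> p i < i"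
      and IHe: "\<forall>i. 0 < i \<and> i < m \<longrightarrow> {\<phi> (p i), \<phi> i} \<in> edges T" and IH':
      "\<forall>e \<in> edges T. e \<subseteq> \<phi> ` {..<m} \<longrightarrow> (\<exists>i. 0 < i \<and> i < m \<and> e = {\<phi> (p i), \<phi> i})"
      "\<forall>u \<in> \<phi> ` {..<m}. \<forall>v \<in> \<phi> ` {..<m}. joined T (\<phi> ` {..<m}) u v"
      by auto
    let ?S = "\<phi> ` {..<m}"
    have "card ?S < n" using card_image[OF IH(1)] Suc.prems by simp
    then obtain z where z: "z \<in> vertices T" "z \<notin> ?S"
      using IH(2) unfolding n_def by (metis subset_antisym subsetI less_irrefl)
    have "\<phi> 0 \<in> ?S" using Suc.hyps by auto
    moreover have "(\<phi> 0, z) \<in> (adj_rel T)\<^sup>*"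
      using T(3) z(1) IH(2) \<open>\<phi> 0 \<in> ?S\<close> by (auto simp: connected_graph_def)
    ultimately obtain x w where xw: "x \<in> ?S" "w \<notin> ?S" "{x, w} \<in> edges T"
      using rtrancl_leaves_set[of "\<phi> 0" z "adj_rel T" ?S] z(2) by (auto simp: adj_rel_def)
    have wV: "w \<in> vertices T" using xw(3) T(2) by (auto simp: nsets_def)
    obtain q where q: "q < m" "x = \<phi> q" using xw(1) by auto
    let ?\<phi> = "\<phi>(m := w)" and ?p = "p(m := q)"
    have S': "?\<phi> ` {..<Suc m} = insert w ?S" by (auto simp: lessThan_Suc)
    have c1: "inj_on ?\<phi> {..<Suc m}" using IH(1) xw(2) by (auto simp: inj_on_def less_Suc_eq)
    have c2: "?\<phi> ` {..<Suc m} \<subseteq> vertices T" using S' IH(2) wV by simp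
    have c3: "\<forall>i. 0 < i \<and> i < Suc m \<longrightarrow> ?p i < i" using IH(3) q by (auto simp: less_Suc_eq)
    have cE: "\<forall>i. 0 < i \<and> i < Suc m \<longrightarrow> {?\<phi> (?p i), ?\<phi> i} \<in> edges T"
    proof (intro allI impI)
      fix i assume i: "0 < i \<and> i < Suc m"
      show "{?\<phi> (?p i), ?\<phi> i} \<in> edges T"
      proof (cases "i = m")
        case True
        then show ?thesis using q xw(3) by simp
      next
        case False
        then have "0 < i" "i < m" using i by auto
        moreover from this have "p i < m" using IH(3) less_trans by blast
        ultimately show ?thesis using IHe by simp
      qed
    qed
    have c4: "\<exists>i. 0 < i \<and> i < Suc m \<and> e = {?\<phi> (?p i), ?\<phi> i}"
      if e: "e \<in> edges T" "e \<subseteq> insert w ?S" for e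
    proof (cases "w \<in> e")
      case False
      then obtain i where i: "0 < i" "i < m" "e = {\<phi> (p i), \<phi> i}" using IH'(1) e by blast
      moreover have "p i < m" using IH(3) i by (meson less_trans)
      ultimately show ?thesis by (intro exI[of _ i]) auto
    next
      case True
      obtain y where y: "e = {y, w}" "y \<noteq> w"
        using True e(1) T(2) by (auto simp: nsets_def card_2_iff)
      then have yS: "y \<in> ?S" using e(2) by auto
      have "y = x"
      proof (rule ccontr)
        assume "y \<noteq> x"
        moreover have "joined T ?S y x" using IH'(2) xw(1) yS by blast
        moreover have "{y, w} \<in> edges T" using e(1) y(1) by simp
        ultimately show False using unique_neighbour[OF T(4)] xw(2,3) by metis
      qed
      then show ?thesis using y q Suc.hyps by (intro exI[of _ m]) auto
    qed
    have c5: "joined T (insert w ?S) u v" if "u \<in> insert w ?S" "v \<in> insert w ?S" for u v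
    proof -
      have *: "joined T (insert w ?S) u w" if "u \<in> ?S" for u
        using IH'(2) that xw by (intro joined_insert[of T ?S u x w]) auto
      have "joined T (insert w ?S) w w" unfolding joined_def by (intro exI[of _ "[w]"]) auto
      moreover have "joined T (insert w ?S) u v" if "u \<noteq> w" "v \<noteq> w"
      proof (rule joined_mono)
        show "joined T ?S u v" using IH'(2) that \<open>u \<in> insert w ?S\<close> \<open>v \<in> insert w ?S\<close> by auto
      qed auto
      moreover have "joined T (insert w ?S) w v" if "v \<noteq> w"
        using that \<open>v \<in> insert w ?S\<close> by (intro joined_rev[OF *]) simp
      moreover have "joined T (insert w ?S) u w" if "u \<noteq> w"
        using that \<open>u \<in> insert w ?S\<close> by (intro *) simp
      ultimately show ?thesis by (cases "u = w"; cases "v = w") simp_all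
    qed
    have "\<forall>e \<in> edges T. e \<subseteq> ?\<phi> ` {..<Suc m} \<longrightarrow> (\<exists>i. 0 < i \<and> i < Suc m \<and> e = {?\<phi> (?p i), ?\<phi> i})"
      unfolding S' using c4 by blast
    moreover have "\<forall>u \<in> ?\<phi> ` {..<Suc m}. \<forall>v \<in> ?\<phi> ` {..<Suc m}. joined T (?\<phi> ` {..<Suc m}) u v"
      unfolding S' using c5 by blast
    ultimately show ?case using c1 c2 c3 cE by (intro exI[of _ ?\<phi>] exI[of _ ?p] conjI)
  qed
  from this[of n] npos obtain \<phi> p where f: "inj_on \<phi> {..<n}" "\<phi> ` {..<n} \<subseteq> vertices T"
    "\<forall>i. 0 < i \<and> i < n \<longrightarrow> p i < i"
    and fe: "\<forall>i. 0 < i \<and> i < n \<longrightarrow> {\<phi> (p i), \<phi> i} \<in> edges T"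
    and f': "\<forall>e \<in> edges T. e \<subseteq> \<phi> ` {..<n} \<longrightarrow> (\<exists>i. 0 < i \<and> i < n \<and> e = {\<phi> (p i), \<phi> i})"
    by auto
  have im: "\<phi> ` {..<n} = vertices T"
    using f(1,2) T(1) by (intro card_subset_eq) (auto simp: card_image n_def)
  have "e \<subseteq> vertices T" if "e \<in> edges T" for e using that T(2) by (auto simp: nsets_def)
  with f' im have "\<forall>e \<in> edges T. \<exists>i. 0 < i \<and> i < n \<and> e = {\<phi> (p i), \<phi> i}" by simp
  moreover have "parent_order n p" using f(3) npos by (simp add: parent_order_def)
  moreover have "bij_betw \<phi> {..<n} (vertices T)" using f(1) im by (simp add: bij_betw_def)
  ultimately show ?thesis using fe unfolding n_def by blast
qed

section \<open>Dense sets of words contain boxes\<close>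

definition words :: "nat \<Rightarrow> 'v set \<Rightarrow> 'v list set" where
  "words k W = {xs. set xs \<subseteq> W \<and> length xs = k}"

lemma finite_words: "finite W \<Longrightarrow> finite (words k W)"
  unfolding words_def by (rule finite_lists_length_eq)

lemma card_words: "finite W \<Longrightarrow> card (words k W) = card W ^ k"
  unfolding words_def by (rule card_lists_length_eq)

lemma words_Cons [simp]: "x # ys \<in> words (Suc k) W \<longleftrightarrow> x \<in> W \<and> ys \<in> words k W"
  by (auto simp: words_def)

lemma card_Cons_decompose:
  assumes W: "finite W" and Hs: "Hs \<subseteq> words (Suc k) W"
  shows "card Hs = (\<Sum>x\<in>W. card {ys. x # ys \<in> Hs})"
proof -
  have fin: "finite {ys. x # ys \<in> Hs}" if "x \<in> W" for x
    by (rule finite_subset[OF _ finite_words[OF W, of k]]) (use Hs in \<open>auto dest: subsetD\<close>)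
  have "bij_betw (\<lambda>(x, ys). x # ys) (SIGMA x:W. {ys. x # ys \<in> Hs}) Hs"
    unfolding bij_betw_def
  proof
    show "inj_on (\<lambda>(x, ys). x # ys) (SIGMA x:W. {ys. x # ys \<in> Hs})"
      by (auto simp: inj_on_def)
    show "(\<lambda>(x, ys). x # ys) ` (SIGMA x:W. {ys. x # ys \<in> Hs}) = Hs"
    proof
      show "Hs \<subseteq> (\<lambda>(x, ys). x # ys) ` (SIGMA x:W. {ys. x # ys \<in> Hs})"
      proof
        fix zs assume zs: "zs \<in> Hs"
        with Hs have "length zs = Suc k" "set zs \<subseteq> W" by (auto simp: words_def)
        then obtain x ys where "zs = x # ys" by (cases zs) auto
        then show "zs \<in> (\<lambda>(x, ys). x # ys) ` (SIGMA x:W. {ys. x # ys \<in> Hs})"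
          using zs \<open>set zs \<subseteq> W\<close> by force
      qed
    qed auto
  qed
  then have "card Hs = card (SIGMA x:W. {ys. x # ys \<in> Hs})"
    by (simp add: bij_betw_same_card)
  also have "\<dots> = (\<Sum>x\<in>W. card {ys. x # ys \<in> Hs})"
    using W fin by (intro card_SigmaI) auto
  finally show ?thesis .
qed

text \<open>Elements below \<open>t\<close> contribute at most \<open>t\<close> each, the others at
  most \<open>b\<close>. Read from right to left, a large sum forces many heavy elements.\<close>

lemma many_heavy:
  fixes f :: "'a \<Rightarrow> real" and b t :: real
  assumes "finite W" "\<And>x. x \<in> W \<Longrightarrow> f x \<le> b" "\<And>x. x \<in> W \<Longrightarrow> 0 \<le> f x" "0 \<le> t"
  shows "(\<Sum>x\<in>W. f x) \<le> t * card W + b * card {x \<in> W. t \<le> f x}"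
proof -
  have "(\<Sum>x\<in>W. f x) \<le> (\<Sum>x\<in>W. t + (if t \<le> f x then b else 0))"
    using assms(2-4) by (intro sum_mono) (auto intro: add_increasing)
  also have "\<dots> = t * card W + b * card {x \<in> W. t \<le> f x}"
    using assms(1) by (simp add: sum.distrib sum.If_cases Int_def)
  finally show ?thesis .
qed

text \<open>A block \<open>X\<close> of boundedly many heavy vertices replaces convexity: many of the remaining words
  see at least \<open>M\<close> vertices of \<open>X\<close>, and there are only \<open>2 ^ card X\<close> ways to see them.\<close>

lemma dense_words_contain_box:
  fixes c :: real
  assumes "0 < c"
  shows "\<exists>w0. \<forall>(W :: 'v set) Hs. finite W \<and> w0 \<le> card W \<and> Hs \<subseteq> words k W \<and> c * real (card W) ^ k \<le> card Hs \<longrightarrow>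
    (\<exists>Us. length Us = k \<and> (\<forall>U \<in> set Us. U \<subseteq> W \<and> card U = M) \<and>
       (\<forall>xs. list_all2 (\<in>) xs Us \<longrightarrow> xs \<in> Hs))"
  using assms
proof (induction k arbitrary: c)
  case 0
  show ?case
  proof (intro exI[of _ 0] allI impI)
    fix W :: "'v set" and Hs
    assume "finite W \<and> 0 \<le> card W \<and> Hs \<subseteq> words 0 W \<and> c * real (card W) ^ 0 \<le> card Hs"
    then have "card Hs \<noteq> 0" "Hs \<subseteq> {[]}" using \<open>0 < c\<close> by (auto simp: words_def)
    then have "[] \<in> Hs" by (metis card.empty subset_singletonD insertI1)
    then show "\<exists>Us. length Us = 0 \<and> (\<forall>U \<in> set Us. U \<subseteq> W \<and> card U = M) \<and>
       (\<forall>xs. list_all2 (\<in>) xs Us \<longrightarrow> xs \<in> Hs)"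
      by auto
  qed
next
  case (Suc k)
  \<comment> \<open>A heavy first letter has at least the density \<open>c / 2\<close> of tails, so
    \<open>K\<close> heavy letters see a tail \<open>K * c / 2\<close> times on average. Since
    \<open>M \<le> K * c / 4\<close>, the tails that see at least \<open>M\<close> of the letters
    still have density \<open>c / 4\<close>, which is then shared among the \<open>2 ^ K\<close>
    sets of seen letters.\<close>
  define K where "K = nat \<lceil>4 * real M / c\<rceil> + 1"
  have K: "real K * c \<ge> 4 * real M" "K > 0"
  proof -
    have "real K \<ge> 4 * real M / c" unfolding K_def by linarith
    then show "real K * c \<ge> 4 * real M" using Suc.prems by (simp add: field_simps)
  qed (simp add: K_def)
  define c' where "c' = c / (4 * 2 ^ K)"
  have "c' > 0" using Suc.prems by (simp add: c'_def)
  from Suc.IH[OF this] obtain w0 where w0: "\<And>(W :: 'v set) Hs. \<lbrakk>finite W; w0 \<le> card W; Hs \<subseteq> words k W;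
      c' * real (card W) ^ k \<le> card Hs\<rbrakk> \<Longrightarrow>
    (\<exists>Us. length Us = k \<and> (\<forall>U \<in> set Us. U \<subseteq> W \<and> card U = M) \<and> (\<forall>xs. list_all2 (\<in>) xs Us \<longrightarrow> xs \<in> Hs))"
    by metis
  define w1 where "w1 = max (max w0 1) (nat \<lceil>2 * real K / c\<rceil>)"
  show ?case
  proof (intro exI[of _ w1] allI impI, elim conjE)
    fix W :: "'v set" and Hs
    assume W: "finite W" and w1: "w1 \<le> card W" and Hs: "Hs \<subseteq> words (Suc k) W"
      and dense: "c * real (card W) ^ Suc k \<le> card Hs"
    define w where "w = real (card W)"
    have wpos: "w > 0" using w1 by (simp add: w_def w1_def)
    define D where "D x = {ys. x # ys \<in> Hs}" for x
    have HsW: "ys \<in> words k W" if "x # ys \<in> Hs" for x ys using Hs that by (auto dest: subsetD)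
    then have D: "D x \<subseteq> words k W" for x by (auto simp: D_def)
    have finD: "finite (D x)" for x by (rule finite_subset[OF D finite_words[OF W]])
    have Dle: "real (card (D x)) \<le> w ^ k" for x
      using card_mono[OF finite_words[OF W] D, of x] card_words[OF W, of k]
      by (simp add: w_def flip: of_nat_power)
    define Heavy where "Heavy = {x \<in> W. c / 2 * w ^ k \<le> card (D x)}"
    have "c * w ^ Suc k \<le> (\<Sum>x\<in>W. real (card (D x)))"
      using dense card_Cons_decompose[OF W Hs] by (simp add: w_def D_def)
    also have "\<dots> \<le> c / 2 * w ^ k * card W + w ^ k * card Heavy"
      unfolding Heavy_def using W Dle wpos Suc.prems by (intro many_heavy) auto
    finally have "w ^ k * (c / 2 * w) \<le> w ^ k * card Heavy"
      by (simp add: w_def algebra_simps)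
    then have "c / 2 * w \<le> card Heavy" using wpos by (simp add: mult_le_cancel_left)
    moreover have "w \<ge> 2 * real K / c" using w1 unfolding w_def w1_def by linarith
    ultimately have "K \<le> card Heavy"
      using Suc.prems by (simp add: field_simps) 
    then obtain X where X: "X \<subseteq> Heavy" "card X = K" "finite X"
      by (metis obtain_subset_with_card_n)
    define sees where "sees ys = {x \<in> X. x # ys \<in> Hs}" for ys
    define Y where "Y = {ys \<in> words k W. real M \<le> card (sees ys)}"
    have XW: "X \<subseteq> W" using X by (auto simp: Heavy_def)
    have "real K * (c / 2 * w ^ k) = (\<Sum>x\<in>X. c / 2 * w ^ k)" using X by simp
    also have "\<dots> \<le> (\<Sum>x\<in>X. real (card (D x)))"
      using X by (intro sum_mono) (auto simp: Heavy_def)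
    also have "\<dots> = real (card (SIGMA x:X. D x))" using X finD by (simp add: card_SigmaI)
    also have "\<dots> = real (card (SIGMA ys:words k W. sees ys))"
    proof -
      have "bij_betw prod.swap (SIGMA x:X. D x) (SIGMA ys:words k W. sees ys)"
        using HsW by (intro bij_betwI[where g = prod.swap]) (auto simp: sees_def D_def)
      then show ?thesis by (simp add: bij_betw_same_card)
    qed
    also have "\<dots> = (\<Sum>ys\<in>words k W. real (card (sees ys)))"
      using X finite_words[OF W] by (simp add: card_SigmaI sees_def)
    also have "\<dots> \<le> real M * card (words k W) + real K * card Y"
    proof -
      have "card (sees ys) \<le> K" for ys
        using card_mono[of X "sees ys"] X by (auto simp: sees_def)
      then show ?thesis unfolding Y_def using finite_words[OF W]
        by (intro many_heavy) auto
    qed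
    finally have "real K * (c / 2 * w ^ k) \<le> real M * w ^ k + real K * card Y"
      by (simp add: card_words[OF W] w_def)
    moreover have "real M * w ^ k \<le> real K * c / 4 * w ^ k"
      using K wpos by (intro mult_right_mono) auto
    ultimately have "real K * (c / 4 * w ^ k) \<le> real K * card Y" by (simp add: field_simps)
    then have Y: "c / 4 * w ^ k \<le> card Y" using K(2) by (simp add: mult_le_cancel_left)
    have finY: "finite Y" unfolding Y_def using finite_words[OF W] by simp
    have "\<exists>Z \<in> Pow X. M \<le> card Z \<and> c' * w ^ k \<le> card {ys \<in> Y. sees ys = Z}"
    proof (rule ccontr)
      assume neg: "\<not> ?thesis"
      have "real (card {ys \<in> Y. sees ys = Z}) < c' * w ^ k" if "Z \<in> Pow X" for Z
      proof (cases "M \<le> card Z")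
        case False
        then have "{ys \<in> Y. sees ys = Z} = {}" by (auto simp: Y_def)
        then show ?thesis using \<open>0 < c'\<close> wpos by (metis card.empty mult_pos_pos of_nat_0 zero_less_power)
      qed (use neg that in auto)
      then have "(\<Sum>Z\<in>Pow X. real (card {ys \<in> Y. sees ys = Z})) < (\<Sum>Z\<in>Pow X. c' * w ^ k)"
        using X by (intro sum_strict_mono) auto
      also have "\<dots> = c / 4 * w ^ k" using X by (simp add: card_Pow c'_def)
      also have "(\<Sum>Z\<in>Pow X. real (card {ys \<in> Y. sees ys = Z})) = real (card Y)"
      proof -
        have "(\<Sum>Z\<in>Pow X. \<Sum>ys\<in>{ys \<in> Y. sees ys = Z}. 1) = (\<Sum>ys\<in>Y. 1::real)"
          using finY X(3) by (intro sum.group) (auto simp: sees_def)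
        then show ?thesis by simp
      qed
      finally show False using Y by simp
    qed
    then obtain Z where Z: "Z \<subseteq> X" "M \<le> card Z" "c' * w ^ k \<le> card {ys \<in> Y. sees ys = Z}" by auto
    obtain U where U: "U \<subseteq> Z" "card U = M" using Z(2) by (metis obtain_subset_with_card_n)
    have "\<exists>Us. length Us = k \<and> (\<forall>U \<in> set Us. U \<subseteq> W \<and> card U = M) \<and>
        (\<forall>xs. list_all2 (\<in>) xs Us \<longrightarrow> xs \<in> {ys \<in> Y. sees ys = Z})"
      using W w1 Z(3) by (intro w0) (auto simp: w1_def Y_def w_def)
    then obtain Us where Us: "length Us = k" "\<forall>U \<in> set Us. U \<subseteq> W \<and> card U = M"
      "\<forall>xs. list_all2 (\<in>) xs Us \<longrightarrow> xs \<in> {ys \<in> Y. sees ys = Z}" by blast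
    show "\<exists>Us. length Us = Suc k \<and> (\<forall>U \<in> set Us. U \<subseteq> W \<and> card U = M) \<and>
       (\<forall>xs. list_all2 (\<in>) xs Us \<longrightarrow> xs \<in> Hs)"
    proof (intro exI[of _ "U # Us"] conjI allI impI)
      fix xs assume "list_all2 (\<in>) xs (U # Us)"
      then obtain x ys where "xs = x # ys" "x \<in> U" "list_all2 (\<in>) ys Us"
        by (auto simp: list_all2_Cons2)
      then show "xs \<in> Hs" using Us(3) U(1) by (auto simp: sees_def)
    qed (use Us U Z XW in auto)
  qed
qed

section \<open>Absorbing vertices outside a near-clique\<close>

definition children :: "nat \<Rightarrow> (nat \<Rightarrow> nat) \<Rightarrow> nat \<Rightarrow> nat set" where
  "children n p i = {j. 0 < j \<and> j < n \<and> p j = i}"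

lemma finite_children [simp]: "finite (children n p i)"
  unfolding children_def by (rule finite_subset[of _ "{..<n}"]) auto

lemma parent_less:
  assumes "parent_order n p" "0 < i" "i < n"
  shows "p i < n"
  using assms less_trans unfolding parent_order_def by blast

lemma sum_card_children:
  assumes "parent_order n p"
  shows "(\<Sum>i<n. card (children n p i)) = n - 1"
proof -
  have "(\<Sum>i<n. card (children n p i)) = card (\<Union>i<n. children n p i)"
    by (intro card_UN_disjoint[symmetric]) (auto simp: children_def)
  also have "(\<Union>i<n. children n p i) = {1..<n}"
    using parent_less[OF assms] by (auto simp: children_def)
  finally show ?thesis by simp
qed

lemma lessThan_Collect: "{..<n} \<inter> {i. P i} = {i. i < n \<and> P i}"
  by auto

text \<open>The numbers of children add up to \<open>n - 1\<close>, and only vertices with one child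
  and leaves fall short of two, by one and by two respectively.\<close>

lemma few_leaves_many_unary:
  assumes "parent_order n p"
  shows "n \<le> card {i. i < n \<and> card (children n p i) = 1} + 2 * card {i. i < n \<and> children n p i = {}}"
proof -
  let ?c = "\<lambda>i. card (children n p i)"
  have "(\<Sum>i<n. 2::nat) \<le> (\<Sum>i<n. ?c i + (if ?c i = 1 then 1 else 0) + 2 * (if children n p i = {} then 1 else 0))"
  proof (intro sum_mono)
    fix i
    show "2 \<le> ?c i + (if ?c i = 1 then 1 else 0) + 2 * (if children n p i = {} then 1 else 0)"
    proof (cases "children n p i = {}")
      case False
      then have "0 < ?c i" by (simp add: card_gt_0_iff)
      then show ?thesis by (cases "?c i = 1") auto
    qed simp
  qed
  then have "2 * n \<le> (n - 1) + card {i. i < n \<and> ?c i = 1} + 2 * card {i. i < n \<and> children n p i = {}}"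
    by (simp add: sum.distrib sum_card_children[OF assms] sum.If_cases lessThan_Collect
        flip: sum_distrib_left)
  then show ?thesis by simp
qed

text \<open>Of the at least \<open>e * card B\<close> pairs between \<open>B\<close> and
  \<open>A\<close>, the vertices of \<open>A\<close> with fewer than \<open>l\<close> neighbours
  account for at most \<open>l * card A\<close>, and every other vertex of \<open>A\<close> for at
  most \<open>card B\<close>.\<close>

lemma many_reach:
  assumes "finite A" "finite B" "\<And>b. b \<in> B \<Longrightarrow> e \<le> card {a \<in> A. E b a}"
    and "\<And>x y. E x y \<Longrightarrow> E y x"
    and "l * card A + s * card B \<le> e * card B" "B \<noteq> {}"
  shows "s \<le> card {a \<in> A. l \<le> card {b \<in> B. E a b}}"
proof -
  let ?H = "{a \<in> A. l \<le> card {b \<in> B. E a b}}"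
  have "e * card B \<le> (\<Sum>b\<in>B. card {a \<in> A. E b a})"
    using assms(3) sum_bounded_below[of B e "\<lambda>b. card {a \<in> A. E b a}"] by (simp add: mult.commute)
  also have "\<dots> = card (SIGMA b:B. {a \<in> A. E b a})"
    using assms(1,2) by (simp add: card_SigmaI)
  also have "\<dots> = card (SIGMA a:A. {b \<in> B. E a b})"
    by (intro bij_betw_same_card[of prod.swap] bij_betwI[where g = prod.swap]) (auto dest: assms(4))
  also have "\<dots> = (\<Sum>a\<in>A. card {b \<in> B. E a b})"
    using assms(1,2) by (simp add: card_SigmaI)
  also have "\<dots> \<le> (\<Sum>a\<in>A. l + (if a \<in> ?H then card B else 0))"
  proof (intro sum_mono)
    fix a assume "a \<in> A"
    have "card {b \<in> B. E a b} \<le> card B" using assms(2) by (intro card_mono) auto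
    then show "card {b \<in> B. E a b} \<le> l + (if a \<in> ?H then card B else 0)"
      using \<open>a \<in> A\<close> by auto
  qed
  also have "\<dots> = l * card A + card ?H * card B"
    using assms(1) by (simp add: sum.distrib sum.If_cases Int_def)
  finally have "s * card B \<le> card ?H * card B" using assms(5) by linarith
  then show ?thesis using assms(2,6) by (simp add: card_gt_0_iff)
qed

text \<open>\<open>3 * d\<close> leaves move to \<open>B\<close>, their parents to a part
  \<open>A0\<close> of \<open>H\<close>, where every vertex has enough neighbours in
  \<open>B\<close>, and all other vertices to \<open>A - A0\<close>. The \<open>3 * d\<close> places
  saved are used up exactly: \<open>A\<close> may lack \<open>d\<close> vertices, \<open>A0\<close>
  has \<open>d\<close> spare ones, and the choices in \<open>A - A0\<close> lose \<open>d\<close>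
  non-neighbours.\<close>

lemma embeds_with_leaves_outside:
  assumes p: "parent_order n p" and A: "near_clique E d A" "n \<le> card A + d"
    and B: "finite B" "A \<inter> B = {}" and d: "1 \<le> d" "7 * d \<le> n"
    and Lv: "Lv \<subseteq> {i. 0 < i \<and> i < n \<and> children n p i = {}}" "card Lv = 3 * d"
    and H: "H \<subseteq> A" "4 * d \<le> card H" "\<And>a. a \<in> H \<Longrightarrow> 3 * d \<le> card {b \<in> B. E a b}"
  shows "embeds E n p (A \<union> B)"
proof -
  have finA: "finite A" using A(1) by (simp add: near_clique_def)
  have finL: "finite Lv" using Lv(1) by (rule finite_subset) auto
  have Ln: "Lv \<subseteq> {..<n}" "0 \<notin> Lv" using Lv(1) by auto
  define P where "P = p ` Lv"
  have P: "card P \<le> 3 * d" "finite P" using card_image_le[OF finL, of p] Lv(2) finL by (auto simp: P_def)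
  have pL: "p i \<notin> Lv" if "0 < i" "i < n" for i
    using that Lv(1) by (auto simp: children_def)
  have PL: "P \<inter> Lv = {}" using pL Lv(1) by (auto simp: P_def)
  have Pn: "P \<subseteq> {..<n}" using Lv(1) p by (force simp: P_def parent_order_def)
  obtain A0 where A0: "A0 \<subseteq> H" "card A0 = card P + d"
  proof (rule obtain_subset_with_card_n)
    show "card P + d \<le> card H" using H(2) P(1) by simp
  qed blast
  have A0A: "A0 \<subseteq> A" using A0(1) H(1) by blast
  have finA0: "finite A0" using finA A0A finite_subset by blast
  define X where "X i = (if i \<in> Lv then B else if i \<in> P then A0 else A - A0)" for i
  have cAA0: "card (A - A0) = card A - card A0" using A0A finA0 by (simp add: card_Diff_subset)
  have cA0A: "card A0 \<le> card A" using A0A finA by (simp add: card_mono)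
  have Xne: "X i \<inter> X j \<noteq> {} \<Longrightarrow> (i \<in> Lv \<longleftrightarrow> j \<in> Lv) \<and> (i \<in> P \<longleftrightarrow> j \<in> P)" for i j
    using PL A0A B(2) by (auto simp: X_def split: if_splits)
  show ?thesis
  proof (rule embeds_greedy[OF p, of X])
    show "X 0 \<noteq> {}"
    proof -
      have "A0 \<noteq> {}" using A0(2) d(1) by auto
      moreover have "card A0 < card A" using A0(2) P(1) A(2) d by simp
      then have "A - A0 \<noteq> {}" using finA0 card_mono[of A0 A] by auto
      ultimately show ?thesis using Ln by (simp add: X_def)
    qed
    fix i a assume i: "0 < i" "i < n" and a: "a \<in> X (p i)"
    have aA: "a \<in> A" using a pL[OF i] A0A by (auto simp: X_def split: if_splits)
    have U: "card {j. j < i \<and> X j \<inter> X i \<noteq> {}} \<le> card (S - {i})"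
      if "finite S" "{j. j < n \<and> (j \<in> Lv \<longleftrightarrow> i \<in> Lv) \<and> (j \<in> P \<longleftrightarrow> i \<in> P)} \<subseteq> S" for S
    proof (intro card_mono)
      show "{j. j < i \<and> X j \<inter> X i \<noteq> {}} \<subseteq> S - {i}"
      proof
        fix j assume j: "j \<in> {j. j < i \<and> X j \<inter> X i \<noteq> {}}"
        then have "(j \<in> Lv \<longleftrightarrow> i \<in> Lv) \<and> (j \<in> P \<longleftrightarrow> i \<in> P)" by (intro Xne) simp
        moreover have "j < n" "j \<noteq> i" using j i(2) by auto
        ultimately show "j \<in> S - {i}" using that(2) by blast
      qed
    qed (use that in simp)
    consider "i \<in> Lv" | "i \<in> P" "i \<notin> Lv" | "i \<notin> Lv" "i \<notin> P" by blast
    then show "card {j. j < i \<and> X j \<inter> X i \<noteq> {}} < card {y \<in> X i. E a y}"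
    proof cases
      case 1
      then have "a \<in> A0" using a PL pL[OF i] by (auto simp: X_def P_def split: if_splits)
      then have "3 * d \<le> card {y \<in> X i. E a y}" using H(3) A0(1) 1 by (auto simp: X_def)
      moreover have "card {j. j < i \<and> X j \<inter> X i \<noteq> {}} \<le> card (Lv - {i})"
        using 1 finL by (intro U) auto
      ultimately show ?thesis using 1 Lv(2) d finL by simp
    next
      case 2
      then have "card A0 \<le> card {y \<in> X i. E a y} + d"
        using near_clique_nbrs[OF A(1) A0A aA] by (auto simp: X_def)
      moreover have "card {j. j < i \<and> X j \<inter> X i \<noteq> {}} \<le> card (P - {i})"
        using 2 P by (intro U) auto
      moreover have "card P > 0" using 2 P by (auto simp: card_gt_0_iff)
      ultimately show ?thesis using 2 P A0(2) by simp
    next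
      case 3
      then have "card (A - A0) \<le> card {y \<in> X i. E a y} + d"
        using near_clique_nbrs[OF A(1) _ aA, of "A - A0"] by (auto simp: X_def)
      moreover have "card {j. j < i \<and> X j \<inter> X i \<noteq> {}} \<le> card (({..<n} - (Lv \<union> P)) - {i})"
        using 3 by (intro U) auto
      moreover have "card (({..<n} - (Lv \<union> P)) - {i}) = n - (3 * d + card P) - 1"
        using 3 i Ln Pn PL Lv(2) finL P(2)
        by (subst card_Diff_singleton) (auto simp: card_Diff_subset card_Un_disjoint Int_commute)
      moreover have "n - (3 * d + card P) > 0" using P(1) d by simp
      ultimately show ?thesis using cAA0 A0(2) A(2) cA0A P(1) d by linarith
    qed
  qed (use finA B(1) A0A in \<open>auto simp: X_def intro: finite_subset\<close>)
qed

text \<open>The images on \<open>S\<close> are fixed by \<open>f\<close>, and every other vertex is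
  confined to a near-clique \<open>cl i\<close>. Two classes are equal or disjoint, so only vertices
  of the same class compete. A free vertex must be adjacent to the image of its parent and to that
  of at most one child in \<open>S\<close>; each condition excludes at most \<open>d\<close>
  vertices, hence the \<open>2 * d\<close> in \<open>size\<close>.\<close>

lemma embeds_extend:
  assumes p: "parent_order n p" and sym: "\<And>x y. E x y \<Longrightarrow> E y x"
    and S: "S \<subseteq> {..<n}" "inj_on f S" "f ` S \<subseteq> V"
    and edge: "\<And>i. \<lbrakk>i \<in> S; 0 < i; p i \<in> S\<rbrakk> \<Longrightarrow> E (f (p i)) (f i)"
    and cl: "\<And>i. i < n \<Longrightarrow> i \<notin> S \<Longrightarrow> near_clique E d (cl i) \<and> cl i \<subseteq> V"
    and cl_eq: "\<And>i j. \<lbrakk>i < n; i \<notin> S; j < n; j \<notin> S; cl i \<inter> cl j \<noteq> {}\<rbrakk> \<Longrightarrow> cl i = cl j"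
    and up: "\<And>i. \<lbrakk>i < n; 0 < i; i \<notin> S; p i \<notin> S\<rbrakk> \<Longrightarrow> cl (p i) = cl i"
    and upS: "\<And>i. \<lbrakk>i < n; 0 < i; i \<notin> S; p i \<in> S\<rbrakk> \<Longrightarrow> f (p i) \<in> cl i"
    and down: "\<And>i. \<lbrakk>i < n; 0 < i; i \<in> S; p i \<notin> S\<rbrakk> \<Longrightarrow> f i \<in> cl (p i)"
    and one: "\<And>i. \<lbrakk>i < n; i \<notin> S\<rbrakk> \<Longrightarrow> card (children n p i \<inter> S) \<le> 1"
    and size: "\<And>i. \<lbrakk>i < n; i \<notin> S\<rbrakk> \<Longrightarrow>
      card {j. j < n \<and> j \<notin> S \<and> cl j = cl i} + card (f ` S \<inter> cl i) + 2 * d \<le> card (cl i)"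
  shows "embeds E n p V"
proof -
  \<comment> \<open>A child in \<open>S\<close> comes later in the order, but its image is already
    reserved, so the candidates for \<open>i\<close> look ahead to it.\<close>
  define X where "X i = (if i \<in> S then {f i} else {y \<in> cl i - f ` S. \<forall>j \<in> children n p i \<inter> S. E y (f j)})" for i
  have big: "card (cl i) \<le> card {y \<in> X i. E a y} + card (f ` S \<inter> cl i) + 2 * d"
    if i: "i < n" "i \<notin> S" and a: "a \<in> cl i" for i a
  proof -
    let ?Y = "{y \<in> cl i - f ` S. E a y}"
    have fin: "finite (cl i)" using cl[OF i] by (simp add: near_clique_def)
    have "card (cl i - f ` S) \<le> card ?Y + d"
      using near_clique_nbrs[of E d "cl i" "cl i - f ` S" a] cl[OF i] a by auto
    moreover have "card (cl i) \<le> card (cl i - f ` S) + card (f ` S \<inter> cl i)"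
      using card_Un_le[of "cl i - f ` S" "f ` S \<inter> cl i"] by (simp add: Un_Diff_Int Int_commute)
    moreover have "card ?Y \<le> card {y \<in> X i. E a y} + d"
    proof (cases "children n p i \<inter> S = {}")
      case True
      then show ?thesis using i by (simp add: X_def)
    next
      case False
      then have "card (children n p i \<inter> S) = 1" using one[OF i] by (simp add: le_Suc_eq)
      then obtain j where j: "children n p i \<inter> S = {j}" by (auto simp: card_1_singleton_iff)
      then have "j \<in> children n p i \<inter> S" by simp
      then have "f j \<in> cl i" using down[of j] i by (auto simp: children_def)
      then have "card ?Y \<le> card {y \<in> ?Y. E (f j) y} + d"
        using near_clique_nbrs[of E d "cl i" ?Y "f j"] cl[OF i] by auto
      moreover have "{y \<in> ?Y. E (f j) y} \<subseteq> {y \<in> X i. E a y}"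
        using i j sym by (auto simp: X_def)
      then have "card {y \<in> ?Y. E (f j) y} \<le> card {y \<in> X i. E a y}"
        using fin i by (intro card_mono) (auto simp: X_def)
      ultimately show ?thesis by simp
    qed
    ultimately show ?thesis by simp
  qed
  have Xcl: "X i \<subseteq> cl i - f ` S" if "i \<notin> S" for i using that by (auto simp: X_def)
  show ?thesis
  proof (rule embeds_greedy[OF p, of X])
    show "X i \<subseteq> V" if "i < n" for i using that cl[of i] S(3) by (auto simp: X_def)
    show "finite (X i)" if "i < n" for i
      using that cl[of i] by (auto simp: X_def near_clique_def)
    show "X 0 \<noteq> {}"
    proof (cases "0 \<in> S")
      case False
      have n: "0 < n" using p by (simp add: parent_order_def)
      have "0 < card {j. j < n \<and> j \<notin> S \<and> cl j = cl 0}"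
        using False n by (subst card_gt_0_iff) auto
      with size[OF n False] have lt: "card (f ` S \<inter> cl 0) + 2 * d < card (cl 0)" by simp
      then obtain a where "a \<in> cl 0" by (metis card.empty ex_in_conv not_less0)
      from big[OF n False this] lt have "card {y \<in> X 0. E a y} > 0" by simp
      then show ?thesis by (metis (no_types, lifting) card.empty empty_Collect_eq empty_iff less_irrefl)
    qed (simp add: X_def)
    fix i a assume i: "0 < i" "i < n" and a: "a \<in> X (p i)"
    have pi: "p i < n" using parent_less[OF p i] .
    show "card {j. j < i \<and> X j \<inter> X i \<noteq> {}} < card {y \<in> X i. E a y}"
    proof (cases "i \<in> S")
      case True
      have "E a (f i)"
        using a edge[OF True i(1)] True i by (cases "p i \<in> S") (auto simp: X_def children_def)
      then have "{y \<in> X i. E a y} = {f i}" using True by (auto simp: X_def)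
      moreover have "{j. j < i \<and> X j \<inter> X i \<noteq> {}} = {}"
      proof -
        have "X j \<inter> X i = {}" if "j < i" for j
        proof (cases "j \<in> S")
          case jS: True
          then have "f j \<noteq> f i" using inj_onD[OF S(2) _ jS True] that by blast
          then show ?thesis using True jS by (simp add: X_def)
        next
          case jS: False
          have "f i \<notin> X j" using Xcl[OF jS] True by blast
          then show ?thesis using True by (simp add: X_def)
        qed
        then show ?thesis by blast
      qed
      ultimately show ?thesis by simp
    next
      case False
      have acl: "a \<in> cl i"
        using a up[OF i(2,1) False] upS[OF i(2,1) False] by (cases "p i \<in> S") (auto simp: X_def)
      have "{j. j < i \<and> X j \<inter> X i \<noteq> {}} \<subseteq> {j. j < n \<and> j \<notin> S \<and> cl j = cl i} - {i}"
      proof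
        fix j assume j: "j \<in> {j. j < i \<and> X j \<inter> X i \<noteq> {}}"
        then obtain y where y: "y \<in> X j" "y \<in> X i" and ji: "j < n" "j \<noteq> i" using i by auto
        have yi: "y \<in> cl i" "y \<notin> f ` S" using y(2) Xcl[OF False] by auto
        then have jS: "j \<notin> S" using y(1) by (auto simp: X_def)
        then have "y \<in> cl j" using y(1) Xcl by auto
        then have "cl j \<inter> cl i \<noteq> {}" using yi(1) by blast
        from cl_eq[OF ji(1) jS i(2) False this]
        show "j \<in> {j. j < n \<and> j \<notin> S \<and> cl j = cl i} - {i}" using ji jS by simp
      qed
      then have "card {j. j < i \<and> X j \<inter> X i \<noteq> {}} \<le> card ({j. j < n \<and> j \<notin> S \<and> cl j = cl i} - {i})"
        by (intro card_mono) auto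
      also have "\<dots> < card {j. j < n \<and> j \<notin> S \<and> cl j = cl i}"
        using i False by (intro card_Diff1_less) simp_all
      finally show ?thesis using size[OF i(2) False] big[OF i(2) False acl] by linarith
    qed
  qed
qed

text \<open>Hall's condition in its crudest form: every set is at least as large as the whole index
  set, so representatives can be picked one by one.\<close>

lemma distinct_representatives:
  assumes "finite J" "\<And>j. j \<in> J \<Longrightarrow> card J \<le> card (N j)"
  shows "\<exists>g. inj_on g J \<and> (\<forall>j \<in> J. g j \<in> N j)"
  using assms
proof (induction J)
  case (insert x J)
  then obtain g where g: "inj_on g J" "\<forall>j \<in> J. g j \<in> N j"
    by (metis Suc_leD card_insert_disjoint insertCI)
  have "card (g ` J) < card (N x)"
    using insert card_image_le[OF insert(1), of g] by simp (metis Suc_le_lessD le_trans less_Suc_eq_le not_less)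
  then have "\<not> N x \<subseteq> g ` J" using insert(1) card_mono[of "g ` J" "N x"] by auto
  then obtain y where "y \<in> N x" "y \<notin> g ` J" by blast
  with g insert(2) show ?case
    by (intro exI[of _ "g(x := y)"]) (auto simp: inj_on_def image_iff)
qed simp

section \<open>Bare paths\<close>

definition unary :: "nat \<Rightarrow> (nat \<Rightarrow> nat) \<Rightarrow> nat set" where
  "unary n p = {i. i < n \<and> card (children n p i) = 1}"

lemma unary_unique: "\<lbrakk>p i = p j; p i \<in> unary n p; 0 < i; 0 < j; i < n; j < n\<rbrakk> \<Longrightarrow> i = j"
proof -
  assume a: "p i = p j" "p i \<in> unary n p" "0 < i" "0 < j" "i < n" "j < n"
  then obtain c where "children n p (p i) = {c}" by (auto simp: unary_def card_1_singleton_iff)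
  moreover have "i \<in> children n p (p i)" "j \<in> children n p (p i)" using a by (auto simp: children_def)
  ultimately show "i = j" by simp
qed

text \<open>A vertex \<open>t\<close> is missed if it is the root, not unary, a child of a non-unary
  vertex, a grandchild of one through a unary parent, or the child of a unary root. With
  \<open>l\<close> leaves these are at most \<open>1\<close>, \<open>2 * l\<close>,
  \<open>2 * l\<close>, \<open>2 * l\<close> and \<open>1\<close> vertices; the fourth kind is
  mapped injectively by \<open>p\<close> into the third.\<close>

lemma many_bare_paths:
  assumes p: "parent_order n p"
  shows "n \<le> card {t. 0 < t \<and> t \<in> unary n p \<and> 0 < p t \<and> p t \<in> unary n p \<and> p (p t) \<in> unary n p}
    + 6 * card {i. i < n \<and> children n p i = {}} + 2"
proof -
  let ?U = "unary n p" and ?l = "card {i. i < n \<and> children n p i = {}}"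
  let ?G = "{t. 0 < t \<and> t \<in> ?U \<and> 0 < p t \<and> p t \<in> ?U \<and> p (p t) \<in> ?U}"
  let ?B = "{t. 0 < t \<and> t < n \<and> p t \<notin> ?U}"
  let ?C = "{t. 0 < t \<and> t < n \<and> 0 < p t \<and> p t \<in> ?U \<and> p (p t) \<notin> ?U}"
  let ?Z = "{t. 0 < t \<and> t < n \<and> p t = 0 \<and> p t \<in> ?U}"
  have finU: "finite ?U" "?U \<subseteq> {..<n}" by (auto simp: unary_def)
  have U: "n \<le> card ?U + 2 * ?l" using few_leaves_many_unary[OF p] by (simp add: unary_def)
  have "card ({..<n} - ?U) = n - card ?U" using finU by (simp add: card_Diff_subset)
  then have 1: "card ({..<n} - ?U) \<le> 2 * ?l" using U by simp
  have "card ?B = (\<Sum>i\<in>{..<n} - ?U. card (children n p i))"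
  proof -
    have "?B = (\<Union>i\<in>{..<n} - ?U. children n p i)"
      using parent_less[OF p] by (auto simp: children_def)
    moreover have "card (\<Union>i\<in>{..<n} - ?U. children n p i) = (\<Sum>i\<in>{..<n} - ?U. card (children n p i))"
      by (intro card_UN_disjoint) (auto simp: children_def)
    ultimately show ?thesis by simp
  qed
  moreover have "(\<Sum>i\<in>{..<n} - ?U. card (children n p i)) + card ?U = n - 1"
  proof -
    have "(\<Sum>i\<in>?U. card (children n p i)) = card ?U" by (simp add: unary_def)
    then show ?thesis
      using sum.subset_diff[OF finU(2), of "\<lambda>i. card (children n p i)"] sum_card_children[OF p] by simp
  qed
  ultimately have 2: "card ?B \<le> 2 * ?l" using U by linarith
  have "inj_on p ?C" by (rule inj_onI) (rule unary_unique[of p _ _ n]; auto)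
  moreover have "p ` ?C \<subseteq> ?B" using parent_less[OF p] by auto
  ultimately have "card ?C \<le> card ?B" by (intro card_inj_on_le) auto
  then have 3: "card ?C \<le> 2 * ?l" using 2 by simp
  have "inj_on p ?Z" by (rule inj_onI) (rule unary_unique[of p _ _ n]; auto)
  then have 4: "card ?Z \<le> card {0::nat}" by (intro card_inj_on_le) auto
  have finG: "finite ?G" by (rule finite_subset[OF _ finU(1)]) auto
  have "{..<n} \<subseteq> ?G \<union> ({0} \<union> (({..<n} - ?U) \<union> (?B \<union> (?C \<union> ?Z))))" by auto
  then have "card {..<n} \<le> card (?G \<union> ({0} \<union> (({..<n} - ?U) \<union> (?B \<union> (?C \<union> ?Z)))))"
    using finG by (intro card_mono) auto
  also have "\<dots> \<le> card ?G + (card {0::nat} + (card ({..<n} - ?U) + (card ?B + (card ?C + card ?Z))))"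
    by (meson add_le_mono card_Un_le le_refl order_trans)
  finally show ?thesis using 1 2 3 4 by simp
qed

lemma residue_class_large:
  assumes "finite G" "4 * m \<le> card G + 3"
  shows "\<exists>c. m \<le> card {t \<in> G. D t mod 4 = (c::nat)}"
proof (rule ccontr)
  assume "\<not> ?thesis"
  then have lt: "card {t \<in> G. D t mod 4 = c} < m" for c by (simp add: not_le)
  have "(\<Sum>c<4. card {t \<in> G. D t mod 4 = c}) = card G"
  proof -
    have "(\<lambda>t. D t mod 4) ` G \<subseteq> {..<4}" by auto
    then show ?thesis
      using assms(1) sum.group[of G "{..<4}" "\<lambda>t. D t mod 4" "\<lambda>_. 1::nat"] by simp
  qed
  moreover have "(\<Sum>c<4. card {t \<in> G. D t mod 4 = c}) \<le> (\<Sum>c<4::nat. m - 1)"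
  proof (rule sum_mono)
    show "card {t \<in> G. D t mod 4 = c} \<le> m - 1" for c using lt[of c] by linarith
  qed
  ultimately show False using assms(2) lt[of 0] by simp
qed

lemma add_mod_4_neq: "0 < d \<Longrightarrow> d < 4 \<Longrightarrow> (x + d) mod 4 \<noteq> x mod (4 :: nat)"
  by (simp add: mod_eq_dvd_iff_nat nat_dvd_not_less)

text \<open>For \<open>3 * d\<close> bare paths the middle vertex \<open>t\<close> goes to
  \<open>B\<close>, and its neighbours \<open>p t\<close> and \<open>ch t\<close> go to distinct
  neighbours of its image in \<open>A\<close>. The chosen \<open>t\<close> have equal depth modulo
  \<open>4\<close>, which keeps the triples disjoint and non-adjacent. These \<open>9 * d\<close>
  vertices take only \<open>6 * d\<close> places in \<open>A\<close>, so \<open>n - 3 * d\<close>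
  places plus the loss \<open>2 * d\<close> of \<open>embeds_extend\<close> fit into
  \<open>A\<close>.\<close>

lemma embeds_with_paths_outside:
  assumes p: "parent_order n p" and sym: "\<And>x y. E x y \<Longrightarrow> E y x"
    and A: "near_clique E d A" "n \<le> card A + d"
    and B: "finite B" "A \<inter> B = {}" "3 * d \<le> card B" and d: "1 \<le> d"
    and e: "\<And>b. b \<in> B \<Longrightarrow> 6 * d \<le> card {a \<in> A. E b a}"
    and G: "G \<subseteq> {t. 0 < t \<and> t \<in> unary n p \<and> 0 < p t \<and> p t \<in> unary n p \<and> p (p t) \<in> unary n p}"
      "12 * d \<le> card G + 3"
  shows "embeds E n p (A \<union> B)"
proof -
  define D where "D = parent_rec p (\<lambda>_. Suc) (0::nat)"
  have D: "D i = Suc (D (p i))" if "0 < i" "i < n" for i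
    using parent_rec_parent[OF p that] by (simp add: D_def)
  have finG: "finite G" by (rule finite_subset[OF G(1)]) (auto simp: unary_def)
  have Gn: "t < n" "0 < t" "p t < n" "0 < p t" "t \<in> unary n p" "p t \<in> unary n p" "p (p t) \<in> unary n p"
    "D t = Suc (Suc (D (p (p t))))" "D (p t) = Suc (D (p (p t)))" if "t \<in> G" for t
  proof -
    show *: "t < n" "0 < t" "p t < n" "0 < p t" "t \<in> unary n p" "p t \<in> unary n p" "p (p t) \<in> unary n p"
      using that G(1) by (auto simp: unary_def)
    show "D t = Suc (Suc (D (p (p t))))" "D (p t) = Suc (D (p (p t)))"
      using D[OF *(2,1)] D[OF *(4,3)] by simp_all
  qed
  obtain c where c: "3 * d \<le> card {t \<in> G. D t mod 4 = c}"
    using residue_class_large[OF finG, of "3 * d" D] G(2) by auto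
  from ex_subset_card[OF c] obtain L where L: "L \<subseteq> {t \<in> G. D t mod 4 = c}" "card L = 3 * d"
    by blast
  have LG: "L \<subseteq> G" and Dc: "\<And>t. t \<in> L \<Longrightarrow> D t mod 4 = c" using L(1) by auto
  have finL: "finite L" using LG finG finite_subset by blast
  define ch where "ch t = (THE j. children n p t = {j})" for t
  have ch: "children n p t = {ch t}" if "t \<in> unary n p" for t
  proof -
    from that obtain j where "children n p t = {j}" by (auto simp: unary_def card_1_singleton_iff)
    then show ?thesis unfolding ch_def by simp
  qed
  have ch': "0 < ch t" "ch t < n" "p (ch t) = t" if "t \<in> unary n p" for t
    using ch[OF that] by (auto simp: children_def)
  have Du: "D (ch t) = Suc (D t)" if "t \<in> L" for t
    using D[of "ch t"] ch'[of t] Gn(5)[of t] that LG by auto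
  have unary_eq: "i = ch t" if "t \<in> unary n p" "0 < i" "i < n" "p i = t" for i t
    using ch[OF that(1)] that by (auto simp: children_def)
  have "card L \<le> card B" using L(2) B(3) by simp
  then obtain w where w: "inj_on w L" "w ` L \<subseteq> B" using card_le_inj[OF finL B(1)] by auto
  have cJ: "card (L \<times> (UNIV :: bool set)) = 6 * d" using L(2) by (simp add: card_cartesian_product)
  \<comment> \<open>The second component distinguishes the two neighbours of \<open>t\<close>:
    \<open>False\<close> stands for the parent, \<open>True\<close> for the child.\<close>
  have "\<exists>g. inj_on g (L \<times> (UNIV :: bool set)) \<and> (\<forall>j \<in> L \<times> UNIV. g j \<in> {a \<in> A. E (w (fst j)) a})"
  proof (rule distinct_representatives)
    fix j assume "j \<in> L \<times> (UNIV :: bool set)"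
    then have "w (fst j) \<in> B" using w(2) by auto
    then show "card (L \<times> (UNIV :: bool set)) \<le> card {a \<in> A. E (w (fst j)) a}" using e cJ by simp
  qed (use finL in simp)
  then obtain g where g: "inj_on g (L \<times> (UNIV :: bool set))"
    "\<forall>j \<in> L \<times> UNIV. g j \<in> {a \<in> A. E (w (fst j)) a}"
    by blast
  have gA: "g (t, b) \<in> A" "E (w t) (g (t, b))" if "t \<in> L" for t b
    using g(2)[rule_format, of "(t, b)"] that by auto
  define S where "S = L \<union> p ` L \<union> ch ` L"
  define f where "f i = (if i \<in> L then w i else if i \<in> p ` L then g (ch i, False) else g (p i, True))" for i
  have injp: "inj_on p L" 
  proof (rule inj_onI)
    fix s t assume st: "s \<in> L" "t \<in> L" "p s = p t"
    then have "s \<in> G" "t \<in> G" using LG by auto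
    then show "s = t" using unary_unique[OF st(3) Gn(6)] Gn(1,2) by blast
  qed
  have chp: "ch (p t) = t" if "t \<in> L" for t
  proof -
    have tG: "t \<in> G" using that LG by blast
    show ?thesis using unary_eq[OF Gn(6)[OF tG] Gn(2)[OF tG] Gn(1)[OF tG] refl] by (rule HOL.sym)
  qed
  have pch: "p (ch t) = t" if "t \<in> L" for t using ch'(3) Gn(5) that LG by blast
  have injch: "inj_on ch L" by (rule inj_on_inverseI[of _ p]) (rule pch)
  have Dp: "D t = Suc (D (p t))" if "t \<in> L" for t using Gn[of t] that LG by auto
  have disj: "t \<noteq> p s" "t \<noteq> ch s" "p t \<noteq> ch s" if "t \<in> L" "s \<in> L" for t s
  proof -
    have DD: "D t mod 4 = D s mod 4" using Dc that by simp
    show "t \<noteq> p s"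
    proof
      assume "t = p s"
      then have "D s = D t + 1" using Dp that by simp
      with DD show False using add_mod_4_neq[of 1 "D t"] by simp
    qed
    show "t \<noteq> ch s"
    proof
      assume "t = ch s"
      then have "D t = D s + 1" using Du that by simp
      with DD show False using add_mod_4_neq[of 1 "D s"] by simp
    qed
    show "p t \<noteq> ch s"
    proof
      assume "p t = ch s"
      then have "D t = D s + 2" using Du Dp that by simp
      with DD show False using add_mod_4_neq[of 2 "D s"] by simp
    qed
  qed
  have f_L: "f t = w t" "f (p t) = g (t, False)" "f (ch t) = g (t, True)" if "t \<in> L" for t
  proof -
    have "p t \<notin> L" using disj(1)[OF _ that] by blast
    moreover have "ch t \<notin> L" using disj(2)[OF _ that] by blast
    moreover have "ch t \<notin> p ` L" using disj(3)[OF _ that] by (metis imageE)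
    ultimately show "f t = w t" "f (p t) = g (t, False)" "f (ch t) = g (t, True)"
      using that chp[OF that] pch[OF that] by (simp_all add: f_def)
  qed
  have fin3: "finite (p ` L)" "finite (ch ` L)" using finL by auto
  have dj: "L \<inter> p ` L = {}" "(L \<union> p ` L) \<inter> ch ` L = {}"
    using disj by blast+
  have "card S = card (L \<union> p ` L) + card (ch ` L)"
    unfolding S_def using finL dj(2) by (intro card_Un_disjoint) simp_all
  also have "card (L \<union> p ` L) = card L + card (p ` L)"
    using finL dj(1) by (intro card_Un_disjoint) simp_all
  finally have cS: "card S = 9 * d"
    using card_image[OF injp] card_image[OF injch] L(2) by simp
  have Sn: "S \<subseteq> {..<n}" using Gn ch' LG by (force simp: S_def)
  have SfA: "f i \<in> A" if "i \<in> S" "i \<notin> L" for i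
    using that f_L gA by (auto simp: S_def)
  have LfB: "f i \<in> B" if "i \<in> L" for i using that f_L w(2) by auto
  have injf: "inj_on f S"
  proof -
    have 1: "inj_on f L" using w(1) f_L by (auto simp: inj_on_def)
    have 2: "inj_on f (p ` L)" "inj_on f (ch ` L)"
    proof -
      have "t = s" if "g (t, b) = g (s, b)" "t \<in> L" "s \<in> L" for t s b
        using inj_onD[OF g(1) that(1)] that(2,3) by simp
      then show "inj_on f (p ` L)" "inj_on f (ch ` L)" using f_L by (fastforce simp: inj_on_def)+
    qed
    have 3: "f (p t) \<noteq> f (ch s)" if "t \<in> L" "s \<in> L" for t s
      using inj_onD[OF g(1), of "(t, False)" "(s, True)"] f_L that by auto
    have 4: "f ` L \<inter> f ` (p ` L \<union> ch ` L) = {}"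
    proof -
      have "f ` L \<subseteq> B" using LfB by blast
      moreover have "f ` (p ` L \<union> ch ` L) \<subseteq> A"
      proof
        fix y assume "y \<in> f ` (p ` L \<union> ch ` L)"
        then obtain t where "t \<in> L" "y = f (p t) \<or> y = f (ch t)" by auto
        then show "y \<in> A" using f_L gA by auto
      qed
      ultimately show ?thesis using B(2) by blast
    qed
    have 5: "f ` (p ` L) \<inter> f ` (ch ` L) = {}" using 3 by (auto simp: image_iff)
    have "inj_on f (p ` L \<union> ch ` L)"
      using 2 5 by (subst inj_on_Un) blast
    then show ?thesis
      using 1 4 unfolding S_def Un_assoc by (subst inj_on_Un) blast
  qed
  show ?thesis
  proof (rule embeds_extend[OF p sym Sn injf, where d = d and cl = "\<lambda>_. A"])
    show "f ` S \<subseteq> A \<union> B" using SfA LfB by auto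
    fix i assume i: "i \<in> S" "0 < i" "p i \<in> S"
    then have "i < n" using Sn by auto
    show "E (f (p i)) (f i)"
    proof -
      consider t where "t \<in> L" "i = t" | t where "t \<in> L" "i = p t" | t where "t \<in> L" "i = ch t"
        using i(1) by (auto simp: S_def)
      then show ?thesis
      proof cases
        case (1 t)
        then show ?thesis using f_L(1,2)[OF 1(1)] sym gA by simp
      next
        case (2 t)
        have Dt: "D t = Suc (Suc (D (p (p t))))" using Gn(8)[of t] LG 2(1) by blast
        obtain s where s: "s \<in> L" "p (p t) = s \<or> p (p t) = p s \<or> p (p t) = ch s"
          using i(3) 2(2) by (auto simp: S_def)
        then have "D (p (p t)) = D s \<or> Suc (D (p (p t))) = D s \<or> D (p (p t)) = Suc (D s)"
          using Dp Du by metis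
        then have "D t = D s + 2 \<or> D t = D s + 1 \<or> D t = D s + 3" using Dt by linarith
        moreover have "D t mod 4 = D s mod 4" using Dc 2(1) s(1) by simp
        ultimately have False using add_mod_4_neq[of 1 "D s"] add_mod_4_neq[of 2 "D s"] add_mod_4_neq[of 3 "D s"] by auto
        then show ?thesis ..
      next
        case (3 t)
        then show ?thesis using f_L(1,3)[OF 3(1)] gA pch by simp
      qed
    qed
  next
    fix i assume i: "i < n" "0 < i" "i \<notin> S" "p i \<in> S"
    have "p i \<notin> L" using i unary_eq[of "p i" i] Gn(5)[of "p i"] LG by (auto simp: S_def)
    then show "f (p i) \<in> A" using SfA i by blast
  next
    fix i assume i: "i < n" "0 < i" "i \<in> S" "p i \<notin> S"
    have "i \<notin> L" using i by (auto simp: S_def)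
    then show "f i \<in> A" using SfA i by blast
  next
    fix i assume i: "i < n" "i \<notin> S"
    \<comment> \<open>Outside \<open>S\<close> only grandparents \<open>p (p t)\<close> can have
      children in \<open>S\<close>. This is why bare paths also ask for a unary grandparent.\<close>
    show "card (children n p i \<inter> S) \<le> 1"
    proof (cases "i \<in> p ` p ` L")
      case True
      then have "i \<in> unary n p" using Gn LG by auto
      then have "card (children n p i) = 1" by (simp add: unary_def)
      then show ?thesis by (metis card_mono finite_children inf_le1)
    next
      case False
      then have "children n p i \<inter> S = {}" using i pch by (auto simp: S_def children_def)
      then show ?thesis by simp
    qed
    have "{j. j < n \<and> j \<notin> S \<and> A = A} = {..<n} - S" by auto
    moreover have "card ({..<n} - S) = n - 9 * d"
      using Sn cS finite_subset[OF Sn] by (simp add: card_Diff_subset)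
    moreover have "9 * d \<le> n" using card_mono[OF _ Sn] cS by simp
    moreover have "card (f ` S \<inter> A) \<le> 6 * d"
    proof -
      have "f ` S \<inter> A \<subseteq> g ` (L \<times> UNIV)" using f_L LfB B(2) by (auto simp: S_def)
      then have "card (f ` S \<inter> A) \<le> card (g ` (L \<times> (UNIV :: bool set)))"
        using finL by (intro card_mono) auto
      also have "\<dots> = 6 * d" using card_image[OF g(1)] cJ by simp
      finally show ?thesis .
    qed
    ultimately show "card {j. j < n \<and> j \<notin> S \<and> A = A} + card (f ` S \<inter> A) + 2 * d \<le> card A"
      using A(2) by simp
  qed (use A in auto)
qed

text \<open>A tree with fewer than \<open>3 * d\<close> non-root leaves has at least
  \<open>n - 18 * d - 2\<close> bare paths, more than the \<open>12 * d\<close> needed because of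
  \<open>40 * d \<le> n\<close>. If there are enough leaves, the last hypothesis provides
  \<open>4 * d\<close> vertices of \<open>A\<close> with \<open>3 * d\<close> neighbours in
  \<open>B\<close> each, as places for the parents of leaves.\<close>

lemma embeds_absorb:
  assumes p: "parent_order n p" and sym: "\<And>x y. E x y \<Longrightarrow> E y x"
    and A: "near_clique E d A" "n \<le> card A + d"
    and B: "finite B" "A \<inter> B = {}" "3 * d \<le> card B" and d: "1 \<le> d" "40 * d \<le> n"
    and e: "\<And>b. b \<in> B \<Longrightarrow> e \<le> card {a \<in> A. E b a}" "6 * d \<le> e"
      "3 * d * card A + 4 * d * card B \<le> e * card B"
  shows "embeds E n p (A \<union> B)"
proof (cases "3 * d \<le> card {i. 0 < i \<and> i < n \<and> children n p i = {}}")
  case True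
  from ex_subset_card[OF this] obtain Lv where
    Lv: "Lv \<subseteq> {i. 0 < i \<and> i < n \<and> children n p i = {}}" "card Lv = 3 * d"
    by blast
  let ?H = "{a \<in> A. 3 * d \<le> card {b \<in> B. E a b}}"
  have "B \<noteq> {}" using B(3) d(1) by auto
  then have "4 * d \<le> card ?H"
    using A(1) B(1) e sym by (intro many_reach[of A B e]) (auto simp: near_clique_def)
  then show ?thesis
    using d by (intro embeds_with_leaves_outside[OF p A B(1,2) _ _ Lv, of ?H]) auto
next
  case False
  let ?G = "{t. 0 < t \<and> t \<in> unary n p \<and> 0 < p t \<and> p t \<in> unary n p \<and> p (p t) \<in> unary n p}"
  have "card {i. i < n \<and> children n p i = {}} \<le> card (insert 0 {i. 0 < i \<and> i < n \<and> children n p i = {}})"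
    by (intro card_mono) auto
  also have "\<dots> \<le> Suc (card {i. 0 < i \<and> i < n \<and> children n p i = {}})" by (rule card_insert_le_m1) auto
  finally have "n \<le> card ?G + 18 * d + 2" using False many_bare_paths[OF p] by simp
  then have G: "12 * d \<le> card ?G + 3" using d by simp
  have "6 * d \<le> card {a \<in> A. E b a}" if "b \<in> B" for b using e(1)[OF that] e(2) by simp
  from embeds_with_paths_outside[OF p sym A B d(1) this subset_refl G]
  show ?thesis .
qed

section \<open>Embedding through a single vertex\<close>

definition tree_nbrs :: "nat \<Rightarrow> (nat \<Rightarrow> nat) \<Rightarrow> nat \<Rightarrow> nat set" where
  "tree_nbrs n p x = children n p x \<union> (if x = 0 then {} else {p x})"

text \<open>\<open>x\<close> is the largest index that has at least half of all vertices as
  descendants. Children have larger indices than their parents, so every branch below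
  \<open>x\<close> has less than half of the vertices, while the branch above has at most half.
  \<open>lab i\<close> names the branch of \<open>i\<close> by the neighbour of \<open>x\<close> in
  it.\<close>

lemma centroid:
  assumes p: "parent_order n p"
  shows "\<exists>x lab. x < n \<and> (\<forall>i<n. i \<noteq> x \<longrightarrow> lab i \<in> tree_nbrs n p x) \<and> (\<forall>c \<in> tree_nbrs n p x. lab c = c) \<and>
    (\<forall>i. 0 < i \<and> i < n \<and> i \<noteq> x \<and> p i \<noteq> x \<longrightarrow> lab i = lab (p i)) \<and>
    (\<forall>c \<in> tree_nbrs n p x. 2 * card {i. i < n \<and> i \<noteq> x \<and> lab i = c} \<le> n)"
proof -
  have n: "0 < n" using p by (simp add: parent_order_def)
  have plt: "p i < i" if "0 < i" "i < n" for i using p that by (simp add: parent_order_def)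
  define anc where "anc x = parent_rec p (\<lambda>i b. i = x \<or> b) (x = 0)" for x
  have anc0: "anc x 0 \<longleftrightarrow> x = 0" for x by (simp add: anc_def)
  have ancS: "anc x i \<longleftrightarrow> i = x \<or> anc x (p i)" if "0 < i" "i < n" for x i
    using parent_rec_parent[OF p that] by (simp add: anc_def)
  have anc_refl: "anc x x" if "x < n" for x using that anc0 ancS by (cases "x = 0") auto
  define desc where "desc x = {i. i < n \<and> anc x i}" for x
  have anc_root: "anc 0 i" if "i < n" for i
    using that
  proof (induction i rule: less_induct)
    case (less i)
    then show ?case using anc0 ancS[of i 0] plt[of i] by (cases "i = 0") auto
  qed
  define x where "x = Max {x. x < n \<and> n \<le> 2 * card (desc x)}"
  have "desc 0 = {..<n}" using anc_root by (auto simp: desc_def)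
  then have "0 \<in> {x. x < n \<and> n \<le> 2 * card (desc x)}" using n by simp
  then have "x \<in> {x. x < n \<and> n \<le> 2 * card (desc x)}" unfolding x_def by (intro Max_in) auto
  then have x: "x < n" "n \<le> 2 * card (desc x)" by auto
  have xmax: "2 * card (desc c) < n" if "x < c" "c < n" for c
  proof (rule ccontr)
    assume "\<not> ?thesis"
    then have "c \<le> x" unfolding x_def using that by (intro Max_ge) auto
    with that show False by simp
  qed
  \<comment> \<open>The root starts with \<open>p x\<close>, the name of the branch above
    \<open>x\<close>; every child of \<open>x\<close> opens a branch of its own.\<close>
  define lab where "lab = parent_rec p (\<lambda>i l. if p i = x then i else l) (p x)"
  have lab0: "lab 0 = p x" by (simp add: lab_def)
  have labS: "lab i = (if p i = x then i else lab (p i))" if "0 < i" "i < n" for i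
    unfolding lab_def by (subst parent_rec_parent[OF p that]) simp
  have child: "0 < c" "c < n" "p c = x" "x < c" if "c \<in> children n p x" for c
    using that plt by (auto simp: children_def)
  have 1: "lab i \<in> tree_nbrs n p x" if "i < n" "i \<noteq> x" for i
    using that
  proof (induction i rule: less_induct)
    case (less i)
    show ?case
    proof (cases "i = 0 \<or> p i = x")
      case True
      then show ?thesis using less.prems labS[of i] lab0
        by (cases "i = 0") (auto simp: tree_nbrs_def children_def)
    next
      case False
      then show ?thesis using less.prems labS[of i] less.IH[of "p i"] plt[of i] by simp
    qed
  qed
  have up: "lab i = p x" if "i < n" "\<not> anc x i" for i
    using that
  proof (induction i rule: less_induct)
    case (less i)
    show ?case
    proof (cases "i = 0")
      case False
      then have "\<not> anc x (p i)" "p i < i" "p i \<noteq> x" using less.prems ancS[of i x] plt[of i] anc_refl[OF x(1)] by auto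
      then show ?thesis using False labS[of i] less.IH[of "p i"] less.prems by simp
    qed (simp add: lab0)
  qed
  have anc_le: "x \<le> i" if "i < n" "anc x i" for i
    using that
  proof (induction i rule: less_induct)
    case (less i)
    show ?case
    proof (cases "i = 0")
      case True
      then show ?thesis using less.prems anc0 by simp
    next
      case False
      then show ?thesis using less.prems ancS[of i x] plt[of i] less.IH[of "p i"] by auto
    qed
  qed
  have 2: "lab c = c" if "c \<in> tree_nbrs n p x" for c
  proof (cases "c \<in> children n p x")
    case True
    then show ?thesis using labS child by simp
  next
    case False
    then have "x \<noteq> 0" "c = p x" using that by (auto simp: tree_nbrs_def split: if_splits)
    then show ?thesis using up[of "p x"] anc_le[of "p x"] plt[of x] x(1) by fastforce
  qed
  have 3: "lab i = lab (p i)" if "0 < i" "i < n" "p i \<noteq> x" for i using labS that by simp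
  have desc_child: "anc c i" if "c \<in> children n p x" "i < n" "i \<noteq> x" "lab i = c" for i c
    using that(2-)
  proof (induction i rule: less_induct)
    case (less i)
    show ?case
    proof (cases "i = 0")
      case True
      then have "p x = c" "x \<noteq> 0" using less.prems lab0 by auto
      then show ?thesis using plt[of x] x(1) child(4)[OF that(1)] by simp
    next
      case False
      then show ?thesis using less.prems labS[of i] ancS[of i c] less.IH[of "p i"] plt[of i] by (cases "p i = x") auto
    qed
  qed
  have down: "x < lab i" if "i < n" "i \<noteq> x" "anc x i" for i
    using that
  proof (induction i rule: less_induct)
    case (less i)
    have "i \<noteq> 0" using less.prems anc0[of x] by (cases "i = 0") auto
    with less show ?case using less.prems labS[of i] ancS[of i x] less.IH[of "p i"] plt[of i] by (cases "p i = x") auto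
  qed
  have 4: "2 * card {i. i < n \<and> i \<noteq> x \<and> lab i = c} \<le> n" if "c \<in> tree_nbrs n p x" for c
  proof (cases "c \<in> children n p x")
    case True
    then have "{i. i < n \<and> i \<noteq> x \<and> lab i = c} \<subseteq> desc c" using desc_child by (auto simp: desc_def)
    then have "card {i. i < n \<and> i \<noteq> x \<and> lab i = c} \<le> card (desc c)" by (intro card_mono) (auto simp: desc_def)
    then show ?thesis using xmax[of c] child[OF True] by simp
  next
    case False
    then have c: "x \<noteq> 0" "c = p x" using that by (auto simp: tree_nbrs_def split: if_splits)
    have "{i. i < n \<and> i \<noteq> x \<and> lab i = c} \<subseteq> {..<n} - desc x"
      using down plt[of x] x(1) c by (fastforce simp: desc_def)
    then have "card {i. i < n \<and> i \<noteq> x \<and> lab i = c} \<le> card ({..<n} - desc x)" by (intro card_mono) auto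
    also have "\<dots> = n - card (desc x)" by (subst card_Diff_subset) (auto simp: desc_def)
    finally show ?thesis using x(2) by linarith
  qed
  show ?thesis
    using x(1) 1 2 3 4 by (intro exI[of _ x] exI[of _ lab]) blast
qed

text \<open>Elements are added until the weight reaches \<open>s\<close>, and the last one
  overshoots by less than \<open>b\<close>. As every weight is at least one, at most
  \<open>s\<close> elements are used.\<close>

lemma subset_with_weight:
  fixes s :: nat
  assumes "finite C" "\<And>c. c \<in> C \<Longrightarrow> 1 \<le> w c \<and> w c \<le> b" "1 \<le> b" "s \<le> (\<Sum>c\<in>C. w c)"
  shows "\<exists>J \<subseteq> C. s \<le> (\<Sum>c\<in>J. w c) \<and> card J \<le> s \<and> (\<Sum>c\<in>J. w c) < s + b"
  using assms(4)
proof (induction s)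
  case 0
  then show ?case using assms(3) by (intro exI[of _ "{}"]) auto
next
  case (Suc s)
  then obtain J where J: "J \<subseteq> C" "s \<le> (\<Sum>c\<in>J. w c)" "card J \<le> s" "(\<Sum>c\<in>J. w c) < s + b" by auto
  show ?case
  proof (cases "Suc s \<le> (\<Sum>c\<in>J. w c)")
    case True
    then show ?thesis using J by (intro exI[of _ J]) auto
  next
    case False
    then have eq: "(\<Sum>c\<in>J. w c) = s" using J by simp
    then have "J \<noteq> C" using Suc.prems by auto
    then obtain c where c: "c \<in> C" "c \<notin> J" using J(1) by blast
    have "finite J" using J(1) assms(1) finite_subset by blast
    then show ?thesis using J c eq assms(2)[OF c(1)] by (intro exI[of _ "insert c J"]) auto
  qed
qed

text \<open>The centroid goes to \<open>v\<close>, its tree neighbours go to neighbours of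
  \<open>v\<close>, and each branch stays in the near-clique that contains its first vertex. One set
  \<open>A js\<close> receives the branches outside \<open>J\<close>, the other sets those in
  \<open>J\<close>. Both groups have total weight at least \<open>3 * d\<close>, so no near-clique
  receives more than \<open>n - 1 - 3 * d\<close> vertices.\<close>

lemma embeds_through_vertex:
  assumes p: "parent_order n p" and sym: "\<And>x y. E x y \<Longrightarrow> E y x" and irr: "\<not> E v v"
    and A: "\<And>i. i < \<kappa> \<Longrightarrow> near_clique E d (A i)" "\<And>i. i < \<kappa> \<Longrightarrow> n \<le> card (A i) + d"
      "\<And>i j. \<lbrakk>i < \<kappa>; j < \<kappa>; i \<noteq> j\<rbrakk> \<Longrightarrow> A i \<inter> A j = {}"
    and deg: "n + 5 * d \<le> (\<Sum>i<\<kappa>. card {a \<in> A i. E v a})"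
    and d: "1 \<le> d" "14 * d \<le> n" "\<kappa> * (3 * d) \<le> n"
  shows "embeds E n p (insert v (\<Union>i<\<kappa>. A i))"
proof (cases "\<exists>i<\<kappa>. n + d \<le> card (A i)")
  case True
  then obtain i where i: "i < \<kappa>" "n + d \<le> card (A i)" by blast
  have "embeds E n p (A i)" using embeds_near_clique[OF p A(1)[OF i(1)] i(2)] .
  then show ?thesis by (rule embeds_mono) (use i in auto)
next
  case False
  then have small: "card (A i) < n + d" if "i < \<kappa>" for i using that by auto
  define N where "N i = {a \<in> A i. E v a}" for i
  have finA: "finite (A i)" if "i < \<kappa>" for i using A(1)[OF that] by (simp add: near_clique_def)
  have finN: "finite (N i)" if "i < \<kappa>" for i using finA[OF that] by (simp add: N_def)
  have "\<kappa> \<noteq> 0" using deg d by (intro notI) simp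
  \<comment> \<open>\<open>A js\<close> has the most neighbours of \<open>v\<close>. They number at
    least \<open>3 * d\<close> by averaging and fewer than \<open>n + d\<close> by the size of
    \<open>A js\<close>, so the other sets contain more than \<open>4 * d\<close> neighbours of
    \<open>v\<close>.\<close>
  obtain js where js: "js < \<kappa>" "\<And>i. i < \<kappa> \<Longrightarrow> card (N i) \<le> card (N js)"
  proof -
    have "Max ((\<lambda>i. card (N i)) ` {..<\<kappa>}) \<in> (\<lambda>i. card (N i)) ` {..<\<kappa>}"
      using \<open>\<kappa> \<noteq> 0\<close> by (intro Max_in) auto
    then obtain j where "j < \<kappa>" "card (N j) = Max ((\<lambda>i. card (N i)) ` {..<\<kappa>})" by auto
    then show ?thesis by (intro that[of j]) auto
  qed
  have degN: "n + 5 * d \<le> (\<Sum>i<\<kappa>. card (N i))" using deg by (simp add: N_def)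
  have "(\<Sum>i<\<kappa>. card (N i)) \<le> \<kappa> * card (N js)"
    using sum_bounded_above[of "{..<\<kappa>}" "\<lambda>i. card (N i)" "card (N js)"] js(2) by simp
  then have "\<kappa> * (3 * d) \<le> \<kappa> * card (N js)" using degN d by linarith
  then have ds: "3 * d \<le> card (N js)" using \<open>\<kappa> \<noteq> 0\<close> by simp
  have dsn: "card (N js) < n + d"
    using small[OF js(1)] card_mono[OF finA[OF js(1)], of "N js"] by (auto simp: N_def)
  define NO where "NO = (\<Union>i\<in>{..<\<kappa>} - {js}. N i)"
  have finNO: "finite NO" using finN by (auto simp: NO_def)
  have "card NO = (\<Sum>i\<in>{..<\<kappa>} - {js}. card (N i))"
    unfolding NO_def using finN A(3) by (intro card_UN_disjoint) (auto simp: N_def)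
  then have sumN: "n + 5 * d \<le> card NO + card (N js)"
    using degN js(1) by (simp add: sum.remove[of "{..<\<kappa>}" js])
  obtain x lab where x: "x < n" and lab: "\<And>i. i < n \<Longrightarrow> i \<noteq> x \<Longrightarrow> lab i \<in> tree_nbrs n p x"
    and labc: "\<And>c. c \<in> tree_nbrs n p x \<Longrightarrow> lab c = c"
    and labp: "\<And>i. \<lbrakk>0 < i; i < n; i \<noteq> x; p i \<noteq> x\<rbrakk> \<Longrightarrow> lab i = lab (p i)"
    and half: "\<And>c. c \<in> tree_nbrs n p x \<Longrightarrow> 2 * card {i. i < n \<and> i \<noteq> x \<and> lab i = c} \<le> n"
    using centroid[OF p] by blast
  define C where "C = tree_nbrs n p x"
  have C: "c < n" "c \<noteq> x" if "c \<in> C" for c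
  proof -
    have plt: "p c < c" if "0 < c" "c < n" for c using p that by (simp add: parent_order_def)
    have "c < n \<and> c \<noteq> x"
    proof (cases "c \<in> children n p x")
      case True
      then show ?thesis using plt[of c] by (auto simp: children_def)
    next
      case False
      then have "x \<noteq> 0" "c = p x" using that by (auto simp: C_def tree_nbrs_def split: if_splits)
      then show ?thesis using plt[of x] x by simp
    qed
    then show "c < n" "c \<noteq> x" by auto
  qed
  have finC: "finite C" by (simp add: C_def tree_nbrs_def)
  define w where "w c = card {i. i < n \<and> i \<noteq> x \<and> lab i = c}" for c
  have sumw: "(\<Sum>c\<in>C. w c) = n - 1"
  proof -
    have "(\<Sum>c\<in>C. \<Sum>i\<in>{i \<in> {..<n} - {x}. lab i = c}. 1) = (\<Sum>i\<in>{..<n} - {x}. 1::nat)"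
      using finC lab by (intro sum.group) (auto simp: C_def)
    moreover have "{i \<in> {..<n} - {x}. lab i = c} = {i. i < n \<and> i \<noteq> x \<and> lab i = c}" for c by auto
    ultimately show ?thesis using x by (simp add: w_def)
  qed
  have w1: "1 \<le> w c \<and> w c \<le> n div 2" if "c \<in> C" for c
  proof -
    have "c \<in> {i. i < n \<and> i \<noteq> x \<and> lab i = c}" using C[OF that] labc that by (simp add: C_def)
    then have "0 < w c" unfolding w_def by (subst card_gt_0_iff) auto
    then show ?thesis using half[of c] that by (simp add: w_def C_def)
  qed
  have wge: "card J \<le> (\<Sum>c\<in>J. w c)" if "J \<subseteq> C" for J
    using sum_bounded_below[of J 1 w] w1 that by auto
  have nd: "1 \<le> n div 2" "3 * d \<le> (\<Sum>c\<in>C. w c)" using sumw d by simp_all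
  obtain J0 where J0: "J0 \<subseteq> C" "3 * d \<le> (\<Sum>c\<in>J0. w c)" "card J0 \<le> 3 * d" "(\<Sum>c\<in>J0. w c) < 3 * d + n div 2"
    using subset_with_weight[OF finC _ nd] w1 by blast
  \<comment> \<open>If \<open>J0\<close> leaves more branches than \<open>A js\<close> has
    neighbours of \<open>v\<close>, further branches join \<open>J\<close> until exactly
    \<open>card (N js)\<close> remain. These are at least \<open>3 * d\<close> branches, so they
    weigh at least \<open>3 * d\<close>.\<close>
  obtain J where J: "J \<subseteq> C" "3 * d \<le> (\<Sum>c\<in>J. w c)" "(\<Sum>c\<in>J. w c) + 3 * d \<le> n - 1"
    "card J \<le> card NO" "card (C - J) \<le> card (N js)"
  proof (cases "card C \<le> card J0 + card (N js)")
    case True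
    then have "card (C - J0) \<le> card (N js)" using J0(1) finC by (simp add: card_Diff_subset finite_subset)
    moreover have "card J0 \<le> card NO" using J0(3) sumN dsn by simp
    ultimately show ?thesis using that[of J0] J0 d by simp
  next
    case False
    define h where "h = card C - card (N js)"
    have h: "card J0 \<le> h" "h \<le> card C" "h + card (N js) = card C" using False by (auto simp: h_def)
    have finJ0: "finite J0" using J0(1) finC finite_subset by blast
    have "h - card J0 \<le> card (C - J0)" using h J0(1) finC finJ0 by (simp add: card_Diff_subset)
    from ex_subset_card[OF this] obtain R where R: "R \<subseteq> C - J0" "card R = h - card J0" by blast
    have finR: "finite R" using R(1) finC finite_subset by blast
    have cJ: "card (J0 \<union> R) = h" using R h(1) finJ0 finR by (subst card_Un_disjoint) auto
    have JC: "J0 \<union> R \<subseteq> C" using J0(1) R(1) by auto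
    have "card (C - (J0 \<union> R)) = card (N js)"
      using JC cJ finJ0 finR h(3) by (simp add: card_Diff_subset)
    moreover have "(\<Sum>c\<in>C - (J0 \<union> R). w c) + (\<Sum>c\<in>J0 \<union> R. w c) = n - 1"
      using sum.subset_diff[OF JC finC, of w] sumw by simp
    moreover have "card (C - (J0 \<union> R)) \<le> (\<Sum>c\<in>C - (J0 \<union> R). w c)" by (rule wge) auto
    moreover have "(\<Sum>c\<in>J0. w c) \<le> (\<Sum>c\<in>J0 \<union> R. w c)" using finJ0 finR by (intro sum_mono2) auto
    moreover have "card C \<le> n - 1" using wge[of C] sumw by simp
    ultimately show ?thesis
      using that[of "J0 \<union> R"] JC cJ J0(2) ds sumN h by simp
  qed
  have finJ: "finite J" using J(1) finC finite_subset by blast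
  obtain fJ where fJ: "inj_on fJ J" "fJ ` J \<subseteq> NO" using card_le_inj[OF finJ finNO J(4)] by auto
  obtain fR where fR: "inj_on fR (C - J)" "fR ` (C - J) \<subseteq> N js"
    using card_le_inj[of "C - J" "N js"] finC finN[OF js(1)] J(5) by auto
  define f where "f i = (if i = x then v else if i \<in> J then fJ i else fR i)" for i
  define g where "g c = (if c \<in> J then (SOME i. i < \<kappa> \<and> i \<noteq> js \<and> fJ c \<in> N i) else js)" for c
  have gJ: "g c < \<kappa> \<and> g c \<noteq> js \<and> fJ c \<in> N (g c)" if "c \<in> J" for c
  proof -
    have "\<exists>i. i < \<kappa> \<and> i \<noteq> js \<and> fJ c \<in> N i" using fJ(2) that by (auto simp: NO_def)
    from someI_ex[OF this] show ?thesis using that by (simp add: g_def)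
  qed
  have g: "g c < \<kappa>" "f c \<in> N (g c)" if "c \<in> C" for c
    using gJ[of c] fR(2) js(1) that C[OF that] by (auto simp: f_def g_def)
  have fA: "f c \<in> A (g c)" "E v (f c)" "f c \<noteq> v" if "c \<in> C" for c
    using g[OF that] irr by (auto simp: N_def)
  have Adisj: "i = j" if "i < \<kappa>" "j < \<kappa>" "a \<in> A i" "a \<in> A j" for i j a using A(3)[of i j] that by blast
  have fx: "f x = v" by (simp add: f_def)
  define S where "S = insert x C"
  have gl: "g (lab i) < \<kappa>" if "i < n" "i \<notin> S" for i using g lab[of i] that by (auto simp: S_def C_def)
  show ?thesis
  \<comment> \<open>The vertex \<open>v\<close> may lie in one of the sets \<open>A i\<close>, so it
    is taken out of the classes.\<close>
  proof (rule embeds_extend[OF p sym, where S = S and f = f and d = d and cl = "\<lambda>i. A (g (lab i)) - {v}"])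
    show "S \<subseteq> {..<n}" using x C by (auto simp: S_def)
    have ne: "f c \<noteq> f c'" if "c \<in> J" "c' \<in> C - J" for c c'
    proof
      assume eq: "f c = f c'"
      have "c \<in> C" "c' \<in> C" using that J(1) by auto
      then have "g c = g c'" using Adisj[OF g(1) g(1) fA(1) fA(1)[of c', folded eq]] by blast
      then show False using gJ[OF that(1)] that by (simp add: g_def)
    qed
    have "inj_on f J" using fJ(1) C J(1) by (auto simp: inj_on_def f_def subset_iff)
    moreover have "inj_on f (C - J)" using fR(1) C by (auto simp: inj_on_def f_def)
    ultimately have "inj_on f (J \<union> (C - J))" using ne by (subst inj_on_Un) blast
    moreover have "J \<union> (C - J) = C" using J(1) by blast
    ultimately have "inj_on f C" by simp
    moreover have "f x \<notin> f ` (C - {x})" using fA(3) fx by force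
    ultimately show "inj_on f S" by (simp add: S_def)
    show "f ` S \<subseteq> insert v (\<Union>i<\<kappa>. A i)" using fA(1) g(1) fx unfolding S_def by blast
    {
      fix i assume i: "i \<in> S" "0 < i" "p i \<in> S"
      then have "i < n" using x C by (auto simp: S_def)
      have plt: "p j < j" if "0 < j" "j < n" for j using p that by (simp add: parent_order_def)
      consider "i = x" | "i \<in> C" "p i = x" | "i \<in> C" "p i \<in> C" "i \<noteq> x" "p i \<noteq> x"
        using i C by (auto simp: S_def)
      then show "E (f (p i)) (f i)"
      proof cases
        case 1
        then have "p x \<in> C" using i plt[of x] x by (auto simp: S_def)
        then show ?thesis using 1 fA(2) sym C by (auto simp: f_def)
      next
        case 2
        then show ?thesis using fA(2)[of i] C(2) by (auto simp: f_def)
      next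
        case 3
        \<comment> \<open>Two neighbours of the centroid cannot be parent and child:
          \<open>i\<close> would be the parent of \<open>x\<close>, and then \<open>p i\<close> is
          too small to be a child of \<open>x\<close>.\<close>
        then have "i = p x" "0 < x" by (auto simp: C_def tree_nbrs_def children_def split: if_splits)
        then have "p i < i" "i < x" using plt[of i] plt[of x] i(2) x \<open>i < n\<close> by auto
        then have "p (p i) \<noteq> x \<or> p i = 0" using plt[of "p i"] \<open>i < n\<close> by (cases "p i = 0") auto
        then have False using 3 \<open>i = p x\<close> \<open>p i < i\<close> by (auto simp: C_def tree_nbrs_def children_def split: if_splits)
        then show ?thesis ..
      qed
    next
      fix i assume i: "i < n" "i \<notin> S"
      show "near_clique E d (A (g (lab i)) - {v}) \<and> A (g (lab i)) - {v} \<subseteq> insert v (\<Union>i<\<kappa>. A i)"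
        using near_clique_subset[OF A(1)[OF gl[OF i]]] gl[OF i] by auto
    next
      fix i j assume ij: "i < n" "i \<notin> S" "j < n" "j \<notin> S" "(A (g (lab i)) - {v}) \<inter> (A (g (lab j)) - {v}) \<noteq> {}"
      then obtain a where "a \<in> A (g (lab i))" "a \<in> A (g (lab j))" by blast
      then have "g (lab i) = g (lab j)" using Adisj gl ij by metis
      then show "A (g (lab i)) - {v} = A (g (lab j)) - {v}" by simp
    next
      fix i assume i: "i < n" "0 < i" "i \<notin> S" "p i \<notin> S"
      then have "lab i = lab (p i)" by (intro labp) (auto simp: S_def)
      then show "A (g (lab (p i))) - {v} = A (g (lab i)) - {v}" by simp
    next
      fix i assume i: "i < n" "0 < i" "i \<notin> S" "p i \<in> S"
      then have "p i \<noteq> x" by (auto simp: S_def C_def tree_nbrs_def children_def)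
      then have "lab i = p i" "p i \<in> C" using labp[of i] labc[of "p i"] i by (auto simp: S_def C_def)
      then show "f (p i) \<in> A (g (lab i)) - {v}" using fA by simp
    next
      fix i assume i: "i < n" "0 < i" "i \<in> S" "p i \<notin> S"
      then have "p i \<noteq> x" "i \<noteq> x" by (auto simp: S_def C_def tree_nbrs_def)
      then have "i \<in> C" "lab (p i) = i" using labp[of i] labc[of i] i by (auto simp: S_def C_def)
      then show "f i \<in> A (g (lab (p i))) - {v}" using fA by simp
    next
      fix i assume i: "i < n" "i \<notin> S"
      \<comment> \<open>Children of \<open>x\<close> have their parent in \<open>S\<close>, so only
        the parent of \<open>p x\<close> can be outside \<open>S\<close> with a child in
        \<open>S\<close>.\<close>
      have "children n p i \<inter> S \<subseteq> {p x}"
        using i by (auto simp: S_def C_def tree_nbrs_def children_def split: if_splits)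
      then show "card (children n p i \<inter> S) \<le> 1"
        using card_mono[of "{p x}"] by fastforce
    next
      fix i assume i: "i < n" "i \<notin> S"
      define l where "l = g (lab i)"
      have l: "l < \<kappa>" using gl[OF i] by (simp add: l_def)
      let ?Cl = "{c \<in> C. g c = l}"
      have eq: "g (lab j) = l" if jS: "j < n" "j \<notin> S" and eqA: "A (g (lab j)) - {v} = A l - {v}" for j
      proof -
        have "A l - {v} \<noteq> {}"
        proof
          assume "A l - {v} = {}"
          then have "A l \<subseteq> {v}" by blast
          then have "card (A l) \<le> 1" using card_mono[of "{v}" "A l"] by simp
          then show False using A(2)[OF l] d by simp
        qed
        then obtain a where "a \<in> A l" "a \<in> A (g (lab j))" using eqA by blast
        then show ?thesis using Adisj[OF gl[OF jS] l] by blast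
      qed
      have "{j. j < n \<and> j \<notin> S \<and> A (g (lab j)) - {v} = A l - {v}} \<subseteq> (\<Union>c\<in>?Cl. {i. i < n \<and> i \<noteq> x \<and> lab i = c} - {c})"
      proof
        fix j assume "j \<in> {j. j < n \<and> j \<notin> S \<and> A (g (lab j)) - {v} = A l - {v}}"
        then have j: "j < n" "j \<notin> S" "g (lab j) = l" using eq by auto
        then have "lab j \<in> C" "j \<noteq> x" "j \<noteq> lab j" using lab[of j] by (auto simp: S_def C_def)
        then show "j \<in> (\<Union>c\<in>?Cl. {i. i < n \<and> i \<noteq> x \<and> lab i = c} - {c})" using j by blast
      qed
      then have "card {j. j < n \<and> j \<notin> S \<and> A (g (lab j)) - {v} = A l - {v}} \<le> card (\<Union>c\<in>?Cl. {i. i < n \<and> i \<noteq> x \<and> lab i = c} - {c})"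
        using finC by (intro card_mono) auto
      also have "\<dots> \<le> (\<Sum>c\<in>?Cl. card ({i. i < n \<and> i \<noteq> x \<and> lab i = c} - {c}))"
        using finC by (intro card_UN_le) auto
      also have "\<dots> = (\<Sum>c\<in>?Cl. w c - 1)"
        using C labc by (intro sum.cong) (auto simp: w_def C_def)
      finally have c1: "card {j. j < n \<and> j \<notin> S \<and> A (g (lab j)) - {v} = A l - {v}} \<le> (\<Sum>c\<in>?Cl. w c - 1)" .
      have "f ` S \<inter> (A l - {v}) \<subseteq> f ` ?Cl"
      proof
        fix y assume "y \<in> f ` S \<inter> (A l - {v})"
        then obtain s where s: "s \<in> C" "y = f s" "y \<in> A l" using fx by (auto simp: S_def)
        then have "g s = l" using Adisj[OF g(1) l fA(1)] by simp
        then show "y \<in> f ` ?Cl" using s by blast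
      qed
      then have "card (f ` S \<inter> (A l - {v})) \<le> card (f ` ?Cl)" using finC by (intro card_mono) auto
      also have "\<dots> \<le> card ?Cl" using finC by (intro card_image_le) auto
      finally have c2: "card (f ` S \<inter> (A l - {v})) \<le> (\<Sum>c\<in>?Cl. 1)" by simp
      have "(\<Sum>c\<in>?Cl. w c - 1) + (\<Sum>c\<in>?Cl. 1) = (\<Sum>c\<in>?Cl. w c)"
      proof (subst sum.distrib[symmetric], rule sum.cong)
        show "w c - 1 + 1 = w c" if "c \<in> ?Cl" for c using w1[of c] that by simp
      qed simp
      moreover have "(\<Sum>c\<in>?Cl. w c) + 3 * d \<le> n - 1"
      proof (cases "l = js")
        case True
        then have "?Cl \<subseteq> C - J" using gJ by auto
        then have "(\<Sum>c\<in>?Cl. w c) \<le> (\<Sum>c\<in>C - J. w c)" using finC by (intro sum_mono2) auto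
        then show ?thesis using J(2) sum.subset_diff[OF J(1) finC, of w] sumw by simp
      next
        case False
        then have "?Cl \<subseteq> J" by (auto simp: g_def)
        then have "(\<Sum>c\<in>?Cl. w c) \<le> (\<Sum>c\<in>J. w c)" using finJ by (intro sum_mono2) auto
        then show ?thesis using J(3) by simp
      qed
      moreover have "card (A l) \<le> card (A l - {v}) + 1"
        using diff_card_le_card_Diff[of "{v}" "A l"] by simp
      then have "n \<le> card (A l - {v}) + d + 1" using A(2)[OF l] by linarith
      ultimately show "card {j. j < n \<and> j \<notin> S \<and> A (g (lab j)) - {v} = A (g (lab i)) - {v}} +
          card (f ` S \<inter> (A (g (lab i)) - {v})) + 2 * d \<le> card (A (g (lab i)) - {v})"
        using c1 c2 x unfolding l_def by linarith
    }
  qed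
qed

section \<open>Near-cliques and stability\<close>

abbreviation nonadj :: "('v \<Rightarrow> 'v \<Rightarrow> bool) \<Rightarrow> 'v \<Rightarrow> 'v \<Rightarrow> bool" where
  "nonadj E x y \<equiv> x \<noteq> y \<and> \<not> E x y"

abbreviation nonadj_parts :: "('v \<Rightarrow> 'v \<Rightarrow> bool) \<Rightarrow> 'v set list \<Rightarrow> bool" where
  "nonadj_parts E Us \<equiv> sorted_wrt (\<lambda>U U'. \<forall>x \<in> U. \<forall>y \<in> U'. nonadj E x y) Us"

text \<open>Each blue clique is counted once per ordering; as sets of words these cliques can be fed
  into \<open>dense_words_contain_box\<close>.\<close>

definition cocliques :: "('v \<Rightarrow> 'v \<Rightarrow> bool) \<Rightarrow> nat \<Rightarrow> 'v set \<Rightarrow> 'v list set" where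
  "cocliques E k W = {xs \<in> words k W. sorted_wrt (nonadj E) xs}"

text \<open>A blue complete multipartite graph with part sizes \<open>ms\<close>. Non-adjacency
  includes distinctness, so the parts are automatically disjoint.\<close>

definition has_parts :: "('v \<Rightarrow> 'v \<Rightarrow> bool) \<Rightarrow> nat list \<Rightarrow> 'v set \<Rightarrow> bool" where
  "has_parts E ms W \<longleftrightarrow> (\<exists>Us. map card Us = ms \<and> (\<forall>U \<in> set Us. finite U \<and> U \<subseteq> W) \<and>
     nonadj_parts E Us)"

lemma cocliques_Suc:
  "x # ys \<in> cocliques E (Suc k) W \<longleftrightarrow> x \<in> W \<and> ys \<in> cocliques E k {y \<in> W. nonadj E x y}"
  by (auto simp: cocliques_def words_def)

lemma card_cocliques_Suc:
  assumes "finite W"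
  shows "card (cocliques E (Suc k) W) = (\<Sum>x\<in>W. card (cocliques E k {y \<in> W. nonadj E x y}))"
proof -
  have "card (cocliques E (Suc k) W) = (\<Sum>x\<in>W. card {ys. x # ys \<in> cocliques E (Suc k) W})"
    using assms by (intro card_Cons_decompose) (auto simp: cocliques_def)
  also have "\<dots> = (\<Sum>x\<in>W. card (cocliques E k {y \<in> W. nonadj E x y}))"
    by (intro sum.cong) (simp_all add: cocliques_Suc)
  finally show ?thesis .
qed

lemma card_cocliques_1: "card (cocliques E (Suc 0) W) = card W"
proof -
  have "cocliques E (Suc 0) W = (\<lambda>x. [x]) ` W"
    by (auto simp: cocliques_def words_def length_Suc_conv)
  then show ?thesis by (simp add: card_image inj_on_def)
qed

text \<open>Whenever a set is removed, some remaining vertex has fewer than \<open>n\<close>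
  neighbours among the rest, since minimum degree \<open>n\<close> would admit the tree greedily.
  The removed vertices add at most their number to its degree in \<open>W\<close>.\<close>

lemma low_degree_vertices:
  assumes p: "parent_order n p" and W: "finite W" "\<not> embeds E n p W" and "s \<le> card W"
  shows "\<exists>S \<subseteq> W. card S = s \<and> (\<forall>x \<in> S. card {y \<in> W. E x y} < n + s)"
  using assms(4)
proof (induction s)
  case (Suc s)
  then obtain S where S: "S \<subseteq> W" "card S = s" "\<forall>x \<in> S. card {y \<in> W. E x y} < n + s" by auto
  have finS: "finite S" using S(1) W(1) finite_subset by blast
  have "card S < card W" using S(2) Suc.prems by simp
  then have ne: "W - S \<noteq> {}" using S(1) by auto
  have "\<exists>x \<in> W - S. card {y \<in> W - S. E x y} < n"
  proof (rule ccontr)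
    assume neg: "\<not> ?thesis"
    have "embeds E n p (W - S)"
    proof (rule embeds_greedy[OF p, where X = "\<lambda>_. W - S"])
      fix i a assume i: "0 < i" "i < n" "a \<in> W - S"
      have "card {j. j < i \<and> (W - S) \<inter> (W - S) \<noteq> {}} \<le> card {..<i}" by (intro card_mono) auto
      then show "card {j. j < i \<and> (W - S) \<inter> (W - S) \<noteq> {}} < card {y \<in> W - S. E a y}"
        using neg i by force
    qed (use W ne in auto)
    then show False using W(2) embeds_mono by blast
  qed
  then obtain x where x: "x \<in> W - S" "card {y \<in> W - S. E x y} < n" by blast
  have "card {y \<in> W. E x y} \<le> card ({y \<in> W - S. E x y} \<union> S)" using W finS by (intro card_mono) auto
  also have "\<dots> \<le> card {y \<in> W - S. E x y} + card S" by (rule card_Un_le)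
  finally have "card {y \<in> W. E x y} < n + Suc s" using x(2) S(2) by simp
  then show ?case using S x finS by (intro exI[of _ "insert x S"]) auto
qed (intro exI[of _ "{}"]; simp)

text \<open>Vertices with more than \<open>\<delta> * n\<close> non-neighbours are deleted. Each
  accounts for at least \<open>\<delta> * n / 2\<close> ordered blue pairs; the factor
  \<open>1 / 2\<close> pays for the vertex itself among its non-neighbours.\<close>

lemma near_clique_if_few_nonadj:
  assumes W: "finite W" and \<delta>: "0 < \<delta>" "2 \<le> \<delta> * real n"
    and few: "card (cocliques E 2 W) \<le> c * real n ^ 2"
  shows "\<exists>A \<subseteq> W. near_clique E (nat \<lfloor>\<delta> * n\<rfloor>) A \<and> card W - 2 * c / \<delta> * n \<le> card A"
proof -
  define Bad where "Bad = {x \<in> W. \<delta> * n < card {y \<in> W. \<not> E x y}}"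
  have finB: "finite Bad" using W by (simp add: Bad_def)
  have deg: "\<delta> * n / 2 \<le> card {y \<in> W. nonadj E x y}" if "x \<in> Bad" for x
  proof -
    have "card {y \<in> W. \<not> E x y} \<le> card (insert x {y \<in> W. nonadj E x y})" using W by (intro card_mono) auto
    also have "\<dots> \<le> card {y \<in> W. nonadj E x y} + 1" by (simp add: card_insert_if W)
    finally have "real (card {y \<in> W. \<not> E x y}) \<le> card {y \<in> W. nonadj E x y} + 1" by linarith
    then show ?thesis using that \<delta>(2) by (auto simp: Bad_def)
  qed
  have "card Bad * (\<delta> * n / 2) \<le> (\<Sum>x\<in>Bad. real (card {y \<in> W. nonadj E x y}))"
    using sum_bounded_below[of Bad "\<delta> * n / 2"] deg by auto
  also have "\<dots> \<le> (\<Sum>x\<in>W. real (card {y \<in> W. nonadj E x y}))"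
    using W by (intro sum_mono2) (auto simp: Bad_def)
  also have "\<dots> = card (cocliques E 2 W)"
    using card_cocliques_Suc[OF W, of E 1] by (simp add: card_cocliques_1 numeral_2_eq_2)
  also have "\<dots> \<le> c * real n ^ 2" by (rule few)
  finally have "n * (card Bad * \<delta>) \<le> n * (2 * c * n)" by (simp add: power2_eq_square algebra_simps)
  moreover have "0 < real n" using \<delta> by (metis less_eq_real_def mult_zero_right not_le of_nat_0_le_iff zero_less_numeral)
  ultimately have Bad: "card Bad \<le> 2 * c / \<delta> * n" using \<delta>(1) by (simp add: field_simps)
  have "near_clique E (nat \<lfloor>\<delta> * n\<rfloor>) (W - Bad)"
    unfolding near_clique_def
  proof (intro conjI ballI)
    fix a assume a: "a \<in> W - Bad"
    have "card {y \<in> W - Bad. \<not> E a y} \<le> card {y \<in> W. \<not> E a y}" using W by (intro card_mono) auto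
    also have "\<dots> \<le> nat \<lfloor>\<delta> * n\<rfloor>" using a by (intro le_nat_floor) (auto simp: Bad_def)
    finally show "card {y \<in> W - Bad. \<not> E a y} \<le> nat \<lfloor>\<delta> * n\<rfloor>" .
  qed (use W in simp)
  moreover have "real (card (W - Bad)) = card W - card Bad"
    using W finB by (simp add: card_Diff_subset Bad_def of_nat_diff card_mono)
  ultimately show ?thesis using Bad by (intro exI[of _ "W - Bad"]) auto
qed

text \<open>Induction on \<open>k\<close>: a vertex of low red degree has a blue neighbourhood only
  about \<open>n\<close> smaller than \<open>W\<close>, in which the tree still cannot be embedded.
  Either one such neighbourhood contains the near-clique, or linearly many of them contain many blue
  cliques, each extended by the vertex itself.\<close>

lemma near_clique_or_dense:
  fixes \<delta> :: real
  assumes "2 \<le> k" "0 < \<delta>"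
  shows "\<exists>\<gamma> c n0. 0 < \<gamma> \<and> 0 < c \<and> (\<forall>n p E (W :: 'v set). n0 \<le> n \<and> parent_order n p \<and> finite W \<and> \<not> embeds E n p W \<and>
      (1 - \<gamma>) * (real k - 1) * n \<le> card W \<longrightarrow>
      (\<exists>A \<subseteq> W. near_clique E (nat \<lfloor>\<delta> * n\<rfloor>) A \<and> (1 - \<delta>) * n \<le> card A) \<or> c * real n ^ k \<le> card (cocliques E k W))"
  using assms(1)
proof (induction k rule: nat_induct_at_least)
  case base
  show ?case
  proof (rule exI[of _ "\<delta> / 2"], rule exI[of _ "\<delta>\<^sup>2 / 4"], rule exI[of _ "nat \<lceil>2 / \<delta>\<rceil>"], intro conjI allI impI; (elim conjE)?)
    show "0 < \<delta> / 2" "0 < \<delta>\<^sup>2 / 4" using assms(2) by auto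
    fix n p E and W :: "'v set"
    assume n: "nat \<lceil>2 / \<delta>\<rceil> \<le> n" and "parent_order n p" and W: "finite W" "(1 - \<delta> / 2) * (real 2 - 1) * n \<le> card W"
    have "2 / \<delta> \<le> n" using n by linarith
    then have n2: "2 \<le> \<delta> * n" using assms(2) by (simp add: field_simps)
    show "(\<exists>A \<subseteq> W. near_clique E (nat \<lfloor>\<delta> * n\<rfloor>) A \<and> (1 - \<delta>) * n \<le> card A) \<or> \<delta>\<^sup>2 / 4 * real n ^ 2 \<le> card (cocliques E 2 W)"
    proof (rule disjCI)
      assume "\<not> \<delta>\<^sup>2 / 4 * real n ^ 2 \<le> card (cocliques E 2 W)"
      then obtain A where A: "A \<subseteq> W" "near_clique E (nat \<lfloor>\<delta> * n\<rfloor>) A" "card W - 2 * (\<delta>\<^sup>2 / 4) / \<delta> * n \<le> card A"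
        using near_clique_if_few_nonadj[OF W(1) assms(2) n2, of E "\<delta>\<^sup>2 / 4"] by auto
      have eq: "2 * (\<delta>\<^sup>2 / 4) / \<delta> = \<delta> / 2" using assms(2) by (simp add: power2_eq_square)
      have "(1 - \<delta>) * n \<le> card A" using A(3)[unfolded eq] W(2) by (simp add: algebra_simps)
      with A show "\<exists>A \<subseteq> W. near_clique E (nat \<lfloor>\<delta> * n\<rfloor>) A \<and> (1 - \<delta>) * n \<le> card A" by blast
    qed
  qed
next
  case (Suc k)
  then obtain \<gamma>0 c n0 where IH: "0 < \<gamma>0" "0 < c" "\<And>n p E (W :: 'v set). \<lbrakk>n0 \<le> n; parent_order n p; finite W; \<not> embeds E n p W;
      (1 - \<gamma>0) * (real k - 1) * n \<le> card W\<rbrakk> \<Longrightarrow>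
      (\<exists>A \<subseteq> W. near_clique E (nat \<lfloor>\<delta> * n\<rfloor>) A \<and> (1 - \<delta>) * n \<le> card A) \<or> c * real n ^ k \<le> card (cocliques E k W)"
    by metis
  define \<gamma> where "\<gamma> = min \<gamma>0 1"
  have \<gamma>: "0 < \<gamma>" "\<gamma> \<le> \<gamma>0" "\<gamma> \<le> 1" using IH(1) by (auto simp: \<gamma>_def)
  define \<sigma> where "\<sigma> = \<gamma> / 4"
  have k: "real k \<ge> 2" using Suc.hyps by simp
  show ?case
  \<comment> \<open>The first choice costs \<open>\<gamma> / 4 * n\<close> vertices of
    \<open>W\<close>. Taking about \<open>\<sigma> * n\<close> vertices of low degree raises the
    degree bound by another \<open>\<gamma> / 4 * n\<close>, and rounding is covered by
    \<open>2 \<le> \<gamma> * n\<close>.\<close>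
  proof (rule exI[of _ "\<gamma> / (4 * k)"], rule exI[of _ "\<sigma> * c"], rule exI[of _ "max n0 (nat \<lceil>2 / \<gamma>\<rceil>)"], intro conjI allI impI; (elim conjE)?)
    show "0 < \<gamma> / (4 * k)" "0 < \<sigma> * c" using \<gamma> k IH(2) by (auto simp: \<sigma>_def)
    fix n p E and W :: "'v set"
    assume n: "max n0 (nat \<lceil>2 / \<gamma>\<rceil>) \<le> n" and p: "parent_order n p" and W: "finite W" "\<not> embeds E n p W"
      "(1 - \<gamma> / (4 * k)) * (real (Suc k) - 1) * n \<le> card W"
    have "2 / \<gamma> \<le> n" using n by linarith
    then have n2: "2 \<le> \<gamma> * n" using \<gamma> by (simp add: field_simps)
    define s where "s = nat \<lceil>\<sigma> * n\<rceil>"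
    have s: "\<sigma> * n \<le> s" "s \<le> \<sigma> * n + 1" using \<gamma> by (auto simp: s_def \<sigma>_def)
    have "(1 - \<gamma> / (4 * k)) * (real (Suc k) - 1) * n = real k * n - \<gamma> / 4 * n"
      using k by (simp add: field_simps)
    then have W': "real k * n - \<gamma> / 4 * n \<le> card W" using W(3) by simp
    have kn: "2 * real n \<le> real k * n" using k by (intro mult_right_mono) auto
    have \<gamma>n: "\<gamma> * n \<le> n" using mult_right_mono[OF \<gamma>(3), of "real n"] by simp
    have "real s \<le> card W" using s W' kn \<gamma>n n2 unfolding \<sigma>_def by linarith
    then have "s \<le> card W" by linarith
    then obtain S where S: "S \<subseteq> W" "card S = s" "\<forall>x \<in> S. card {y \<in> W. E x y} < n + s"
      using low_degree_vertices[OF p W(1,2), of s] by auto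
    define N where "N x = {y \<in> W. nonadj E x y}" for x
    have dich: "(\<exists>A \<subseteq> W. near_clique E (nat \<lfloor>\<delta> * n\<rfloor>) A \<and> (1 - \<delta>) * n \<le> card A) \<or> c * real n ^ k \<le> card (cocliques E k (N x))"
      if "x \<in> S" for x
    proof -
      have "card W \<le> card (N x \<union> {y \<in> W. E x y} \<union> {x})" using W(1) by (intro card_mono) (auto simp: N_def)
      also have "\<dots> \<le> card (N x) + card {y \<in> W. E x y} + 1"
        using card_Un_le[of "N x \<union> {y \<in> W. E x y}" "{x}"] card_Un_le[of "N x" "{y \<in> W. E x y}"] by simp
      finally have "card W \<le> card (N x) + n + s" using S(3) that by fastforce
      then have "real (card W) \<le> card (N x) + n + s" by linarith
      then have "real k * n - n - \<gamma> / 4 * n - \<gamma> / 4 * n - 1 \<le> card (N x)" using W' s by (simp add: \<sigma>_def)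
      moreover have "\<gamma> * n \<le> \<gamma>0 * (real k - 1) * n"
        using \<gamma> k IH(1) mult_mono[of \<gamma> \<gamma>0 1 "real k - 1"] by (intro mult_right_mono) auto
      ultimately have "(1 - \<gamma>0) * (real k - 1) * n \<le> card (N x)" using n2 by (simp add: algebra_simps)
      moreover have "finite (N x)" "N x \<subseteq> W" using W(1) by (auto simp: N_def)
      moreover have "\<not> embeds E n p (N x)" using W(2) embeds_mono \<open>N x \<subseteq> W\<close> by blast
      ultimately have "(\<exists>A \<subseteq> N x. near_clique E (nat \<lfloor>\<delta> * n\<rfloor>) A \<and> (1 - \<delta>) * n \<le> card A) \<or> c * real n ^ k \<le> card (cocliques E k (N x))"
        using n by (intro IH(3)[OF _ p]) simp_all
      then show ?thesis using \<open>N x \<subseteq> W\<close> by blast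
    qed
    show "(\<exists>A \<subseteq> W. near_clique E (nat \<lfloor>\<delta> * n\<rfloor>) A \<and> (1 - \<delta>) * n \<le> card A) \<or> \<sigma> * c * real n ^ Suc k \<le> card (cocliques E (Suc k) W)"
    proof (cases "\<exists>A \<subseteq> W. near_clique E (nat \<lfloor>\<delta> * n\<rfloor>) A \<and> (1 - \<delta>) * n \<le> card A")
      case True
      then show ?thesis ..
    next
      case False
      then have big: "c * real n ^ k \<le> card (cocliques E k (N x))" if "x \<in> S" for x using dich that by blast
      have "\<sigma> * n * (c * real n ^ k) \<le> s * (c * real n ^ k)" using s IH(2) by (intro mult_right_mono) auto
      also have "\<dots> \<le> (\<Sum>x\<in>S. real (card (cocliques E k (N x))))"
        using sum_bounded_below[of S "c * real n ^ k"] big S(2) by auto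
      also have "\<dots> \<le> (\<Sum>x\<in>W. real (card (cocliques E k (N x))))" using S(1) W(1) by (intro sum_mono2) auto
      also have "\<dots> = card (cocliques E (Suc k) W)" using card_cocliques_Suc[OF W(1), of E k] by (simp add: N_def)
      finally show ?thesis by (simp add: algebra_simps)
    qed
  qed
qed

text \<open>Any two elements of different parts occur together in a word of the box; the remaining
  positions are filled by arbitrary elements of the nonempty parts.\<close>

lemma parts_if_box:
  assumes "\<forall>xs. list_all2 (\<in>) xs Us \<longrightarrow> sorted_wrt (nonadj E) xs" "\<forall>U \<in> set Us. U \<noteq> {}"
  shows "nonadj_parts E Us"
  unfolding sorted_wrt_iff_nth_less
proof (intro allI impI ballI)
  fix i j x y assume ij: "i < j" "j < length Us" and x: "x \<in> Us ! i" and y: "y \<in> Us ! j"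
  define xs where "xs = map (\<lambda>l. if l = i then x else if l = j then y else (SOME z. z \<in> Us ! l)) [0..<length Us]"
  have "(SOME z. z \<in> Us ! l) \<in> Us ! l" if "l < length Us" for l
    using assms(2) nth_mem[OF that] by (simp add: some_in_eq)
  then have "list_all2 (\<in>) xs Us"
    unfolding list_all2_conv_all_nth xs_def using x y by simp
  then have "sorted_wrt (nonadj E) xs" using assms(1) by blast
  then have "nonadj E (xs ! i) (xs ! j)" using ij by (intro sorted_wrt_nth_less) (simp_all add: xs_def)
  then show "nonadj E x y" using ij by (simp add: xs_def)
qed

text \<open>A positive density of blue \<open>k\<close>-cliques would give a box, hence blue parts
  of size \<open>M\<close>. The bound \<open>card W \<le> C * n\<close> turns a density relative to
  \<open>n\<close> into one relative to \<open>card W\<close>.\<close>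

lemma near_clique_exists:
  fixes \<delta> C :: real
  assumes "2 \<le> k" "0 < \<delta>" "1 \<le> M" "1 \<le> C"
  shows "\<exists>\<gamma> n0. 0 < \<gamma> \<and> (\<forall>n p E (W :: 'v set). n0 \<le> n \<and> parent_order n p \<and> finite W \<and> \<not> embeds E n p W \<and>
      (1 - \<gamma>) * (real k - 1) * n \<le> card W \<and> card W \<le> C * n \<and> \<not> has_parts E (replicate k M) W \<longrightarrow>
      (\<exists>A \<subseteq> W. near_clique E (nat \<lfloor>\<delta> * n\<rfloor>) A \<and> (1 - \<delta>) * n \<le> card A))"
proof -
  obtain \<gamma>0 c n0 where N: "0 < \<gamma>0" "0 < c" "\<And>n p E (W :: 'v set). \<lbrakk>n0 \<le> n; parent_order n p; finite W; \<not> embeds E n p W;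
      (1 - \<gamma>0) * (real k - 1) * n \<le> card W\<rbrakk> \<Longrightarrow>
      (\<exists>A \<subseteq> W. near_clique E (nat \<lfloor>\<delta> * n\<rfloor>) A \<and> (1 - \<delta>) * n \<le> card A) \<or> c * real n ^ k \<le> card (cocliques E k W)"
    using near_clique_or_dense[OF assms(1,2), where 'v = 'v] by metis
  have "0 < c / C ^ k" using N(2) assms(4) by simp
  from dense_words_contain_box[OF this, of k M, where 'v = 'v] obtain w0 where
    w0: "\<And>(W :: 'v set) Hs. \<lbrakk>finite W; w0 \<le> card W; Hs \<subseteq> words k W; c / C ^ k * real (card W) ^ k \<le> card Hs\<rbrakk> \<Longrightarrow>
    (\<exists>Us. length Us = k \<and> (\<forall>U \<in> set Us. U \<subseteq> W \<and> card U = M) \<and> (\<forall>xs. list_all2 (\<in>) xs Us \<longrightarrow> xs \<in> Hs))"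
    by metis
  define \<gamma> where "\<gamma> = min \<gamma>0 (1 / 2)"
  have \<gamma>: "0 < \<gamma>" "\<gamma> \<le> \<gamma>0" "\<gamma> \<le> 1 / 2" using N(1) by (auto simp: \<gamma>_def)
  show ?thesis
  proof (intro exI[of _ \<gamma>] exI[of _ "max n0 (2 * w0)"] conjI allI impI; (elim conjE)?)
    fix n p E and W :: "'v set"
    assume n: "max n0 (2 * w0) \<le> n" and p: "parent_order n p" and W: "finite W" "\<not> embeds E n p W"
      "(1 - \<gamma>) * (real k - 1) * n \<le> card W" "card W \<le> C * n" and np: "\<not> has_parts E (replicate k M) W"
    have k: "1 \<le> real k - 1" using assms(1) by simp
    have "(1 - \<gamma>0) * (real k - 1) * n \<le> (1 - \<gamma>) * (real k - 1) * n" using \<gamma> k by (intro mult_right_mono) auto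
    then have "(\<exists>A \<subseteq> W. near_clique E (nat \<lfloor>\<delta> * n\<rfloor>) A \<and> (1 - \<delta>) * n \<le> card A) \<or> c * real n ^ k \<le> card (cocliques E k W)"
      using N(3)[OF _ p W(1,2)] n W(3) by fastforce
    then show "\<exists>A \<subseteq> W. near_clique E (nat \<lfloor>\<delta> * n\<rfloor>) A \<and> (1 - \<delta>) * n \<le> card A"
    proof
      assume c: "c * real n ^ k \<le> card (cocliques E k W)"
      have "real (card W) ^ k \<le> (C * n) ^ k" using W(4) by (intro power_mono) auto
      then have "c / C ^ k * real (card W) ^ k \<le> c / C ^ k * (C * n) ^ k"
        using N(2) assms(4) by (intro mult_left_mono) auto
      also have "\<dots> = c * real n ^ k" using assms(4) by (simp add: power_mult_distrib)
      finally have "c / C ^ k * real (card W) ^ k \<le> card (cocliques E k W)" using c by simp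
      moreover have "1 / 2 * 1 * real n \<le> (1 - \<gamma>) * (real k - 1) * n" using \<gamma> k by (intro mult_right_mono mult_mono) auto
      then have "w0 \<le> card W" using W(3) n by simp
      moreover have "cocliques E k W \<subseteq> words k W" by (auto simp: cocliques_def)
      ultimately obtain Us where Us: "length Us = k" "\<forall>U \<in> set Us. U \<subseteq> W \<and> card U = M"
        "\<forall>xs. list_all2 (\<in>) xs Us \<longrightarrow> xs \<in> cocliques E k W"
        using w0[OF W(1)] by metis
      have "nonadj_parts E Us"
        using Us(2,3) assms(3) by (intro parts_if_box) (auto simp: cocliques_def)
      moreover have "map card Us = replicate k M" using Us(1,2) by (intro replicate_eqI) auto
      moreover have "\<forall>U \<in> set Us. finite U \<and> U \<subseteq> W" using Us(2) W(1) finite_subset by blast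
      ultimately have "has_parts E (replicate k M) W" unfolding has_parts_def by blast
      with np show ?thesis ..
    qed
  qed (rule \<gamma>(1))
qed

section \<open>Splitting off one near-clique\<close>

lemma extend_part:
  assumes "finite Z" "finite B" "M + card Z + (\<Sum>z\<in>Z. card {b \<in> B. E z b}) \<le> card B"
  shows "\<exists>U \<subseteq> B. card U = M \<and> (\<forall>z \<in> Z. \<forall>u \<in> U. nonadj E z u)"
proof -
  let ?R = "Z \<union> (\<Union>z\<in>Z. {b \<in> B. E z b})"
  have "card ?R \<le> card Z + card (\<Union>z\<in>Z. {b \<in> B. E z b})" by (rule card_Un_le)
  also have "\<dots> \<le> card Z + (\<Sum>z\<in>Z. card {b \<in> B. E z b})" using assms(1) card_UN_le by (intro add_left_mono) blast
  finally have "M \<le> card B - card ?R" using assms(3) by linarith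
  also have "\<dots> \<le> card (B - ?R)" using assms(1,2) by (intro diff_card_le_card_Diff) auto
  finally obtain U where "U \<subseteq> B - ?R" "card U = M" using ex_subset_card by blast
  then show ?thesis by (intro exI[of _ U]) auto
qed

lemma card_Union_set_le: "card (\<Union> (set Us)) \<le> sum_list (map card Us)"
proof (induction Us)
  case (Cons U Us)
  have "card (\<Union> (set (U # Us))) \<le> card U + card (\<Union> (set Us))" by (simp add: card_Un_le)
  with Cons show ?case by simp
qed simp

lemma near_clique_mono: "near_clique E d A \<Longrightarrow> d \<le> d' \<Longrightarrow> near_clique E d' A"
  by (fastforce simp: near_clique_def)

lemma near_clique_size:
  assumes "(1 - \<delta>) * real n \<le> card A" "0 \<le> \<delta>"
  shows "n \<le> card A + nat \<lfloor>\<delta> * n\<rfloor>"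
proof -
  have "real n - card A \<le> \<delta> * n" using assms by (simp add: algebra_simps)
  then have "int n - int (card A) \<le> \<lfloor>\<delta> * n\<rfloor>" by (simp add: le_floor_iff)
  then show ?thesis by linarith
qed

text \<open>Fewer than \<open>g * n\<close> vertices outside \<open>A\<close> have
  \<open>\<epsilon> * n\<close> neighbours in \<open>A\<close>, since otherwise
  \<open>embeds_absorb\<close> finds the tree. All other outside vertices form \<open>V\<close>, and
  double counting bounds the vertices of \<open>A\<close> with many neighbours in \<open>V\<close>,
  which are dropped. As \<open>V\<close> is sparse to \<open>A\<close>, blue parts in
  \<open>V\<close> gain a further part inside \<open>A\<close>; excluding \<open>Suc k\<close> parts
  in \<open>W\<close> thus excludes \<open>k\<close> parts in \<open>V\<close>.\<close>

lemma stability_step: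
  fixes \<delta> \<delta>1 \<epsilon> g C :: real
  assumes p: "parent_order n p" and sym: "\<And>x y. E x y \<Longrightarrow> E y x" and W: "finite W" "\<not> embeds E n p W" "card W \<le> C * n"
    and A: "A \<subseteq> W" "near_clique E (nat \<lfloor>\<delta>1 * n\<rfloor>) A" "(1 - \<delta>1) * n \<le> card A"
    and const: "0 < \<delta>" "0 < \<delta>1" "0 < g" "0 < \<epsilon>" "1 \<le> C" "\<delta>1 \<le> 1 / 40" "3 * \<delta>1 \<le> g" "8 * \<delta>1 \<le> \<epsilon>" "6 * \<delta>1 * C \<le> \<epsilon> * g"
      "\<delta>1 \<le> \<delta> / 2" "2 * C * \<epsilon> \<le> \<delta>\<^sup>2" "4 * real k * M * \<epsilon> \<le> 1"
    and n: "1 \<le> \<delta>1 * n" "8 * (real M + real k * M) \<le> n"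
  shows "\<exists>V A'. V \<subseteq> W - A \<and> A' \<subseteq> A \<and> card W - (1 + \<delta>1 + g) * n \<le> card V \<and>
    near_clique E (nat \<lfloor>\<delta> * n\<rfloor>) A' \<and> (1 - \<delta>) * n \<le> card A' \<and>
    (\<forall>a \<in> A'. card {y \<in> V. E a y} \<le> \<delta> * n) \<and> (\<forall>y \<in> V. card {a \<in> A'. E y a} \<le> \<epsilon> * n) \<and>
    (has_parts E (replicate k M) V \<longrightarrow> has_parts E (replicate (Suc k) M) W)"
proof -
  define d where "d = nat \<lfloor>\<delta>1 * n\<rfloor>"
  have d: "1 \<le> d" "d \<le> \<delta>1 * n" using n(1) by (auto simp: d_def le_nat_floor)
  have npos: "0 < real n" using n(1) const(2) by (metis less_eq_real_def mult_zero_right not_one_le_zero of_nat_0_le_iff)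
  have finA: "finite A" using A(1) W(1) finite_subset by blast
  have Ad: "near_clique E d A" using A(2) by (simp add: d_def)
  have An: "n \<le> card A + d" using near_clique_size[OF A(3)] const(2) by (simp add: d_def)
  have Asmall: "card A < n + d"
  proof (rule ccontr)
    assume "\<not> ?thesis"
    then have "embeds E n p A" using embeds_near_clique[OF p Ad] by simp
    then show False using W(2) embeds_mono A(1) by blast
  qed
  define B where "B = {v \<in> W - A. \<epsilon> * n \<le> card {a \<in> A. E v a}}"
  have finB: "finite B" using W(1) by (simp add: B_def)
  have cB: "card B < g * n"
  proof (rule ccontr)
    assume neg: "\<not> ?thesis"
    \<comment> \<open>Half of \<open>e * card B\<close> pays for \<open>4 * d * card B\<close>,
      because \<open>8 * d \<le> e\<close>; the other half pays for \<open>3 * d * card A\<close>,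
      because \<open>6 * \<delta>1 * C \<le> \<epsilon> * g\<close>.\<close>
    define e where "e = nat \<lceil>\<epsilon> * n\<rceil>"
    have e: "\<epsilon> * n \<le> e" unfolding e_def by (rule real_nat_ceiling_ge)
    have d8: "8 * d \<le> real e"
    proof -
      have "8 * d \<le> 8 * \<delta>1 * n" using d by simp
      also have "\<dots> \<le> \<epsilon> * n" using const npos by (intro mult_right_mono) auto
      finally show ?thesis using e by simp
    qed
    have dB: "3 * d \<le> card B"
    proof -
      have "3 * real d \<le> 3 * \<delta>1 * n" using d by simp
      also have "\<dots> \<le> g * n" using const npos by (intro mult_right_mono) auto
      finally have "3 * real d \<le> card B" using neg by linarith
      then show ?thesis by linarith
    qed
    have d40: "40 * d \<le> n"
    proof -
      have "40 * real d \<le> 40 * \<delta>1 * n" using d by simp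
      also have "\<dots> \<le> 1 * real n" using const npos by (intro mult_right_mono) auto
      finally show ?thesis by linarith
    qed
    have "3 * real d * card A \<le> 3 * (\<delta>1 * n) * (C * n)"
    proof (intro mult_mono)
      have "card A \<le> card W" using A(1) W(1) by (intro card_mono) auto
      then show "real (card A) \<le> C * n" using W(3) by linarith
    qed (use d const npos in auto)
    also have "\<dots> = 6 * \<delta>1 * C * (n * n / 2)" by simp
    also have "\<dots> \<le> \<epsilon> * g * (n * n / 2)" using const npos by (intro mult_right_mono) auto
    also have "\<dots> = \<epsilon> * n * (g * n) / 2" by simp
    also have "\<dots> \<le> real e * card B / 2" using e neg const npos by (intro divide_right_mono mult_mono) auto
    finally have "3 * real d * card A + 4 * real d * card B \<le> real e * card B / 2 + real e * card B / 2"
      using d8 mult_right_mono[OF d8, of "real (card B)"] by simp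
    then have "real (3 * d * card A + 4 * d * card B) \<le> real (e * card B)" by simp
    then have last: "3 * d * card A + 4 * d * card B \<le> e * card B" by linarith
    have "e \<le> card {a \<in> A. E b a}" if "b \<in> B" for b
      using that unfolding e_def B_def by (simp add: nat_le_iff ceiling_le_iff)
    then have "embeds E n p (A \<union> B)"
      using d8 by (intro embeds_absorb[OF p sym Ad An finB _ dB d(1) d40 _ _ last]) (auto simp: B_def)
    moreover have "A \<union> B \<subseteq> W" using A(1) by (auto simp: B_def)
    ultimately show False using W(2) embeds_mono by blast
  qed
  define V where "V = W - A - B"
  have V: "V \<subseteq> W" "finite V" "V \<inter> A = {}" using W(1) by (auto simp: V_def)
  have Vdeg: "card {a \<in> A. E y a} < \<epsilon> * n" if "y \<in> V" for y using that by (auto simp: V_def B_def)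
  have "card W \<le> card V + card A + card B"
  proof -
    have "card W \<le> card (V \<union> A \<union> B)" using V(2) finA finB by (intro card_mono) (auto simp: V_def)
    also have "\<dots> \<le> card V + card A + card B"
      using card_Un_le[of "V \<union> A" B] card_Un_le[of V A] by simp
    finally show ?thesis .
  qed
  then have "real (card W) \<le> card V + card A + card B" by linarith
  then have cV: "card W - (1 + \<delta>1 + g) * n \<le> card V" using cB Asmall d by (simp add: algebra_simps)
  define Bad where "Bad = {a \<in> A. \<delta> * n < card {y \<in> V. E a y}}"
  have finBad: "finite Bad" using finA by (simp add: Bad_def)
  have "real (card Bad) * (\<delta> * n) \<le> (\<Sum>a\<in>Bad. real (card {y \<in> V. E a y}))"
    using sum_bounded_below[of Bad "\<delta> * n"] by (auto simp: Bad_def)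
  also have "\<dots> \<le> (\<Sum>a\<in>A. real (card {y \<in> V. E a y}))" using finA by (intro sum_mono2) (auto simp: Bad_def)
  also have "\<dots> = real (card (SIGMA a:A. {y \<in> V. E a y}))" using finA V(2) by (simp add: card_SigmaI)
  also have "card (SIGMA a:A. {y \<in> V. E a y}) = card (SIGMA y:V. {a \<in> A. E y a})"
    by (intro bij_betw_same_card[of prod.swap] bij_betwI[where g = prod.swap]) (auto dest: sym)
  also have "real \<dots> = (\<Sum>y\<in>V. real (card {a \<in> A. E y a}))" using finA V(2) by (simp add: card_SigmaI)
  also have "\<dots> \<le> card V * (\<epsilon> * n)"
    using sum_bounded_above[of V "\<lambda>y. real (card {a \<in> A. E y a})" "\<epsilon> * n"] Vdeg by fastforce
  also have "\<dots> \<le> (C * n) * (\<epsilon> * n)"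
  proof (rule mult_right_mono)
    have "card V \<le> card W" using V W(1) by (intro card_mono) auto
    then show "real (card V) \<le> C * n" using W(3) by linarith
  qed (use const npos in auto)
  also have "\<dots> = (2 * C * \<epsilon>) * (n * n / 2)" by simp
  also have "\<dots> \<le> \<delta>\<^sup>2 * (n * n / 2)" using const npos by (intro mult_right_mono) auto
  finally have "(\<delta> * n) * card Bad \<le> (\<delta> * n) * (\<delta> * n / 2)" by (simp add: power2_eq_square algebra_simps)
  then have cBad: "card Bad \<le> \<delta> * n / 2" using const npos by (simp add: mult_le_cancel_left)
  define A' where "A' = A - Bad"
  have A'A: "A' \<subseteq> A" by (auto simp: A'_def)
  have "near_clique E (nat \<lfloor>\<delta> * n\<rfloor>) A'"
  proof (rule near_clique_mono[OF near_clique_subset[OF Ad A'A]])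
    have "\<delta>1 * n \<le> \<delta> * n" using const npos by (intro mult_right_mono) auto
    then show "d \<le> nat \<lfloor>\<delta> * n\<rfloor>" unfolding d_def by (intro nat_mono floor_mono)
  qed
  moreover have "(1 - \<delta>) * n \<le> card A'"
  proof -
    have "real (card A') = card A - card Bad"
      unfolding A'_def using finBad finA by (subst card_Diff_subset) (auto simp: Bad_def of_nat_diff card_mono)
    moreover have "\<delta>1 * n \<le> \<delta> * n / 2" using const npos mult_right_mono[of \<delta>1 "\<delta> / 2" "real n"] by simp
    ultimately show ?thesis using cBad A(3) by (simp add: algebra_simps)
  qed
  moreover have "card {y \<in> V. E a y} \<le> \<delta> * n" if "a \<in> A'" for a using that by (auto simp: A'_def Bad_def)
  moreover have "card {a \<in> A'. E y a} \<le> \<epsilon> * n" if "y \<in> V" for y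
  proof -
    have "card {a \<in> A'. E y a} \<le> card {a \<in> A. E y a}" using finA A'A by (intro card_mono) auto
    then show ?thesis using Vdeg[OF that] by linarith
  qed
  moreover have "has_parts E (replicate (Suc k) M) W" if parts: "has_parts E (replicate k M) V"
  proof -
    from parts obtain Us where Us: "map card Us = replicate k M" "\<forall>U \<in> set Us. finite U \<and> U \<subseteq> V"
      "nonadj_parts E Us"
      unfolding has_parts_def by blast
    let ?Z = "\<Union> (set Us)"
    have cZ: "card ?Z \<le> k * M" using card_Union_set_le[of Us] by (simp add: Us(1) sum_list_replicate)
    have finZ: "finite ?Z" "?Z \<subseteq> V" using Us(2) by auto
    have "real (\<Sum>z\<in>?Z. card {b \<in> A. E z b}) = (\<Sum>z\<in>?Z. real (card {b \<in> A. E z b}))" by simp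
    also have "\<dots> \<le> (\<Sum>z\<in>?Z. \<epsilon> * n)" using finZ(2) Vdeg by (intro sum_mono) (auto intro: less_imp_le)
    also have "\<dots> \<le> real (k * M) * (\<epsilon> * n)" 
      using mult_right_mono[of "real (card ?Z)" "real (k * M)" "\<epsilon> * n"] cZ const npos
      by (simp del: of_nat_mult)
    also have "\<dots> = (4 * real k * M * \<epsilon>) * (n / 4)" by simp
    also have "\<dots> \<le> 1 * (real n / 4)" using const npos by (intro mult_right_mono) auto
    finally have 1: "real (\<Sum>z\<in>?Z. card {b \<in> A. E z b}) \<le> n / 4" by simp
    have 2: "real M + card ?Z \<le> n / 8" using n(2) of_nat_mono[OF cZ, where 'a = real] by simp
    have "\<delta>1 * n \<le> 1 / 2 * real n" using const npos by (intro mult_right_mono) auto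
    then have "real n / 2 \<le> card A" using A(3) by (simp add: algebra_simps)
    then have "real (M + card ?Z + (\<Sum>z\<in>?Z. card {b \<in> A. E z b})) \<le> card A" using 1 2 by simp
    then have "M + card ?Z + (\<Sum>z\<in>?Z. card {b \<in> A. E z b}) \<le> card A" by linarith
    from extend_part[OF finZ(1) finA this] obtain U where U: "U \<subseteq> A" "card U = M"
      "\<forall>z \<in> ?Z. \<forall>u \<in> U. nonadj E z u" by blast
    have "nonadj_parts E (U # Us)"
    proof -
      have "nonadj E x y" if "U' \<in> set Us" "x \<in> U" "y \<in> U'" for U' x y
        using U(3) sym[of x y] that by blast
      then show ?thesis using Us(3) by simp
    qed
    moreover have "\<forall>X \<in> set (U # Us). finite X \<and> X \<subseteq> W" 
      using U(1) Us(2) A(1) V(1) finite_subset[OF U(1) finA] by (simp, blast)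
    moreover have "map card (U # Us) = replicate (Suc k) M" using U(2) Us(1) by simp
    ultimately show ?thesis unfolding has_parts_def by blast
  qed
  ultimately show ?thesis
    using A'A cV by (intro exI[of _ V] exI[of _ A']) (auto simp: V_def)
qed

lemma ex_pos_lower_bound:
  fixes S :: "real set"
  assumes "finite S" "\<forall>s \<in> S. 0 < s"
  shows "\<exists>d>0. \<forall>s \<in> S. d \<le> s"
proof (cases "S = {}")
  case False
  then show ?thesis using assms by (intro exI[of _ "Min S"]) auto
qed (auto intro: exI[of _ 1])

text \<open>Induction on \<open>k\<close>: \<open>near_clique_exists\<close> supplies a near-clique
  at a much finer scale \<open>\<delta>1\<close>, \<open>stability_step\<close> splits it off, and
  the remaining set \<open>V\<close> satisfies the hypotheses for the smaller
  \<open>k\<close>.\<close>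

lemma stability:
  fixes \<delta> C :: real
  assumes "2 \<le> k" "0 < \<delta>" "1 \<le> M" "1 \<le> C"
  shows "\<exists>\<gamma> n0. 0 < \<gamma> \<and> (\<forall>n p E (W :: 'v set). n0 \<le> n \<and> parent_order n p \<and> (\<forall>x y. E x y \<longrightarrow> E y x) \<and>
      finite W \<and> \<not> embeds E n p W \<and>
      (1 - \<gamma>) * (real k - 1) * n \<le> card W \<and> card W \<le> C * n \<and> \<not> has_parts E (replicate k M) W \<longrightarrow>
      (\<exists>A. (\<forall>i<k - 1. A i \<subseteq> W \<and> near_clique E (nat \<lfloor>\<delta> * n\<rfloor>) (A i) \<and> (1 - \<delta>) * n \<le> card (A i)) \<and>
        (\<forall>i<k - 1. \<forall>j<k - 1. i \<noteq> j \<longrightarrow> A i \<inter> A j = {} \<and> (\<forall>a \<in> A i. card {y \<in> A j. E a y} \<le> \<delta> * n))))"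
  using assms(1)
proof (induction k rule: nat_induct_at_least)
  case base
  obtain \<gamma> n0 where N: "0 < \<gamma>" "\<And>n p E (W :: 'v set). n0 \<le> n \<and> parent_order n p \<and> finite W \<and> \<not> embeds E n p W \<and>
      (1 - \<gamma>) * (real 2 - 1) * n \<le> card W \<and> card W \<le> C * n \<and> \<not> has_parts E (replicate 2 M) W \<Longrightarrow>
      (\<exists>A \<subseteq> W. near_clique E (nat \<lfloor>\<delta> * n\<rfloor>) A \<and> (1 - \<delta>) * n \<le> card A)"
    using near_clique_exists[OF order_refl assms(2-4), where 'v = 'v] by metis
  show ?case
  proof (intro exI[of _ \<gamma>] exI[of _ n0] conjI allI impI; (elim conjE)?)
    fix n p E and W :: "'v set"
    assume "n0 \<le> n" "parent_order n p" "finite W" "\<not> embeds E n p W"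
      "(1 - \<gamma>) * (real 2 - 1) * n \<le> card W" "card W \<le> C * n" "\<not> has_parts E (replicate 2 M) W"
    then obtain A where A: "A \<subseteq> W" "near_clique E (nat \<lfloor>\<delta> * n\<rfloor>) A" "(1 - \<delta>) * n \<le> card A"
      using N(2)[of n p W E] by blast
    show "\<exists>A. (\<forall>i<(2::nat) - 1. A i \<subseteq> W \<and> near_clique E (nat \<lfloor>\<delta> * n\<rfloor>) (A i) \<and> (1 - \<delta>) * n \<le> card (A i)) \<and>
        (\<forall>i<(2::nat) - 1. \<forall>j<(2::nat) - 1. i \<noteq> j \<longrightarrow> A i \<inter> A j = {} \<and> (\<forall>a \<in> A i. card {y \<in> A j. E a y} \<le> \<delta> * n))"
      using A by (intro exI[of _ "\<lambda>_. A"]) auto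
  qed (rule N(1))
next
  case (Suc k)
  from Suc.IH obtain \<gamma>0 n0 where IH: "0 < \<gamma>0" "\<forall>n p E (W :: 'v set). n0 \<le> n \<and> parent_order n p \<and> (\<forall>x y. E x y \<longrightarrow> E y x) \<and>
      finite W \<and> \<not> embeds E n p W \<and>
      (1 - \<gamma>0) * (real k - 1) * n \<le> card W \<and> card W \<le> C * n \<and> \<not> has_parts E (replicate k M) W \<longrightarrow>
      (\<exists>A. (\<forall>i<k - 1. A i \<subseteq> W \<and> near_clique E (nat \<lfloor>\<delta> * n\<rfloor>) (A i) \<and> (1 - \<delta>) * n \<le> card (A i)) \<and>
        (\<forall>i<k - 1. \<forall>j<k - 1. i \<noteq> j \<longrightarrow> A i \<inter> A j = {} \<and> (\<forall>a \<in> A i. card {y \<in> A j. E a y} \<le> \<delta> * n)))"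
    by (elim exE conjE) (rule that)
  have k: "2 \<le> real k" using Suc.hyps by simp
  have M: "1 \<le> real M" using assms(3) by simp
  define \<epsilon> where "\<epsilon> = min \<delta> (min (\<delta>\<^sup>2 / (2 * C)) (1 / (4 * k * M)))"
  have "0 < \<epsilon>" "\<epsilon> \<le> \<delta>" "\<epsilon> \<le> \<delta>\<^sup>2 / (2 * C)" "\<epsilon> \<le> 1 / (4 * k * M)"
    using assms k M by (auto simp: \<epsilon>_def)
  then have \<epsilon>: "0 < \<epsilon>" "\<epsilon> \<le> \<delta>" "2 * C * \<epsilon> \<le> \<delta>\<^sup>2" "4 * real k * M * \<epsilon> \<le> 1"
    using assms(4) k M by (auto simp: field_simps)
  \<comment> \<open>The losses from \<open>g\<close>, \<open>\<delta>1\<close> and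
    \<open>\<gamma> * k\<close> are kept below \<open>\<gamma>0 / 4 * n\<close> each, so that
    \<open>V\<close> is still large enough for the induction hypothesis.\<close>
  define g where "g = \<gamma>0 / 4"
  have g: "0 < g" using IH(1) by (simp add: g_def)
  have "\<exists>d>0. \<forall>s \<in> {1 / 40, g / 3, \<epsilon> / 8, \<epsilon> * g / (6 * C), \<delta> / 2, \<gamma>0 / 4}. d \<le> s"
    using g \<epsilon>(1) assms(2,4) IH(1) by (intro ex_pos_lower_bound) simp_all
  then obtain \<delta>1 where \<delta>1: "0 < \<delta>1" "\<delta>1 \<le> 1 / 40" "\<delta>1 \<le> \<delta> / 2" "\<delta>1 \<le> \<gamma>0 / 4"
    and "\<delta>1 \<le> g / 3" "\<delta>1 \<le> \<epsilon> / 8" "\<delta>1 \<le> \<epsilon> * g / (6 * C)"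
    by auto
  then have \<delta>2: "3 * \<delta>1 \<le> g" "8 * \<delta>1 \<le> \<epsilon>" "6 * \<delta>1 * C \<le> \<epsilon> * g"
    using assms(4) by (simp_all add: pos_le_divide_eq mult.assoc mult.left_commute)
  have k2: "2 \<le> Suc k" using Suc.hyps by simp
  obtain \<gamma>1 n1 where N: "0 < \<gamma>1" "\<And>n p E (W :: 'v set). n1 \<le> n \<and> parent_order n p \<and> finite W \<and> \<not> embeds E n p W \<and>
      (1 - \<gamma>1) * (real (Suc k) - 1) * n \<le> card W \<and> card W \<le> C * n \<and> \<not> has_parts E (replicate (Suc k) M) W \<Longrightarrow>
      (\<exists>A \<subseteq> W. near_clique E (nat \<lfloor>\<delta>1 * n\<rfloor>) A \<and> (1 - \<delta>1) * n \<le> card A)"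
    using near_clique_exists[OF k2 \<delta>1(1) assms(3,4), where 'v = 'v] by metis
  define \<gamma> where "\<gamma> = min \<gamma>1 (\<gamma>0 / (4 * k))"
  have \<gamma>: "0 < \<gamma>" "\<gamma> \<le> \<gamma>1" "\<gamma> * k \<le> \<gamma>0 / 4"
  proof -
    show "0 < \<gamma>" "\<gamma> \<le> \<gamma>1" using N(1) IH(1) k by (auto simp: \<gamma>_def)
    have "\<gamma> * k \<le> \<gamma>0 / (4 * k) * k" using k by (intro mult_right_mono) (auto simp: \<gamma>_def)
    then show "\<gamma> * k \<le> \<gamma>0 / 4" using k by simp
  qed
  define n2 where "n2 = max (max n0 n1) (max (nat \<lceil>1 / \<delta>1\<rceil>) (8 * (M + k * M)))"
  show ?case
  proof (intro exI[of _ \<gamma>] exI[of _ n2] conjI allI impI; (elim conjE)?)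
    fix n p E and W :: "'v set"
    assume n: "n2 \<le> n" and p: "parent_order n p" and symE: "\<forall>x y. E x y \<longrightarrow> E y x" and W: "finite W" "\<not> embeds E n p W"
      "(1 - \<gamma>) * (real (Suc k) - 1) * n \<le> card W" "card W \<le> C * n" and np: "\<not> has_parts E (replicate (Suc k) M) W"
    have sym: "E x y \<Longrightarrow> E y x" for x y using symE by blast
    have n01: "n0 \<le> n" "n1 \<le> n" "nat \<lceil>1 / \<delta>1\<rceil> \<le> n" "8 * (M + k * M) \<le> n" using n by (auto simp: n2_def)
    have "1 / \<delta>1 \<le> n" using n01(3) by linarith
    then have n\<delta>: "1 \<le> \<delta>1 * n" using \<delta>1(1) by (simp add: field_simps)
    have "real (8 * (M + k * M)) \<le> real n" using n01(4) by (rule of_nat_mono)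
    then have nM: "8 * (real M + real k * M) \<le> n" by simp
    have "(1 - \<gamma>1) * (real (Suc k) - 1) * n \<le> (1 - \<gamma>) * (real (Suc k) - 1) * n"
      using \<gamma> by (intro mult_right_mono) auto
    then have "(1 - \<gamma>1) * (real (Suc k) - 1) * n \<le> card W" using W(3) by linarith
    then obtain A0 where A0: "A0 \<subseteq> W" "near_clique E (nat \<lfloor>\<delta>1 * n\<rfloor>) A0" "(1 - \<delta>1) * n \<le> card A0"
      using N(2)[of n p W E] n01 p W np by blast
    obtain V A' where V: "V \<subseteq> W - A0" "A' \<subseteq> A0" "card W - (1 + \<delta>1 + g) * n \<le> card V"
      "near_clique E (nat \<lfloor>\<delta> * n\<rfloor>) A'" "(1 - \<delta>) * n \<le> card A'"
      "\<forall>a \<in> A'. card {y \<in> V. E a y} \<le> \<delta> * n" "\<forall>y \<in> V. card {a \<in> A'. E y a} \<le> \<epsilon> * n"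
      "has_parts E (replicate k M) V \<longrightarrow> has_parts E (replicate (Suc k) M) W"
      using stability_step[OF p sym W(1,2,4) A0 assms(2) \<delta>1(1) g \<epsilon>(1) assms(4) \<delta>1(2) \<delta>2 \<delta>1(3) \<epsilon>(3,4) n\<delta> nM] by blast
    have "(1 - \<gamma>0) * (real k - 1) * n \<le> card V"
    proof -
      have "\<gamma>0 * n \<le> \<gamma>0 * (real k - 1) * n"
        using k IH(1) mult_left_mono[of 1 "real k - 1" \<gamma>0] by (intro mult_right_mono) auto
      moreover have "\<gamma> * k * n \<le> \<gamma>0 / 4 * n" using \<gamma>(3) by (intro mult_right_mono) auto
      moreover have "\<delta>1 * n \<le> \<gamma>0 / 4 * n" using \<delta>1(4) by (intro mult_right_mono) auto
      moreover have "0 \<le> \<gamma>0 * n" using IH(1) by simp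
      moreover have "real k * n - \<gamma> * k * n \<le> card W" using W(3) by (simp add: algebra_simps)
      ultimately show ?thesis using V(3) by (simp add: g_def algebra_simps)
    qed
    moreover have "V \<subseteq> W" using V(1) by blast
    moreover have "finite V" using \<open>V \<subseteq> W\<close> W(1) finite_subset by blast
    moreover have "card V \<le> C * n"
    proof -
      have "card V \<le> card W" using \<open>V \<subseteq> W\<close> W(1) by (rule card_mono[rotated])
      then show ?thesis using W(4) by linarith
    qed
    moreover have "\<not> embeds E n p V" using W(2) embeds_mono \<open>V \<subseteq> W\<close> by blast
    ultimately obtain A where A: "\<forall>i<k - 1. A i \<subseteq> V \<and> near_clique E (nat \<lfloor>\<delta> * n\<rfloor>) (A i) \<and> (1 - \<delta>) * n \<le> card (A i)"
      "\<forall>i<k - 1. \<forall>j<k - 1. i \<noteq> j \<longrightarrow> A i \<inter> A j = {} \<and> (\<forall>a \<in> A i. card {y \<in> A j. E a y} \<le> \<delta> * n)"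
      using IH(2)[THEN spec, THEN spec, THEN spec, THEN spec, of n p E V] n01(1) p symE np V(8) by blast
    define B where "B i = (if i < k - 1 then A i else A')" for i
    have cross: "B i \<inter> B j = {} \<and> (\<forall>a \<in> B i. card {y \<in> B j. E a y} \<le> \<delta> * n)"
      if ij: "i < k" "j < k" "i \<noteq> j" for i j
    proof -
      consider "i < k - 1" "j < k - 1" | "i < k - 1" "\<not> j < k - 1" | "\<not> i < k - 1" "j < k - 1" using ij by linarith
      then show ?thesis
      proof cases
        case 1
        then show ?thesis using A(2) ij by (simp add: B_def)
      next
        case 2
        have "\<epsilon> * n \<le> \<delta> * n" using \<epsilon>(2) by (intro mult_right_mono) auto
        then show ?thesis using 2 A(1) V(1,2,7) by (fastforce simp: B_def)
      next
        case 3
        have "card {y \<in> A j. E a y} \<le> card {y \<in> V. E a y}" for a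
          using 3 A(1) \<open>finite V\<close> by (intro card_mono) auto
        then have "card {y \<in> A j. E a y} \<le> \<delta> * n" if "a \<in> A'" for a
          using V(6) that by (meson of_nat_mono order_trans)
        then show ?thesis using 3 A(1) V(1,2) by (fastforce simp: B_def)
      qed
    qed
    show "\<exists>A. (\<forall>i<Suc k - 1. A i \<subseteq> W \<and> near_clique E (nat \<lfloor>\<delta> * n\<rfloor>) (A i) \<and> (1 - \<delta>) * n \<le> card (A i)) \<and>
        (\<forall>i<Suc k - 1. \<forall>j<Suc k - 1. i \<noteq> j \<longrightarrow> A i \<inter> A j = {} \<and> (\<forall>a \<in> A i. card {y \<in> A j. E a y} \<le> \<delta> * n))"
    proof (intro exI[of _ B] conjI)
      show "\<forall>i<Suc k - 1. B i \<subseteq> W \<and> near_clique E (nat \<lfloor>\<delta> * n\<rfloor>) (B i) \<and> (1 - \<delta>) * n \<le> card (B i)"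
      proof (intro allI impI)
        fix i
        show "B i \<subseteq> W \<and> near_clique E (nat \<lfloor>\<delta> * n\<rfloor>) (B i) \<and> (1 - \<delta>) * n \<le> card (B i)"
        proof (cases "i < k - 1")
          case True
          then have "A i \<subseteq> W" using A(1) \<open>V \<subseteq> W\<close> by blast
          then show ?thesis using True A(1) by (simp add: B_def)
        next
          case False
          then show ?thesis using V(2,4,5) A0(1) by (auto simp: B_def)
        qed
      qed
    qed (use cross in simp)
  qed (rule \<gamma>(1))
qed

section \<open>Exceptional vertices\<close>

lemma sum_card_swap:
  assumes "finite A" "finite B"
  shows "(\<Sum>a\<in>A. card {b \<in> B. P a b}) = (\<Sum>b\<in>B. card {a \<in> A. P a b})"
proof -
  have "(\<Sum>a\<in>A. card {b \<in> B. P a b}) = card (SIGMA a:A. {b \<in> B. P a b})"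
    using assms by (simp add: card_SigmaI)
  also have "\<dots> = card (SIGMA b:B. {a \<in> A. P a b})"
    by (intro bij_betw_same_card[of prod.swap] bij_betwI[where g = prod.swap]) auto
  also have "\<dots> = (\<Sum>b\<in>B. card {a \<in> A. P a b})" using assms by (simp add: card_SigmaI)
  finally show ?thesis .
qed

text \<open>All sets \<open>A\<^sub>i\<close> are cut to the same size \<open>L\<close> and enumerated by \<open>t < L\<close>, and \<open>red v i t\<close> says that
  \<open>v\<close> is red to the \<open>t\<close>-th vertex of \<open>A\<^sub>i\<close>.  Only the average over the diagonal choices
  \<open>(t, \<dots>, t)\<close> is needed, since upper bounds involve just the marginals.\<close>

locale clusters =
  fixes V :: "'v set" and red :: "'v \<Rightarrow> nat \<Rightarrow> nat \<Rightarrow> bool" and \<kappa> L r m1 z :: nat and b \<zeta> :: real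
  assumes finV: "finite V" and \<kappa>: "2 \<le> \<kappa>" and m1: "1 \<le> m1" and L: "1 \<le> L" and r: "1 \<le> r"
    and \<zeta>: "0 \<le> \<zeta>"
    and red_bound: "v \<in> V \<Longrightarrow> real (\<Sum>i<\<kappa>. card {t \<in> {..<L}. red v i t}) \<le> (1 + \<zeta>) * L"
    and no_small: "\<lbrakk>Z \<subseteq> V; card Z = m1; \<And>i. i < \<kappa> \<Longrightarrow> Bs i \<subseteq> {..<L} \<and> b * L \<le> card (Bs i);
        \<And>v i. \<lbrakk>v \<in> Z; i < \<kappa>\<rbrakk> \<Longrightarrow> 4 * z * card {t \<in> Bs i. red v i t} \<le> card (Bs i)\<rbrakk> \<Longrightarrow> False"
    and no_large: "\<lbrakk>i < \<kappa>; W \<subseteq> V; r \<le> card W; \<And>j. \<lbrakk>j < \<kappa>; j \<noteq> i\<rbrakk> \<Longrightarrow> Bs j \<subseteq> {..<L} \<and> b * L \<le> card (Bs j);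
        \<And>v j. \<lbrakk>v \<in> W; j < \<kappa>; j \<noteq> i\<rbrakk> \<Longrightarrow> 4 * z * card {t \<in> Bs j. red v j t} \<le> card (Bs j)\<rbrakk> \<Longrightarrow> False"
    and large: "\<kappa> * (r - 1) < card V"
begin

section \<open>Blue degrees, sides and patterns\<close>

definition reds :: "'v \<Rightarrow> nat \<Rightarrow> nat" where "reds v i = card {t \<in> {..<L}. red v i t}"

definition blues :: "'v \<Rightarrow> nat \<Rightarrow> nat" where "blues v i = card {t \<in> {..<L}. \<not> red v i t}"

lemma blues_reds: "blues v i + reds v i = L"
proof -
  have "blues v i + reds v i = card ({t \<in> {..<L}. \<not> red v i t} \<union> {t \<in> {..<L}. red v i t})"
    unfolding blues_def reds_def by (intro card_Un_disjoint[symmetric]) auto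
  also have "{t \<in> {..<L}. \<not> red v i t} \<union> {t \<in> {..<L}. red v i t} = {..<L}" by auto
  finally show ?thesis by simp
qed

text \<open>Every vertex gets a set to which it has the fewest blue edges; whether it really belongs
  there is decided later by the size of \<open>\<beta> v\<close>.\<close>

definition side :: "'v \<Rightarrow> nat" where "side v = (SOME i. i < \<kappa> \<and> (\<forall>j<\<kappa>. blues v i \<le> blues v j))"

lemma side: "side v < \<kappa>" "j < \<kappa> \<Longrightarrow> blues v (side v) \<le> blues v j"
proof -
  have "\<exists>i. i < \<kappa> \<and> (\<forall>j. j < \<kappa> \<longrightarrow> blues v i \<le> blues v j)"
    using ex_has_least_nat[of "\<lambda>i. i < \<kappa>" 0 "blues v"] \<kappa> by auto
  then have "\<exists>i. i < \<kappa> \<and> (\<forall>j<\<kappa>. blues v i \<le> blues v j)" by blast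
  from someI_ex[OF this] show "side v < \<kappa>" "j < \<kappa> \<Longrightarrow> blues v (side v) \<le> blues v j" unfolding side_def by auto
qed

abbreviation \<beta> :: "'v \<Rightarrow> nat" where "\<beta> v \<equiv> blues v (side v)"

text \<open>Of the total red degree, at most \<open>(1 + \<zeta>) * L\<close>, the own set already
  takes \<open>L - \<beta> v\<close>. A vertex almost completely red to its own set is therefore
  almost completely blue to all other sets together.\<close>

lemma sum_other: "v \<in> V \<Longrightarrow> real (\<Sum>j\<in>{..<\<kappa>} - {side v}. reds v j) \<le> \<beta> v + \<zeta> * L"
proof -
  assume v: "v \<in> V"
  have "(\<Sum>j<\<kappa>. reds v j) = reds v (side v) + (\<Sum>j\<in>{..<\<kappa>} - {side v}. reds v j)"
    using side(1) by (simp add: sum.remove)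
  moreover have "real (\<Sum>j<\<kappa>. reds v j) \<le> L + \<zeta> * L" using red_bound[OF v] by (simp add: reds_def algebra_simps)
  moreover have "real (\<beta> v) + real (reds v (side v)) = L" using blues_reds[of v "side v"] by (metis of_nat_add)
  ultimately show ?thesis by simp
qed

lemma reds_other:
  assumes "v \<in> V" "j < \<kappa>" "j \<noteq> side v"
  shows "reds v j \<le> \<beta> v + \<zeta> * L"
proof -
  have "reds v j \<le> (\<Sum>j\<in>{..<\<kappa>} - {side v}. reds v j)" using assms by (intro member_le_sum) auto
  then have "real (reds v j) \<le> real (\<Sum>j\<in>{..<\<kappa>} - {side v}. reds v j)" by (rule of_nat_mono)
  with sum_other[OF assms(1)] show ?thesis by simp
qed

text \<open>The indices in \<open>T\<close> that look like \<open>t\<close> from \<open>Y\<close>.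
  If the representative \<open>t\<close> is blue to a vertex of \<open>Y\<close>, so is the whole
  class, which replaces a single representative by a large set.\<close>

definition pattern :: "'v set \<Rightarrow> nat set \<Rightarrow> nat \<Rightarrow> nat \<Rightarrow> nat set" where
  "pattern Y T i t = {t' \<in> T. \<forall>v \<in> Y. red v i t' = red v i t}"

lemma pattern_subset: "pattern Y T i t \<subseteq> T"
  by (auto simp: pattern_def)

text \<open>There are \<open>2 ^ card Y\<close> patterns, and a rare one is shared by fewer than
  \<open>x\<close> indices.\<close>

lemma few_rare_patterns:
  fixes x :: real
  assumes "finite Y" "finite T" "0 \<le> x"
  shows "card {t \<in> T. card (pattern Y T i t) < x} \<le> 2 ^ card Y * x"
proof -
  let ?f = "\<lambda>t. {v \<in> Y. red v i t}" and ?S = "{t \<in> T. card (pattern Y T i t) < x}"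
  have le: "card {t \<in> ?S. ?f t = P} \<le> x" for P
  proof (cases "{t \<in> ?S. ?f t = P} = {}")
    case False
    then obtain t where t: "t \<in> ?S" "?f t = P" by blast
    then have "{t \<in> ?S. ?f t = P} \<subseteq> pattern Y T i t" by (auto simp: pattern_def)
    then have "card {t \<in> ?S. ?f t = P} \<le> card (pattern Y T i t)" using assms(2) by (intro card_mono) (auto simp: pattern_def)
    then show ?thesis using t(1) by simp
  qed (use assms(3) in \<open>simp only: card.empty of_nat_0\<close>)
  have "(\<Sum>P\<in>Pow Y. \<Sum>t\<in>{t \<in> ?S. ?f t = P}. 1) = (\<Sum>t\<in>?S. 1::real)"
    using assms by (intro sum.group) auto
  then have "real (card ?S) = (\<Sum>P\<in>Pow Y. real (card {t \<in> ?S. ?f t = P}))" by simp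
  also have "\<dots> \<le> (\<Sum>P\<in>Pow Y. x)" using le by (intro sum_mono) auto
  also have "\<dots> = 2 ^ card Y * x" using assms(1) by (simp add: card_Pow)
  finally show ?thesis .
qed

text \<open>One index per set is chosen in turn, with a pattern that is not rare and blue to at
  least the fraction \<open>\<epsilon> / 2\<close> of the vertices that survived so far. After
  \<open>\<kappa>\<close> choices the survivors are blue to whole pattern classes, so
  \<open>no_small\<close> forbids \<open>m1\<close> of them.\<close>

lemma few_all_blue:
  fixes c \<epsilon> :: real
  assumes Y: "Y \<subseteq> V" "\<And>v i. v \<in> Y \<Longrightarrow> i < \<kappa> \<Longrightarrow> \<epsilon> * L \<le> blues v i" and \<epsilon>: "0 < \<epsilon>" "\<epsilon> \<le> 1"
    and c: "2 ^ card Y * c \<le> \<epsilon> / 4" "b \<le> c" "0 \<le> c"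
  shows "(\<epsilon> / 2) ^ \<kappa> * card Y < m1"
proof (rule ccontr)
  assume neg: "\<not> ?thesis"
  have finY: "finite Y" using Y(1) finV finite_subset by blast
  let ?cl = "pattern Y {..<L}"
  have "\<exists>Y' ts. Y' \<subseteq> Y \<and> (\<forall>i<s. ts i < L \<and> c * L \<le> card (?cl i (ts i)) \<and> (\<forall>v \<in> Y'. \<not> red v i (ts i))) \<and>
      (\<epsilon> / 2) ^ s * card Y \<le> card Y'" if "s \<le> \<kappa>" for s
    using that
  proof (induction s)
    case 0
    then show ?case by (intro exI[of _ Y]) auto
  next
    case (Suc s)
    then obtain Y' ts where IH: "Y' \<subseteq> Y" "\<forall>i<s. ts i < L \<and> c * L \<le> card (?cl i (ts i)) \<and> (\<forall>v \<in> Y'. \<not> red v i (ts i))"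
      "(\<epsilon> / 2) ^ s * card Y \<le> card Y'"
      by auto
    have finY': "finite Y'" using IH(1) finY finite_subset by blast
    let ?rare = "{t \<in> {..<L}. card (?cl s t) < c * L}"
    have "real (card ?rare) \<le> 2 ^ card Y * (c * L)" using finY c by (intro few_rare_patterns) auto
    also have "\<dots> \<le> \<epsilon> / 4 * L" using c(1) mult_right_mono[OF c(1), of "real L"] by (simp add: mult.assoc)
    finally have rare_le: "real (card ?rare) \<le> \<epsilon> / 4 * L" .
    \<comment> \<open>Otherwise non-rare indices contribute at most the fraction
      \<open>\<epsilon> / 2\<close> of all pairs and rare ones at most
      \<open>\<epsilon> / 4\<close>, short of the average \<open>\<epsilon>\<close>. The case of
      empty \<open>Y'\<close> is separate: then every index would have to be rare.\<close>
    have "\<exists>t<L. c * L \<le> card (?cl s t) \<and> \<epsilon> / 2 * card Y' \<le> card {v \<in> Y'. \<not> red v s t}"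
    proof (rule ccontr)
      assume none: "\<not> ?thesis"
      have "\<epsilon> * L * card Y' \<le> (\<Sum>v\<in>Y'. real (blues v s))"
      proof -
        have "\<epsilon> * L \<le> blues v s" if "v \<in> Y'" for v using Y(2)[of v s] IH(1) Suc.prems that by auto
        then show ?thesis
          using sum_bounded_below[of Y' "\<epsilon> * L" "\<lambda>v. real (blues v s)"] by (simp add: mult.commute)
      qed
      also have "\<dots> = real (\<Sum>v\<in>Y'. card {t \<in> {..<L}. \<not> red v s t})" by (simp add: blues_def)
      also have "\<dots> = (\<Sum>t<L. real (card {v \<in> Y'. \<not> red v s t}))"
        using sum_card_swap[OF finY' finite_lessThan[of L], of "\<lambda>v t. \<not> red v s t"] by simp
      also have "\<dots> \<le> (\<Sum>t<L. \<epsilon> / 2 * card Y' + (if t \<in> ?rare then real (card Y') else 0))"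
      proof (intro sum_mono)
        fix t assume t: "t \<in> {..<L}"
        have "card {v \<in> Y'. \<not> red v s t} \<le> card Y'" using finY' by (intro card_mono) auto
        then show "real (card {v \<in> Y'. \<not> red v s t}) \<le> \<epsilon> / 2 * card Y' + (if t \<in> ?rare then real (card Y') else 0)"
          using none t \<epsilon>(1) by (cases "t \<in> ?rare") (auto simp: not_le intro: add_increasing less_imp_le)
      qed
      also have "\<dots> = \<epsilon> / 2 * card Y' * L + card ?rare * real (card Y')"
        by (simp add: sum.distrib sum.If_cases Int_def conj_commute)
      also have "\<dots> \<le> \<epsilon> / 2 * card Y' * L + \<epsilon> / 4 * L * real (card Y')"
        using rare_le by (intro add_left_mono mult_right_mono) auto
      finally have "\<epsilon> * (L * card Y') \<le> 3 / 4 * \<epsilon> * (L * card Y')" by (simp add: algebra_simps)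
      then have "card Y' = 0" using \<epsilon>(1) L by (simp add: mult_le_cancel_right)
      then have "?rare = {..<L}" using none by (auto simp: not_le)
      then have "real L \<le> \<epsilon> / 4 * L" using rare_le by simp
      then show False using \<epsilon>(2) L mult_right_mono[OF \<epsilon>(2), of "real L"] by simp
    qed
    then obtain t where t: "t < L" "c * L \<le> card (?cl s t)" "\<epsilon> / 2 * card Y' \<le> card {v \<in> Y'. \<not> red v s t}" by blast
    have "(\<epsilon> / 2) ^ Suc s * card Y \<le> \<epsilon> / 2 * card Y'" using IH(3) \<epsilon>(1) mult_left_mono[OF IH(3), of "\<epsilon> / 2"] by simp
    then show ?case
      using IH(1,2) t by (intro exI[of _ "{v \<in> Y'. \<not> red v s t}"] exI[of _ "ts(s := t)"]) (auto simp: less_Suc_eq)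
  qed
  from this[of \<kappa>] obtain Y' ts where Y': "Y' \<subseteq> Y"
    "\<forall>i<\<kappa>. ts i < L \<and> c * L \<le> card (?cl i (ts i)) \<and> (\<forall>v \<in> Y'. \<not> red v i (ts i))" "(\<epsilon> / 2) ^ \<kappa> * card Y \<le> card Y'"
    by auto
  have "m1 \<le> card Y'" using neg Y'(3) by linarith
  from ex_subset_card[OF this] obtain Z where Z: "Z \<subseteq> Y'" "card Z = m1" by blast
  show False
  proof (rule no_small[of Z "\<lambda>i. ?cl i (ts i)"])
    fix i assume i: "i < \<kappa>"
    have "b * L \<le> c * L" using c(2) by (intro mult_right_mono) auto
    also have "c * L \<le> card (?cl i (ts i))" using Y'(2) i by blast
    finally show "?cl i (ts i) \<subseteq> {..<L} \<and> b * L \<le> card (?cl i (ts i))" using pattern_subset by blast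
  next
    fix v i assume "v \<in> Z" "i < \<kappa>"
    then have "v \<in> Y" "\<not> red v i (ts i)" using Y'(1,2) Z(1) by blast+
    then have "{t \<in> ?cl i (ts i). red v i t} = {}" by (auto simp: pattern_def)
    then show "4 * z * card {t \<in> ?cl i (ts i). red v i t} \<le> card (?cl i (ts i))" by (simp only: card.empty mult_0_right le0)
  qed (use Z Y' Y in auto)
qed

text \<open>If the sum exceeded \<open>m1 * L\<close>, some index with a non-rare pattern would be
  blue to \<open>m1\<close> vertices of \<open>D\<close> at once, since rare indices contribute at
  most \<open>L\<close> in total. Its pattern class serves in the common set of \<open>D\<close>;
  the other sets are taken whole, because there the red degrees are at most
  \<open>(\<epsilon> + \<zeta>) * L\<close>. This contradicts \<open>no_small\<close>.\<close>

lemma mass_bound: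
  fixes c \<epsilon> :: real
  assumes D: "D \<subseteq> V" "\<And>v. v \<in> D \<Longrightarrow> side v = i \<and> \<beta> v \<le> \<epsilon> * L" and i: "i < \<kappa>"
    and \<epsilon>: "4 * z * (\<epsilon> + \<zeta>) \<le> 1" and c: "2 ^ card D * c * card D \<le> 1" "b \<le> c" "b \<le> 1" "0 \<le> c"
  shows "(\<Sum>v\<in>D. \<beta> v) \<le> m1 * L"
proof (rule ccontr)
  assume neg: "\<not> ?thesis"
  have finD: "finite D" using D(1) finV finite_subset by blast
  let ?rare = "{t \<in> {..<L}. card (pattern D {..<L} i t) < c * L}"
  have "\<exists>t<L. c * L \<le> card (pattern D {..<L} i t) \<and> m1 \<le> card {v \<in> D. \<not> red v i t}"
  proof (rule ccontr)
    assume none: "\<not> ?thesis"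
    have "(\<Sum>v\<in>D. \<beta> v) = (\<Sum>v\<in>D. card {t \<in> {..<L}. \<not> red v i t})" using D(2) by (simp add: blues_def)
    also have "\<dots> = (\<Sum>t<L. card {v \<in> D. \<not> red v i t})" using finD by (intro sum_card_swap) auto
    also have "\<dots> \<le> (\<Sum>t<L. (m1 - 1) + (if t \<in> ?rare then card D else 0))"
    proof (intro sum_mono)
      fix t assume t: "t \<in> {..<L}"
      have "card {v \<in> D. \<not> red v i t} \<le> card D" using finD by (intro card_mono) auto
      then show "card {v \<in> D. \<not> red v i t} \<le> (m1 - 1) + (if t \<in> ?rare then card D else 0)"
        using none t m1 by (cases "t \<in> ?rare") (auto simp: not_le)
    qed
    also have "\<dots> = (m1 - 1) * L + card ?rare * card D"
      by (simp add: sum.distrib sum.If_cases Int_def conj_commute)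
    finally have "(\<Sum>v\<in>D. \<beta> v) \<le> (m1 - 1) * L + card ?rare * card D" .
    moreover have "card ?rare * card D \<le> L"
    proof -
      have "real (card ?rare) \<le> 2 ^ card D * (c * L)" using finD c by (intro few_rare_patterns) auto
      then have "real (card ?rare) * card D \<le> 2 ^ card D * (c * L) * card D" by (intro mult_right_mono) auto
      also have "\<dots> = (2 ^ card D * c * card D) * L" by simp
      also have "\<dots> \<le> 1 * real L" using c(1) by (intro mult_right_mono) auto
      finally have "real (card ?rare * card D) \<le> real L" by simp
      then show ?thesis by linarith
    qed
    moreover have "(m1 - 1) * L + L = m1 * L" using m1 by (cases m1) auto
    ultimately show False using neg by linarith
  qed
  then obtain t where t: "t < L" "c * L \<le> card (pattern D {..<L} i t)" "m1 \<le> card {v \<in> D. \<not> red v i t}" by blast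
  from ex_subset_card[OF t(3)] obtain Z where Z: "Z \<subseteq> {v \<in> D. \<not> red v i t}" "card Z = m1" by blast
  show False
  proof (rule no_small[of Z "\<lambda>j. if j = i then pattern D {..<L} i t else {..<L}"])
    fix j assume j: "j < \<kappa>"
    have "b * L \<le> c * L" "b * L \<le> 1 * real L" using c(2,3) by (intro mult_right_mono; simp)+
    then show "(if j = i then pattern D {..<L} i t else {..<L}) \<subseteq> {..<L} \<and>
      b * L \<le> card (if j = i then pattern D {..<L} i t else {..<L})"
      using t(2) pattern_subset[of D "{..<L}"] by (cases "j = i") simp_all
  next
    fix v j assume vj: "v \<in> Z" "j < \<kappa>"
    then have v: "v \<in> D" "\<not> red v i t" using Z(1) by auto
    show "4 * z * card {t' \<in> if j = i then pattern D {..<L} i t else {..<L}. red v j t'}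
        \<le> card (if j = i then pattern D {..<L} i t else {..<L})"
    proof (cases "j = i")
      case True
      then have "{t' \<in> if j = i then pattern D {..<L} i t else {..<L}. red v j t'} = {}"
        using v by (auto simp: pattern_def)
      then show ?thesis by (simp only: card.empty mult_0_right le0)
    next
      case False
      have "real (reds v j) \<le> \<beta> v + \<zeta> * L" using reds_other[of v j] v D vj False by auto
      also have "\<dots> \<le> (\<epsilon> + \<zeta>) * L" using D(2)[OF v(1)] unfolding distrib_right by linarith
      finally have "4 * z * real (reds v j) \<le> 4 * z * ((\<epsilon> + \<zeta>) * L)" by (intro mult_left_mono) auto
      also have "\<dots> = 4 * z * (\<epsilon> + \<zeta>) * L" by simp
      also have "\<dots> \<le> 1 * real L" using \<epsilon> by (intro mult_right_mono) auto
      finally have "real (4 * z * reds v j) \<le> real L" by simp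
      then have "4 * z * reds v j \<le> L" by linarith
      then show ?thesis using False by (simp add: reds_def)
    qed
  qed (use Z D in auto)
qed

section \<open>The balance at one scale\<close>

definition exceptional :: "real \<Rightarrow> 'v set" where "exceptional \<epsilon> = {v \<in> V. \<epsilon> * L < \<beta> v}"

lemma exceptional: "exceptional \<epsilon> \<subseteq> V" "finite (exceptional \<epsilon>)"
  using finV by (auto simp: exceptional_def)

text \<open>The vertices \<open>v\<close> of intermediate scale have few red neighbours outside \<open>A\<^sub>i\<close>, \<open>i = side v\<close>, in total,
  so the set \<open>Rem\<close> of all these neighbours can be removed.  Outside of \<open>Rem\<close> and of the rare patterns
  the excess \<open>X t\<close> of red neighbours is at least \<open>1\<close>; on \<open>Rem\<close> it is still at least \<open>- m1\<close>.\<close>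

lemma scale_contradiction:
  fixes \<epsilon> \<epsilon>' \<eta> c :: real
  defines "D \<equiv> exceptional \<epsilon>' - exceptional \<epsilon>"
  assumes K: "card (exceptional \<epsilon>) \<le> K" and D: "\<zeta> * card D \<le> \<eta>" "real (\<Sum>v\<in>D. \<beta> v) \<le> \<eta> * L"
    and c: "b \<le> c" "0 \<le> c" "4 * z * (\<epsilon>' + \<zeta>) \<le> c"
    and sum: "2 * \<eta> * (real m1 + 1) + (real K + 1) * (2 * real \<kappa> * 2 ^ K * c) + K * \<zeta> < 1"
  shows False
proof -
  define T where "T = {t \<in> {..<L}. \<forall>v \<in> D. \<forall>j<\<kappa>. j \<noteq> side v \<longrightarrow> \<not> red v j t}"
  have T: "T \<subseteq> {..<L}" "finite T" by (auto simp: T_def)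
  define Rem where "Rem = {..<L} - T"
  have finD: "finite D" using exceptional(2) by (simp add: D_def)
  have DV: "D \<subseteq> V" using exceptional(1) by (auto simp: D_def)
  let ?C = "exceptional \<epsilon>"
  define rareS where "rareS U = (\<Union>i<\<kappa>. {t \<in> U. card (pattern ?C U i t) < c * L})" for U
  have rareS: "card (rareS U) \<le> \<kappa> * (2 ^ K * (c * L))" if "finite U" for U
  proof -
    have "card (rareS U) \<le> (\<Sum>i<\<kappa>. card {t \<in> U. card (pattern ?C U i t) < c * L})"
      unfolding rareS_def by (intro card_UN_le) auto
    then have "real (card (rareS U)) \<le> real (\<Sum>i<\<kappa>. card {t \<in> U. card (pattern ?C U i t) < c * L})"
      by (rule of_nat_mono)
    also have "\<dots> = (\<Sum>i<\<kappa>. real (card {t \<in> U. card (pattern ?C U i t) < c * L}))" by (rule of_nat_sum)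
    also have "\<dots> \<le> (\<Sum>i<\<kappa>. 2 ^ K * (c * L))"
    proof (rule sum_mono)
      fix i
      have "real (card {t \<in> U. card (pattern ?C U i t) < c * L}) \<le> 2 ^ card ?C * (c * L)"
        using exceptional(2) that c(2) by (intro few_rare_patterns) auto
      also have "\<dots> \<le> 2 ^ K * (c * L)" using K c(2) by (intro mult_right_mono power_increasing) auto
      finally show "real (card {t \<in> U. card (pattern ?C U i t) < c * L}) \<le> 2 ^ K * (c * L)" .
    qed
    finally show ?thesis by simp
  qed
  \<comment> \<open>Patterns are used twice: within all indices for the bound \<open>- m1\<close>,
    and within \<open>T\<close> for the bound \<open>1\<close>, where the vertices of
    \<open>D\<close> must be blue to every index of a class in a foreign set.\<close>
  define Rare where "Rare = rareS {..<L} \<union> rareS T"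
  have cRare: "card Rare \<le> 2 * real \<kappa> * 2 ^ K * c * L"
  proof -
    have "card Rare \<le> card (rareS {..<L}) + card (rareS T)" unfolding Rare_def by (rule card_Un_le)
    then have "real (card Rare) \<le> real (card (rareS {..<L})) + real (card (rareS T))" by linarith
    then show ?thesis using rareS[of "{..<L}"] rareS[OF T(2)] by (simp add: algebra_simps)
  qed
  have RareL: "Rare \<subseteq> {..<L}" using T(1) by (auto simp: Rare_def rareS_def)
  have cRem: "card Rem \<le> 2 * \<eta> * L"
  proof -
    have "Rem \<subseteq> (\<Union>v\<in>D. \<Union>j\<in>{..<\<kappa>} - {side v}. {t \<in> {..<L}. red v j t})" by (auto simp: Rem_def T_def)
    then have "card Rem \<le> card (\<Union>v\<in>D. \<Union>j\<in>{..<\<kappa>} - {side v}. {t \<in> {..<L}. red v j t})"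
      using finD by (intro card_mono) auto
    also have "\<dots> \<le> (\<Sum>v\<in>D. card (\<Union>j\<in>{..<\<kappa>} - {side v}. {t \<in> {..<L}. red v j t}))"
      using finD by (intro card_UN_le)
    also have "\<dots> \<le> (\<Sum>v\<in>D. \<Sum>j\<in>{..<\<kappa>} - {side v}. reds v j)"
      unfolding reds_def by (intro sum_mono card_UN_le) auto
    finally have "card Rem \<le> (\<Sum>v\<in>D. \<Sum>j\<in>{..<\<kappa>} - {side v}. reds v j)" .
    then have "real (card Rem) \<le> real (\<Sum>v\<in>D. \<Sum>j\<in>{..<\<kappa>} - {side v}. reds v j)" by (rule of_nat_mono)
    also have "\<dots> = (\<Sum>v\<in>D. real (\<Sum>j\<in>{..<\<kappa>} - {side v}. reds v j))" by simp
    also have "\<dots> \<le> (\<Sum>v\<in>D. \<beta> v + \<zeta> * L)" using sum_other DV by (intro sum_mono) blast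
    also have "\<dots> = real (\<Sum>v\<in>D. \<beta> v) + (\<zeta> * card D) * L" by (simp add: sum.distrib)
    also have "\<dots> \<le> \<eta> * L + \<eta> * L" using D by (intro add_mono mult_right_mono) auto
    finally show ?thesis by simp
  qed
  define rv where "rv v t = card {i \<in> {..<\<kappa>}. red v i t}" for v t
  \<comment> \<open>By \<open>red_bound\<close> the average of \<open>X t\<close> over
    \<open>t\<close> is at most \<open>K * \<zeta>\<close>, while the pointwise lower bounds bring
    it close to \<open>1\<close>.\<close>
  define X where "X t = (\<Sum>v\<in>?C. int (rv v t) - 1)" for t
  have nonneg_rv: "int (rv v t) - 1 \<ge> (if rv v t = 0 then - 1 else 0)" for v t by simp
  have X1: "- int K \<le> X t" for t
  proof -
    have "(\<Sum>v\<in>?C. - 1) \<le> X t" unfolding X_def by (intro sum_mono) simp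
    then show ?thesis using K by simp
  qed
  have X2: "- int m1 \<le> X t" if t: "t < L" "t \<notin> Rare" for t
  proof (rule ccontr)
    assume neg: "\<not> ?thesis"
    have "(\<Sum>v\<in>?C. if rv v t = 0 then - 1 else 0) \<le> X t" unfolding X_def using nonneg_rv by (intro sum_mono)
    moreover have "(\<Sum>v\<in>?C. if rv v t = 0 then - 1 else 0) = - int (card {v \<in> ?C. rv v t = 0})"
      using exceptional(2) by (simp add: sum.If_cases Int_def)
    ultimately have "m1 \<le> card {v \<in> ?C. rv v t = 0}" using neg by linarith
    from ex_subset_card[OF this] obtain Z where Z: "Z \<subseteq> {v \<in> ?C. rv v t = 0}" "card Z = m1" by blast
    show False
    proof (rule no_small[of Z "\<lambda>i. pattern ?C {..<L} i t"])
      fix i assume i: "i < \<kappa>"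
      have "c * L \<le> card (pattern ?C {..<L} i t)" using t i by (auto simp: Rare_def rareS_def not_less)
      moreover have "b * L \<le> c * L" using c(1) by (intro mult_right_mono) auto
      ultimately show "pattern ?C {..<L} i t \<subseteq> {..<L} \<and> b * L \<le> card (pattern ?C {..<L} i t)" using pattern_subset by simp
    next
      fix v i assume vi: "v \<in> Z" "i < \<kappa>"
      then have "{i \<in> {..<\<kappa>}. red v i t} = {}" using Z(1) by (auto simp: rv_def)
      then have "{t' \<in> pattern ?C {..<L} i t. red v i t'} = {}" using vi Z(1) by (auto simp: pattern_def)
      then show "4 * z * card {t' \<in> pattern ?C {..<L} i t. red v i t'} \<le> card (pattern ?C {..<L} i t)" by (simp only: card.empty mult_0_right le0)
    qed (use Z exceptional in auto)
  qed
  have X3: "1 \<le> X t" if t: "t \<in> T" "t \<notin> Rare" for t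
  proof (rule ccontr)
    assume neg: "\<not> ?thesis"
    define Vi where "Vi i = {v \<in> V - ?C. side v = i}" for i
    define Ci where "Ci i = {v \<in> ?C. \<forall>j<\<kappa>. j \<noteq> i \<longrightarrow> \<not> red v j t}" for i
    \<comment> \<open>The count on the right is \<open>\<kappa> \<ge> 2\<close> for a vertex without
      red representatives and \<open>1\<close> for a vertex with exactly one. Hence
      \<open>X t \<le> 0\<close> would make the sets \<open>Ci i\<close> together at least as large
      as the set of exceptional vertices, and some \<open>Vi i \<union> Ci i\<close> would reach
      size \<open>r\<close>.\<close>
    have two: "2 - int (rv v t) \<le> int (card {i \<in> {..<\<kappa>}. \<forall>j<\<kappa>. j \<noteq> i \<longrightarrow> \<not> red v j t})" for v
    proof -
      let ?Q = "{i \<in> {..<\<kappa>}. \<forall>j<\<kappa>. j \<noteq> i \<longrightarrow> \<not> red v j t}"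
      consider "rv v t = 0" | "rv v t = 1" | "2 \<le> rv v t" by linarith
      then show ?thesis
      proof cases
        case 1
        then have "{i \<in> {..<\<kappa>}. red v i t} = {}" by (simp add: rv_def)
        then have "?Q = {..<\<kappa>}" by auto
        then show ?thesis using \<kappa> by simp
      next
        case 2
        then obtain i where "{i \<in> {..<\<kappa>}. red v i t} = {i}" by (auto simp: rv_def card_1_singleton_iff)
        then have "i \<in> ?Q" by blast
        then have "0 < card ?Q" by (subst card_gt_0_iff) auto
        then show ?thesis using 2 by linarith
      qed simp
    qed
    have "int (card ?C) \<le> (\<Sum>v\<in>?C. 2 - int (rv v t))"
      using neg by (simp add: X_def sum_subtractf)
    also have "\<dots> \<le> (\<Sum>v\<in>?C. int (card {i \<in> {..<\<kappa>}. \<forall>j<\<kappa>. j \<noteq> i \<longrightarrow> \<not> red v j t}))"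
      using two by (intro sum_mono)
    also have "\<dots> = int (\<Sum>i<\<kappa>. card (Ci i))"
      unfolding Ci_def of_nat_sum[symmetric] using exceptional(2)
      by (subst sum_card_swap[of ?C "{..<\<kappa>}" "\<lambda>v i. \<forall>j<\<kappa>. j \<noteq> i \<longrightarrow> \<not> red v j t"]) simp_all
    finally have 1: "card ?C \<le> (\<Sum>i<\<kappa>. card (Ci i))" by (simp only: of_nat_le_iff)
    have "(\<Sum>i<\<kappa>. \<Sum>v\<in>{v \<in> V - ?C. side v = i}. 1) = (\<Sum>v\<in>V - ?C. 1::nat)"
      using finV side(1) by (intro sum.group) auto
    then have "(\<Sum>i<\<kappa>. card (Vi i)) = card (V - ?C)" by (simp add: Vi_def)
    then have "(\<Sum>i<\<kappa>. card (Vi i)) + card ?C = card V"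
      using exceptional finV by (simp add: card_Diff_subset card_mono)
    then have gt: "\<kappa> * (r - 1) < (\<Sum>i<\<kappa>. card (Vi i) + card (Ci i))" using 1 large by (simp add: sum.distrib)
    have "\<exists>i<\<kappa>. r - 1 < card (Vi i) + card (Ci i)"
    proof (rule ccontr)
      assume "\<not> ?thesis"
      then have "card (Vi i) + card (Ci i) \<le> r - 1" if "i < \<kappa>" for i using that not_less by blast
      then have "(\<Sum>i<\<kappa>. card (Vi i) + card (Ci i)) \<le> (\<Sum>i<\<kappa>. r - 1)" by (intro sum_mono) simp
      with gt show False by simp
    qed
    then obtain i where i: "i < \<kappa>" "r \<le> card (Vi i) + card (Ci i)" by auto
    have "card (Vi i \<union> Ci i) = card (Vi i) + card (Ci i)"
      using finV exceptional(2) by (intro card_Un_disjoint) (auto simp: Vi_def Ci_def)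
    then have "r \<le> card (Vi i \<union> Ci i)" using i(2) by simp
    then show False
    proof (rule no_large[of i "Vi i \<union> Ci i" "\<lambda>j. pattern ?C T j t", OF i(1), rotated])
      fix j assume j: "j < \<kappa>" "j \<noteq> i"
      have cL: "c * L \<le> card (pattern ?C T j t)" using t j by (auto simp: Rare_def rareS_def not_less)
      moreover have "b * L \<le> c * L" using c(1) by (intro mult_right_mono) auto
      ultimately show "pattern ?C T j t \<subseteq> {..<L} \<and> b * L \<le> card (pattern ?C T j t)"
        using T(1) pattern_subset[of ?C T j t] by auto
      fix v assume v: "v \<in> Vi i \<union> Ci i"
      show "4 * z * card {t' \<in> pattern ?C T j t. red v j t'} \<le> card (pattern ?C T j t)"
      \<comment> \<open>Vertices below the finer scale have red degree at most
        \<open>(\<epsilon>' + \<zeta>) * L\<close>, negligible even against a pattern class of size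
        \<open>c * L\<close>. All others have no red index in the class: those in \<open>D\<close>
        by the choice of \<open>T\<close>, those in \<open>Ci i\<close> by the pattern.\<close>
      proof (cases "v \<in> Vi i - D")
        case True
        then have v': "v \<in> V" "\<beta> v \<le> \<epsilon>' * L" "side v = i" by (auto simp: Vi_def D_def exceptional_def)
        have "card {t' \<in> pattern ?C T j t. red v j t'} \<le> reds v j"
          unfolding reds_def using T by (intro card_mono) (auto simp: pattern_def)
        then have "real (card {t' \<in> pattern ?C T j t. red v j t'}) \<le> reds v j" by (rule of_nat_mono)
        also have "\<dots> \<le> (\<epsilon>' + \<zeta>) * L" using reds_other[OF v'(1) j(1)] v' j by (simp add: algebra_simps)
        finally have "4 * z * real (card {t' \<in> pattern ?C T j t. red v j t'}) \<le> 4 * z * ((\<epsilon>' + \<zeta>) * L)"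
          by (intro mult_left_mono) auto
        also have "\<dots> = 4 * z * (\<epsilon>' + \<zeta>) * L" by simp
        also have "\<dots> \<le> c * L" using c(3) by (intro mult_right_mono) auto
        finally have "real (4 * z * card {t' \<in> pattern ?C T j t. red v j t'}) \<le> real (card (pattern ?C T j t))" using cL by simp
        then show ?thesis by linarith
      next
        case False
        have "{t' \<in> pattern ?C T j t. red v j t'} = {}"
        proof (cases "v \<in> D")
          case True
          then have "side v = i" using v by (auto simp: Vi_def Ci_def D_def)
          then show ?thesis using True j by (auto simp: pattern_def T_def)
        next
          case False
          then have "v \<in> Ci i" using v \<open>v \<notin> Vi i - D\<close> by blast
          then show ?thesis using j by (auto simp: pattern_def Ci_def)
        qed
        then show ?thesis by (simp only: card.empty mult_0_right le0)
      qed
    qed (use exceptional in \<open>auto simp: Vi_def Ci_def\<close>)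
  qed
  have lower: "1 - (real m1 + 1) * (if t \<in> Rem then 1 else 0) - (real K + 1) * (if t \<in> Rare then 1 else 0) \<le> real_of_int (X t)"
    if "t < L" for t
  proof -
    have "t \<in> Rem \<or> t \<in> T" using that by (auto simp: Rem_def)
    then consider "t \<in> Rare" | "t \<notin> Rare" "t \<in> Rem" | "t \<notin> Rare" "t \<in> T" by blast
    then show ?thesis
    proof cases
      case 1
      have "- real K \<le> X t" using X1[of t] by linarith
      then show ?thesis using 1 by simp
    next
      case 2
      have "- real m1 \<le> X t" using X2[OF that 2(1)] by linarith
      then show ?thesis using 2 by simp
    next
      case 3
      have "1 \<le> real_of_int (X t)" using X3[OF 3(2,1)] by linarith
      then show ?thesis using 3 by (simp add: Rem_def)
    qed
  qed
  have "L - (real m1 + 1) * real (card Rem) - (real K + 1) * real (card Rare)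
      = (\<Sum>t<L. 1 - (real m1 + 1) * (if t \<in> Rem then 1 else 0) - (real K + 1) * (if t \<in> Rare then 1 else 0))"
  proof -
    have "{..<L} \<inter> Rem = Rem" "{..<L} \<inter> Rare = Rare" using RareL by (auto simp: Rem_def)
    then have "(\<Sum>t<L. if t \<in> Rem then 1 else 0) = real (card Rem)" "(\<Sum>t<L. if t \<in> Rare then 1 else 0) = real (card Rare)"
      by (simp_all add: sum.If_cases)
    then show ?thesis
      by (simp add: sum_subtractf flip: sum_distrib_left)
  qed
  also have "\<dots> \<le> (\<Sum>t<L. real_of_int (X t))" using lower by (intro sum_mono) auto
  also have "\<dots> = (\<Sum>v\<in>?C. (\<Sum>t<L. real (rv v t)) - L)"
    unfolding X_def by (simp add: sum_subtractf sum.swap[of _ ?C])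
  also have "\<dots> \<le> (\<Sum>v\<in>?C. \<zeta> * L)"
  proof (intro sum_mono)
    fix v assume "v \<in> ?C"
    then have v: "v \<in> V" using exceptional(1) by blast
    have "(\<Sum>t<L. rv v t) = (\<Sum>i<\<kappa>. card {t \<in> {..<L}. red v i t})"
      unfolding rv_def by (intro sum_card_swap) auto
    then have "(\<Sum>t<L. real (rv v t)) \<le> (1 + \<zeta>) * L" using red_bound[OF v] by (metis of_nat_sum)
    then show "(\<Sum>t<L. real (rv v t)) - L \<le> \<zeta> * L" by (simp add: algebra_simps)
  qed
  also have "\<dots> \<le> K * (\<zeta> * L)" using K \<zeta> by (simp add: mult_right_mono)
  finally have "L \<le> (real m1 + 1) * real (card Rem) + (real K + 1) * real (card Rare) + K * (\<zeta> * L)" by simp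
  also have "\<dots> \<le> (real m1 + 1) * (2 * \<eta> * L) + (real K + 1) * (2 * real \<kappa> * 2 ^ K * c * L) + K * (\<zeta> * L)"
    using cRem cRare by (intro add_right_mono add_mono mult_left_mono) auto
  also have "\<dots> = (2 * \<eta> * (real m1 + 1) + (real K + 1) * (2 * real \<kappa> * 2 ^ K * c) + K * \<zeta>) * L" by (simp add: algebra_simps)
  also have "\<dots> < 1 * real L" using sum L by (intro mult_strict_right_mono) auto
  finally show False by simp
qed

end

text \<open>Each scale is negligible against the rarity threshold of the previous one. The gaps
  between consecutive scales are disjoint and have total mass at most
  \<open>\<kappa> * m1 * L\<close> by \<open>mass_bound\<close>, so among \<open>Q\<close> gaps one
  has mass at most \<open>\<eta> * L\<close>; there \<open>scale_contradiction\<close>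
  applies.\<close>

lemma no_clusters:
  assumes "2 \<le> \<kappa>" "1 \<le> m1" "1 \<le> z"
  shows "\<exists>b \<zeta>. 0 < b \<and> 0 < \<zeta> \<and> (\<forall>(V :: 'v set) red L r. \<not> clusters V red \<kappa> L r m1 z b \<zeta>)"
proof -
  define \<eta> where "\<eta> = 1 / (8 * (real m1 + 1))"
  \<comment> \<open>\<open>Kf \<epsilon>\<close> bounds the number of exceptional vertices via
    \<open>few_all_blue\<close>. The rarity threshold \<open>cf \<epsilon>\<close> makes the rare
    indices, weighted by \<open>Kf \<epsilon> + 1\<close>, cost only \<open>\<epsilon> / 8\<close>
    in the final balance.\<close>
  define Kf where "Kf \<epsilon> = nat \<lceil>m1 * (2 / \<epsilon>) ^ \<kappa>\<rceil>" for \<epsilon> :: real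
  define cf where "cf \<epsilon> = \<epsilon> / (16 * \<kappa> * (real (Kf \<epsilon>) + 1) * 2 ^ Kf \<epsilon>)" for \<epsilon> :: real
  \<comment> \<open>The factor \<open>16 * z\<close> keeps
    \<open>4 * z * (e (Suc q) + \<zeta>)\<close> below the threshold \<open>cf (e q)\<close>, as
    \<open>scale_contradiction\<close> requires; \<open>e 0\<close> does the same for
    \<open>mass_bound\<close>, with \<open>1\<close> in place of the threshold.\<close>
  define e where "e = rec_nat (1 / (16 * real z)) (\<lambda>_ x. cf x / (16 * z))"
  have e0: "e 0 = 1 / (16 * real z)" and eS: "e (Suc q) = cf (e q) / (16 * z)" for q by (simp_all add: e_def)
  have \<kappa>: "2 \<le> real \<kappa>" and z: "1 \<le> real z" using assms by auto
  have \<eta>: "0 < \<eta>" "\<eta> \<le> 1 / 16" "2 * \<eta> * (real m1 + 1) = 1 / 4"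
    using assms(2) by (auto simp: \<eta>_def field_simps)
  have cf_eq: "2 * real \<kappa> * (real (Kf \<epsilon>) + 1) * 2 ^ Kf \<epsilon> * cf \<epsilon> = \<epsilon> / 8" for \<epsilon>
  proof -
    define N where "N = \<kappa> * (real (Kf \<epsilon>) + 1) * 2 ^ Kf \<epsilon>"
    have "0 < N" using \<kappa> unfolding N_def by (intro mult_pos_pos add_nonneg_pos) auto
    then have "2 * N * (\<epsilon> / (16 * N)) = \<epsilon> / 8" by simp
    moreover have "cf \<epsilon> = \<epsilon> / (16 * N)" by (simp only: cf_def N_def mult.assoc)
    ultimately show ?thesis by (simp only: N_def mult.assoc)
  qed
  have cf_pos: "0 < cf \<epsilon>" if "0 < \<epsilon>" for \<epsilon>
    using that \<kappa> by (auto simp: cf_def intro!: divide_pos_pos mult_pos_pos add_nonneg_pos)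
  have cf_small: "2 ^ Kf \<epsilon> * cf \<epsilon> * (real (Kf \<epsilon>) + 1) \<le> \<epsilon> / 32" if "0 < \<epsilon>" for \<epsilon>
  proof -
    have "4 * (2 ^ Kf \<epsilon> * cf \<epsilon> * (real (Kf \<epsilon>) + 1)) \<le> 2 * real \<kappa> * (2 ^ Kf \<epsilon> * cf \<epsilon> * (real (Kf \<epsilon>) + 1))"
      using \<kappa> cf_pos[OF that] by (intro mult_right_mono) auto
    also have "\<dots> = 2 * real \<kappa> * (real (Kf \<epsilon>) + 1) * 2 ^ Kf \<epsilon> * cf \<epsilon>" by (simp only: mult_ac)
    also have "\<dots> = \<epsilon> / 8" by (rule cf_eq)
    finally show ?thesis by simp
  qed
  have cf_2: "2 ^ Kf \<epsilon> * cf \<epsilon> \<le> \<epsilon> / 32" if "0 < \<epsilon>" for \<epsilon>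
  proof -
    have "2 ^ Kf \<epsilon> * cf \<epsilon> * 1 \<le> 2 ^ Kf \<epsilon> * cf \<epsilon> * (real (Kf \<epsilon>) + 1)"
      using cf_pos[OF that] by (intro mult_left_mono) auto
    then show ?thesis using cf_small[OF that] by linarith
  qed
  have cf_le: "cf \<epsilon> \<le> \<epsilon>" if "0 < \<epsilon>" for \<epsilon>
  proof -
    have "1 * cf \<epsilon> \<le> 2 ^ Kf \<epsilon> * cf \<epsilon>" using cf_pos[OF that] by (intro mult_right_mono) auto
    then show ?thesis using cf_2[OF that] that by linarith
  qed
  have e_pos: "0 < e q" for q by (induction q) (use z cf_pos in \<open>auto simp: e0 eS\<close>)
  have e_Suc: "e (Suc q) \<le> cf (e q)" for q
  proof -
    have "cf (e q) / (16 * z) \<le> cf (e q) / 1" using z less_imp_le[OF cf_pos[OF e_pos, of q]] by (intro divide_left_mono) auto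
    then show ?thesis by (simp add: eS)
  qed
  have e_dec: "e (Suc q) \<le> e q" for q using e_Suc[of q] cf_le[OF e_pos, of q] by linarith
  have e_anti: "e q' \<le> e q" if "q \<le> q'" for q q'
    using that by (induction q' rule: dec_induct) (use e_dec order_trans in blast)+
  have e1: "e q \<le> 1 / 16" for q
  proof -
    have "e 0 \<le> 1 / 16" using z by (simp add: e0 field_simps)
    then show ?thesis using e_anti[of 0 q] by linarith
  qed
  define Q where "Q = nat \<lceil>\<kappa> * m1 / \<eta>\<rceil> + 1"
  have Q: "real (\<kappa> * m1) < Q * \<eta>"
  proof -
    have "\<kappa> * m1 / \<eta> < Q" unfolding Q_def by linarith
    then show ?thesis using \<eta>(1) by (simp add: field_simps)
  qed
  \<comment> \<open>\<open>b\<close> lies below the rarity threshold of every scale in use.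
    \<open>\<zeta>\<close> is at most \<open>e Q\<close>, and
    \<open>\<zeta> * Kf (e Q) \<le> \<eta>\<close> keeps the excess red degree of all exceptional
    vertices together harmless.\<close>
  define b where "b = e (Suc Q)"
  define \<zeta> where "\<zeta> = min (e Q) (\<eta> / (real (Kf (e Q)) + 1))"
  have \<zeta>p: "0 < \<zeta>" "\<zeta> \<le> e Q" "\<zeta> * Kf (e Q) \<le> \<eta>"
  proof -
    show "0 < \<zeta>" "\<zeta> \<le> e Q" using e_pos \<eta>(1) by (auto simp: \<zeta>_def intro!: divide_pos_pos)
    have "\<zeta> * Kf (e Q) \<le> \<eta> / (real (Kf (e Q)) + 1) * (real (Kf (e Q)) + 1)"
      using \<eta>(1) by (intro mult_mono) (auto simp: \<zeta>_def)
    also have "\<dots> = \<eta>" by simp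
    finally show "\<zeta> * Kf (e Q) \<le> \<eta>" .
  qed
  have b: "b \<le> cf (e q)" if "q \<le> Q" for q
    using e_anti[of "Suc q" "Suc Q"] e_Suc[of q] that by (simp add: b_def)
  have Kf_mono: "Kf \<epsilon> \<le> Kf \<epsilon>'" if "0 < \<epsilon>'" "\<epsilon>' \<le> \<epsilon>" for \<epsilon> \<epsilon>'
    unfolding Kf_def using that by (intro nat_mono ceiling_mono mult_left_mono power_mono divide_left_mono) auto
  have False if cl: "clusters V red \<kappa> L r m1 z b \<zeta>" for V :: "'v set" and red L r
  proof -
    interpret clusters V red \<kappa> L r m1 z b \<zeta> by (rule cl)
    have cardC: "card (exceptional (e q)) \<le> Kf (e q)" if "q \<le> Q" for q
    proof (rule ccontr)
      assume "\<not> ?thesis"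
      then have "Kf (e q) \<le> card (exceptional (e q))" by simp
      from ex_subset_card[OF this] obtain Y where Y: "Y \<subseteq> exceptional (e q)" "card Y = Kf (e q)" by blast
      have "(e q / 2) ^ \<kappa> * card Y < m1"
      proof (rule few_all_blue[where c = "cf (e q)"])
        fix v i assume vi: "v \<in> Y" "i < \<kappa>"
        then have "e q * L < \<beta> v" using Y(1) by (auto simp: exceptional_def)
        moreover have "\<beta> v \<le> blues v i" using side(2)[OF vi(2)] .
        ultimately show "e q * L \<le> blues v i" by simp
      next
        show "2 ^ card Y * cf (e q) \<le> e q / 4" using cf_2[OF e_pos, of q] e_pos[of q] Y(2) by simp
        show "e q \<le> 1" using e1[of q] by simp
      qed (use Y exceptional e_pos b[OF that] cf_pos[OF e_pos, of q] in \<open>auto intro: less_imp_le\<close>)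
      moreover have "m1 * (2 / e q) ^ \<kappa> \<le> card Y" unfolding Y(2) Kf_def by linarith
      then have "(e q / 2) ^ \<kappa> * (m1 * (2 / e q) ^ \<kappa>) \<le> (e q / 2) ^ \<kappa> * card Y"
        using e_pos[of q] by (intro mult_left_mono) auto
      moreover have "(e q / 2) ^ \<kappa> * (m1 * (2 / e q) ^ \<kappa>) = m1"
        using e_pos[of q] by (simp add: power_divide)
      ultimately show False by linarith
    qed
    have Csub: "exceptional (e q) \<subseteq> exceptional (e q')" if "q \<le> q'" for q q'
    proof
      fix v assume v: "v \<in> exceptional (e q)"
      have "e q' * L \<le> e q * L" using e_anti[OF that] by (intro mult_right_mono) auto
      then show "v \<in> exceptional (e q')" using v by (auto simp: exceptional_def)
    qed
    let ?M = "exceptional (e Q) - exceptional (e 0)"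
    \<comment> \<open>Vertices exceptional already at scale \<open>e 0\<close> are left out, since
      \<open>mass_bound\<close> needs vertices that are almost blue to all foreign sets.\<close>
    have mass: "(\<Sum>v\<in>?M. \<beta> v) \<le> \<kappa> * m1 * L"
    proof -
      have "(\<Sum>v\<in>?M. \<beta> v) = (\<Sum>i<\<kappa>. \<Sum>v\<in>{v \<in> ?M. side v = i}. \<beta> v)"
        using exceptional(2) side(1) by (intro sum.group[symmetric]) auto
      also have "\<dots> \<le> (\<Sum>i<\<kappa>. m1 * L)"
      proof (rule sum_mono)
        fix i assume i: "i \<in> {..<\<kappa>}"
        let ?D = "{v \<in> ?M. side v = i}"
        have cD: "card ?D \<le> Kf (e Q)"
          using card_mono[of "exceptional (e Q)" ?D] exceptional(2) cardC[of Q] by fastforce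
        show "(\<Sum>v\<in>?D. \<beta> v) \<le> m1 * L"
        proof (rule mass_bound[where \<epsilon> = "e 0" and c = "cf (e Q)"])
          show "?D \<subseteq> V" using exceptional(1) by auto
          show "side v = i \<and> \<beta> v \<le> e 0 * L" if "v \<in> ?D" for v using that exceptional(1) by (auto simp: exceptional_def)
          show "i < \<kappa>" using i by simp
          have "real (4 * z) * (e 0 + \<zeta>) \<le> real (4 * z) * (e 0 + e 0)"
            using \<zeta>p(2) e_anti[of 0 Q] by (intro mult_left_mono) auto
          also have "\<dots> \<le> 1" using z by (simp add: e0)
          finally show "real (4 * z) * (e 0 + \<zeta>) \<le> 1" .
          have "2 ^ card ?D * cf (e Q) * card ?D \<le> 2 ^ Kf (e Q) * cf (e Q) * (real (Kf (e Q)) + 1)"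
            using cD cf_pos[OF e_pos, of Q] by (intro mult_mono power_increasing mult_nonneg_nonneg) auto
          also have "\<dots> \<le> 1" using cf_small[OF e_pos, of Q] e1[of Q] by linarith
          finally show "2 ^ card ?D * cf (e Q) * card ?D \<le> 1" .
          show "b \<le> 1" using e1[of "Suc Q"] by (simp add: b_def)
        qed (use b[of Q] cf_pos[OF e_pos, of Q] in auto)
      qed
      finally show ?thesis by simp
    qed
    define D where "D q = exceptional (e (Suc q)) - exceptional (e q)" for q
    have "\<exists>q<Q. real (\<Sum>v\<in>D q. \<beta> v) \<le> \<eta> * L"
    proof (rule ccontr)
      assume neg: "\<not> ?thesis"
      have disj: "D q \<inter> D q' = {}" if "q < q'" for q q'
        using Csub[of "Suc q" q'] that by (auto simp: D_def)
      have disj': "D q \<inter> D q' = {}" if "q \<noteq> q'" for q q'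
        using disj[of q q'] disj[of q' q] that by (cases "q < q'") auto
      have "real Q * (\<eta> * L) \<le> (\<Sum>q<Q. real (\<Sum>v\<in>D q. \<beta> v))"
        using neg sum_bounded_below[of "{..<Q}" "\<eta> * L" "\<lambda>q. real (\<Sum>v\<in>D q. \<beta> v)"] by force
      also have "\<dots> = real (\<Sum>q<Q. \<Sum>v\<in>D q. \<beta> v)" by simp
      also have "(\<Sum>q<Q. \<Sum>v\<in>D q. \<beta> v) = (\<Sum>v\<in>(\<Union>q<Q. D q). \<beta> v)"
        using exceptional(2) disj' by (intro sum.UNION_disjoint[symmetric]) (auto simp: D_def)
      also have "\<dots> \<le> (\<Sum>v\<in>?M. \<beta> v)"
      proof (intro sum_mono2)
        have "D q \<subseteq> ?M" if "q < Q" for q using Csub[of "Suc q" Q] Csub[of 0 q] that by (auto simp: D_def)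
        then show "(\<Union>q<Q. D q) \<subseteq> ?M" by blast
      qed (use exceptional(2) in auto)
      also have "\<dots> \<le> \<kappa> * m1 * L" by (rule mass)
      finally have "Q * \<eta> * L \<le> real (\<kappa> * m1) * L" by (simp add: mult.assoc)
      then have "Q * \<eta> \<le> real (\<kappa> * m1)" using L by (simp add: mult_le_cancel_right)
      with Q show False by simp
    qed
    then obtain q where q: "q < Q" "real (\<Sum>v\<in>D q. \<beta> v) \<le> \<eta> * L" by blast
    show False
    proof (rule scale_contradiction[where \<epsilon> = "e q" and \<epsilon>' = "e (Suc q)" and \<eta> = \<eta> and c = "cf (e q)" and K = "Kf (e q)"])
      show "card (exceptional (e q)) \<le> Kf (e q)" using cardC q by simp
      have "card (D q) \<le> card (exceptional (e Q))"
        using exceptional(2) Csub[of "Suc q" Q] q by (intro card_mono) (auto simp: D_def)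
      then have "\<zeta> * card (D q) \<le> \<zeta> * Kf (e Q)" using cardC[of Q] \<zeta>p(1) by (intro mult_left_mono) auto
      then show "\<zeta> * card (exceptional (e (Suc q)) - exceptional (e q)) \<le> \<eta>" using \<zeta>p(3) by (simp add: D_def)
      show "real (\<Sum>v\<in>exceptional (e (Suc q)) - exceptional (e q). \<beta> v) \<le> \<eta> * L" using q(2) by (simp only: D_def)
      show "b \<le> cf (e q)" using b q by simp
      show "0 \<le> cf (e q)" using cf_pos[OF e_pos, of q] by simp
      have "real (4 * z) * (e (Suc q) + \<zeta>) \<le> real (4 * z) * (e (Suc q) + e (Suc q))"
        using \<zeta>p(2) e_anti[of "Suc q" Q] q by (intro mult_left_mono) auto
      also have "\<dots> = cf (e q) / 2" using z by (simp add: eS)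
      finally show "real (4 * z) * (e (Suc q) + \<zeta>) \<le> cf (e q)" using cf_pos[OF e_pos, of q] by simp
      have "Kf (e q) * \<zeta> \<le> Kf (e Q) * \<zeta>"
        using Kf_mono[OF e_pos e_anti[of q Q]] q \<zeta>p(1) by (intro mult_right_mono) auto
      then have "Kf (e q) * \<zeta> \<le> 1 / 16" using \<zeta>p(3) \<eta>(2) by (simp add: mult.commute)
      moreover have "(real (Kf (e q)) + 1) * (2 * real \<kappa> * 2 ^ Kf (e q) * cf (e q)) = e q / 8"
        unfolding cf_eq[symmetric] by (simp only: mult_ac)
      ultimately show "2 * \<eta> * (real m1 + 1) + (real (Kf (e q)) + 1) * (2 * real \<kappa> * 2 ^ Kf (e q) * cf (e q)) + real (Kf (e q)) * \<zeta> < 1"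
        using \<eta>(3) e1[of q] by (simp add: add.commute)
    qed
  qed
  then show ?thesis using e_pos \<zeta>p(1) unfolding b_def by blast
qed

section \<open>From stability to the theorem\<close>

lemma has_parts_mono:
  assumes "has_parts E ms W" "W \<subseteq> V" "list_all2 (\<le>) ms' ms"
  shows "has_parts E ms' V"
proof -
  from assms(1) obtain Us where Us: "map card Us = ms" "\<forall>U \<in> set Us. finite U \<and> U \<subseteq> W"
    "nonadj_parts E Us"
    unfolding has_parts_def by blast
  have len: "length Us = length ms" "length ms' = length ms"
    using Us(1) assms(3) by (auto dest: list_all2_lengthD)
  have "\<exists>U. U \<subseteq> Us ! i \<and> card U = ms' ! i" if "i < length ms" for i
  proof (rule ex_subset_card)
    have "card (Us ! i) = ms ! i" using nth_map[of i Us card] Us(1) that len by simp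
    then show "ms' ! i \<le> card (Us ! i)" using list_all2_nthD[OF assms(3), of i] that len by simp
  qed
  then obtain u where u: "\<And>i. i < length ms \<Longrightarrow> u i \<subseteq> Us ! i \<and> card (u i) = ms' ! i" by metis
  let ?Us = "map u [0..<length ms]"
  have "map card ?Us = ms'" using u len by (intro nth_equalityI) auto
  moreover have "finite U \<and> U \<subseteq> V" if "U \<in> set ?Us" for U
  proof -
    from that obtain i where i: "i < length ms" "U = u i" by auto
    then have "Us ! i \<in> set Us" using len by simp
    then show ?thesis using u[OF i(1)] i(2) Us(2) assms(2) finite_subset by blast
  qed
  moreover have "nonadj_parts E ?Us"
    unfolding sorted_wrt_iff_nth_less
  proof (intro allI impI ballI)
    fix i j x y assume ij: "i < j" "j < length ?Us" "x \<in> ?Us ! i" "y \<in> ?Us ! j"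
    then have "i < length ms" "j < length ms" by auto
    moreover have "x \<in> u i" "y \<in> u j" using ij by auto
    ultimately have "x \<in> Us ! i" "y \<in> Us ! j" using u by blast+
    then show "nonadj E x y" using Us(3) ij len by (auto simp: sorted_wrt_iff_nth_less)
  qed
  ultimately show ?thesis unfolding has_parts_def by blast
qed

text \<open>Parts of size \<open>M\<close> are chosen in the sets \<open>Bs j\<close> one after the
  other. The red neighbours of the given parts exclude at most a quarter of \<open>Bs j\<close>,
  those of the parts chosen before at most another quarter, and half of \<open>Bs j\<close> suffices
  for the vertices already used and the \<open>M\<close> new ones.\<close>

lemma attach_parts:
  fixes A Bs :: "nat \<Rightarrow> 'v set"
  assumes sym: "\<And>x y. E x y \<Longrightarrow> E y x" and finV: "finite V"
    and Us0: "nonadj_parts E Us0" "\<forall>U \<in> set Us0. U \<subseteq> V"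
    and z: "card (\<Union> (set Us0)) \<le> z" "1 \<le> z"
    and js: "distinct js" "length js \<le> K"
    and A: "\<And>j. j \<in> set js \<Longrightarrow> A j \<subseteq> V \<and> Bs j \<subseteq> A j"
      "\<And>i j a. \<lbrakk>i \<in> set js; j \<in> set js; i \<noteq> j; a \<in> A i\<rbrakk> \<Longrightarrow> card {y \<in> A j. E a y} \<le> D"
    and few: "\<And>v j. \<lbrakk>v \<in> \<Union> (set Us0); j \<in> set js\<rbrakk> \<Longrightarrow> 4 * z * card {y \<in> Bs j. E v y} \<le> card (Bs j)"
    and size: "\<And>j. j \<in> set js \<Longrightarrow> 4 * (K * M * D) \<le> card (Bs j)"
      "\<And>j. j \<in> set js \<Longrightarrow> 2 * (M + z + K * M) \<le> card (Bs j)"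
  shows "has_parts E (map card Us0 @ replicate (length js) M) V"
proof -
  let ?Z = "\<Union> (set Us0)"
  have finA: "finite (A j)" "finite (Bs j)" if "j \<in> set js" for j
  proof -
    show "finite (A j)" using A(1)[OF that] finV by (auto intro: finite_subset)
    then show "finite (Bs j)" using A(1)[OF that] by (auto intro: finite_subset)
  qed
  have finZ: "finite ?Z" "?Z \<subseteq> V" 
  proof -
    show "?Z \<subseteq> V" using Us0(2) by blast
    then show "finite ?Z" using finV by (rule finite_subset)
  qed
  have arith: "M + c + S \<le> B"
    if "S = S1 + S2" "c \<le> z + Q" "4 * S2 \<le> B" "4 * S1 \<le> B" "2 * (M + z + Q) \<le> B" for S S1 S2 c Q B :: nat
    using that by presburger
  have "\<exists>Ws. map card Ws = replicate (length is) M \<and> (\<forall>W \<in> set Ws. finite W \<and> W \<subseteq> (\<Union>i\<in>set is. A i)) \<and>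
      nonadj_parts E (Us0 @ Ws)"
    if "distinct is" "set is \<subseteq> set js" "length is \<le> K" for "is"
    using that
  proof (induction "is")
    case Nil
    then show ?case using Us0(1) by (intro exI[of _ "[]"]) simp
  next
    case (Cons j "is")
    then obtain Ws where Ws: "map card Ws = replicate (length is) M"
      "\<forall>W \<in> set Ws. finite W \<and> W \<subseteq> (\<Union>i\<in>set is. A i)"
      "nonadj_parts E (Us0 @ Ws)"
      by auto
    have j: "j \<in> set js" "j \<notin> set is" using Cons.prems by auto
    let ?R = "\<Union> (set Ws)"
    have finR: "finite ?R" using Ws(2) by auto
    have "card ?R \<le> length is * M" using card_Union_set_le[of Ws] by (simp add: Ws(1) sum_list_replicate)
    also have "\<dots> \<le> K * M" using Cons.prems(3) by (intro mult_right_mono) auto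
    finally have cR: "card ?R \<le> K * M" .
    have RD: "card {y \<in> Bs j. E v y} \<le> D" if v: "v \<in> ?R" for v
    proof -
      obtain i where i: "i \<in> set is" "v \<in> A i" using v Ws(2) by blast
      have "card {y \<in> Bs j. E v y} \<le> card {y \<in> A j. E v y}"
        using A(1)[OF j(1)] finA[OF j(1)] by (intro card_mono) auto
      also have "\<dots> \<le> D" using i j Cons.prems by (intro A(2)) auto
      finally show ?thesis .
    qed
    have "4 * (\<Sum>v\<in>?R - ?Z. card {y \<in> Bs j. E v y}) \<le> 4 * (card (?R - ?Z) * D)"
      using RD sum_bounded_above[of "?R - ?Z" "\<lambda>v. card {y \<in> Bs j. E v y}" D] by simp
    also have "\<dots> \<le> 4 * (K * M * D)"
    proof -
      have "card (?R - ?Z) \<le> K * M" using card_mono[OF finR, of "?R - ?Z"] cR by auto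
      then show ?thesis by simp
    qed
    also have "\<dots> \<le> card (Bs j)" by (rule size(1)[OF j(1)])
    finally have 1: "4 * (\<Sum>v\<in>?R - ?Z. card {y \<in> Bs j. E v y}) \<le> card (Bs j)" .
    have "z * (4 * (\<Sum>v\<in>?Z. card {y \<in> Bs j. E v y})) = (\<Sum>v\<in>?Z. 4 * z * card {y \<in> Bs j. E v y})"
      by (simp add: sum_distrib_left mult_ac)
    also have "\<dots> \<le> card ?Z * card (Bs j)"
      using few[OF _ j(1)] sum_bounded_above[of ?Z "\<lambda>v. 4 * z * card {y \<in> Bs j. E v y}" "card (Bs j)"] by simp
    also have "\<dots> \<le> z * card (Bs j)" using z(1) by (rule mult_right_mono) simp
    finally have 2: "4 * (\<Sum>v\<in>?Z. card {y \<in> Bs j. E v y}) \<le> card (Bs j)" using z(2) by simp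
    have "(\<Sum>v\<in>?Z \<union> ?R. card {y \<in> Bs j. E v y}) = (\<Sum>v\<in>?Z. card {y \<in> Bs j. E v y}) + (\<Sum>v\<in>?R - ?Z. card {y \<in> Bs j. E v y})"
      using finZ finR sum.union_disjoint[of ?Z "?R - ?Z" "\<lambda>v. card {y \<in> Bs j. E v y}"] by simp
    moreover have "card (?Z \<union> ?R) \<le> z + K * M" using card_Un_le[of ?Z ?R] z(1) cR by linarith
    ultimately have "M + card (?Z \<union> ?R) + (\<Sum>v\<in>?Z \<union> ?R. card {y \<in> Bs j. E v y}) \<le> card (Bs j)"
      using 1 2 size(2)[OF j(1)] by (intro arith)
    from extend_part[OF _ finA(2)[OF j(1)] this] finZ finR obtain U where U: "U \<subseteq> Bs j" "card U = M"
      "\<forall>v \<in> ?Z \<union> ?R. \<forall>u \<in> U. nonadj E v u" by blast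
    have "nonadj_parts E ((Us0 @ Ws) @ [U])"
      unfolding sorted_wrt_append[of _ "Us0 @ Ws" "[U]"] using Ws(3) U(3) by auto
    moreover have "map card (Ws @ [U]) = replicate (length (j # is)) M"
      using Ws(1) U(2) by (simp add: replicate_append_same)
    moreover have "\<forall>W \<in> set (Ws @ [U]). finite W \<and> W \<subseteq> (\<Union>i\<in>set (j # is). A i)"
      using Ws(2) U(1) A(1)[OF j(1)] finite_subset[OF U(1) finA(2)[OF j(1)]] by auto
    ultimately show ?case by (intro exI[of _ "Ws @ [U]"]) simp
  qed
  from this[OF js(1) subset_refl js(2)] obtain Ws where Ws: "map card Ws = replicate (length js) M"
    "\<forall>W \<in> set Ws. finite W \<and> W \<subseteq> (\<Union>i\<in>set js. A i)"
    "nonadj_parts E (Us0 @ Ws)" by blast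
  have "\<forall>U \<in> set (Us0 @ Ws). finite U \<and> U \<subseteq> V"
  proof
    fix U assume U: "U \<in> set (Us0 @ Ws)"
    have "(\<Union>i\<in>set js. A i) \<subseteq> V" using A(1) by blast
    then have "U \<subseteq> V" using U Us0(2) Ws(2) unfolding set_append by blast
    then show "finite U \<and> U \<subseteq> V" using finV finite_subset by blast
  qed
  then show ?thesis unfolding has_parts_def using Ws(1,3) by (intro exI[of _ "Us0 @ Ws"]) simp
qed

text \<open>The Ramsey number enters only through the hypothesis that any \<open>r\<close> vertices
  contain the tree or the blue pair of parts. If the conclusion failed, the colouring would satisfy
  the assumptions of \<open>clusters\<close>: \<open>red_bound\<close> comes from
  \<open>embeds_through_vertex\<close>, while \<open>no_small\<close> and \<open>no_large\<close>
  come from attaching parts of size \<open>M\<close> to one or two given parts.\<close>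

lemma tree_or_parts:
  fixes m :: "nat list"
  assumes k: "3 \<le> k" "length m = k" and m0: "1 \<le> m ! 0"
  shows "\<exists>n0. \<forall>n p E (V :: 'v set) r. n0 \<le> n \<and> parent_order n p \<and> (\<forall>x y. E x y \<longrightarrow> E y x) \<and> (\<forall>x. \<not> E x x) \<and>
    finite V \<and> n \<le> r \<and> (k - 1) * (r - 1) < card V \<and>
    (\<forall>W \<subseteq> V. r \<le> card W \<longrightarrow> embeds E n p W \<or> has_parts E [m ! 0, m ! 1] W) \<longrightarrow>
    embeds E n p V \<or> has_parts E m V"
proof -
  define \<kappa> where "\<kappa> = k - 1"
  define z where "z = m ! 0 + m ! 1"
  define M where "M = Max (set m)"
  have mM: "m ! i \<le> M" if "i < k" for i using that k(2) by (simp add: M_def)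
  have M1: "1 \<le> M" using mM[of 0] m0 k by simp
  have \<kappa>: "2 \<le> \<kappa>" "k = Suc \<kappa>" using k by (auto simp: \<kappa>_def)
  have z1: "1 \<le> z" using m0 by (simp add: z_def)
  obtain b \<zeta> where b\<zeta>: "0 < b" "0 < \<zeta>"
    and noc: "\<And>(V :: 'v set) red L r. \<not> clusters V red \<kappa> L r (m ! 0) z b \<zeta>"
    using no_clusters[OF \<kappa>(1) m0 z1, where 'v = 'v] by blast
  \<comment> \<open>The entries serve, in this order, \<open>14 * d \<le> n\<close> and
    \<open>\<kappa> * (3 * d) \<le> n\<close> for \<open>embeds_through_vertex\<close>, the bound
    \<open>n / 2 \<le> L\<close>, the passage from \<open>n + 5 * d\<close> to
    \<open>(1 + \<zeta>) * L\<close>, and the red degrees between different sets in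
    \<open>attach_parts\<close>.\<close>
  have "\<exists>d>0. \<forall>s \<in> {1 / 14, 1 / (3 * real \<kappa>), 1 / 2, \<zeta> / (6 + \<zeta>), b / (8 * (\<kappa> * M))}. d \<le> s"
    using b\<zeta> \<kappa>(1) M1 by (intro ex_pos_lower_bound) auto
  then obtain \<delta> where \<delta>: "0 < \<delta>" "\<delta> \<le> 1 / 14" "\<delta> \<le> 1 / (3 * real \<kappa>)" "\<delta> \<le> 1 / 2" "\<delta> \<le> \<zeta> / (6 + \<zeta>)"
    "\<delta> \<le> b / (8 * (\<kappa> * M))" by auto
  have \<delta>': "14 * \<delta> \<le> 1" "\<kappa> * (3 * \<delta>) \<le> 1" "(1 + 5 * \<delta>) \<le> (1 + \<zeta>) * (1 - \<delta>)" "8 * (\<kappa> * M * \<delta>) \<le> b"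
    using \<delta> b\<zeta> \<kappa>(1) M1 by (simp_all add: field_simps)
  have k2: "2 \<le> k" and C1: "1 \<le> real k" using k by auto
  obtain \<gamma> n1 where \<gamma>: "0 < \<gamma>" and stab: "\<forall>n p E (W :: 'v set). n1 \<le> n \<and> parent_order n p \<and> (\<forall>x y. E x y \<longrightarrow> E y x) \<and>
      finite W \<and> \<not> embeds E n p W \<and>
      (1 - \<gamma>) * (real k - 1) * n \<le> card W \<and> card W \<le> real k * real n \<and> \<not> has_parts E (replicate k M) W \<longrightarrow>
      (\<exists>A. (\<forall>i<k - 1. A i \<subseteq> W \<and> near_clique E (nat \<lfloor>\<delta> * n\<rfloor>) (A i) \<and> (1 - \<delta>) * n \<le> card (A i)) \<and>
        (\<forall>i<k - 1. \<forall>j<k - 1. i \<noteq> j \<longrightarrow> A i \<inter> A j = {} \<and> (\<forall>a \<in> A i. card {y \<in> A j. E a y} \<le> \<delta> * n)))"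
    using stability[OF k2 \<delta>(1) M1 C1, where 'v = 'v] by (elim exE conjE) (rule that)
  define n0 where "n0 = Max {n1, 1, nat \<lceil>1 / \<gamma>\<rceil>, nat \<lceil>1 / \<delta>\<rceil>, nat \<lceil>4 * (M + z + \<kappa> * M) / b\<rceil>}"
  have goal: "embeds E n p V \<or> has_parts E m V"
    if n: "n0 \<le> n" and p: "parent_order n p" and symE: "\<forall>x y. E x y \<longrightarrow> E y x" and irr: "\<forall>x. \<not> E x x"
      and V: "finite V" "n \<le> r" "(k - 1) * (r - 1) < card V"
      and rW: "\<forall>W \<subseteq> V. r \<le> card W \<longrightarrow> embeds E n p W \<or> has_parts E [m ! 0, m ! 1] W"
    for n p E and V :: "'v set" and r
  proof (rule ccontr)
    assume neg: "\<not> ?thesis"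
    then have ne: "\<not> embeds E n p V" and np: "\<not> has_parts E m V" by auto
    have sym: "E x y \<Longrightarrow> E y x" for x y using symE by blast
    have "x \<le> n" if "x \<in> {n1, 1, nat \<lceil>1 / \<gamma>\<rceil>, nat \<lceil>1 / \<delta>\<rceil>, nat \<lceil>4 * (M + z + \<kappa> * M) / b\<rceil>}" for x
    proof -
      have "x \<le> n0" unfolding n0_def by (rule Max_ge[OF _ that]) simp
      then show ?thesis using n by simp
    qed
    then have "n1 \<le> n" "1 \<le> n" "nat \<lceil>1 / \<gamma>\<rceil> \<le> n" "nat \<lceil>1 / \<delta>\<rceil> \<le> n" "nat \<lceil>4 * (M + z + \<kappa> * M) / b\<rceil> \<le> n"
      by blast+
    then have n': "n1 \<le> n" "1 \<le> n" "1 / \<gamma> \<le> n" "1 / \<delta> \<le> n" "4 * (M + z + \<kappa> * M) / b \<le> n" by linarith+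
    then have n\<gamma>: "1 \<le> \<gamma> * n" and n\<delta>: "1 \<le> \<delta> * n" and nb: "4 * (M + z + \<kappa> * M) \<le> b * n"
      using \<gamma> \<delta>(1) b\<zeta>(1) by (simp_all add: field_simps)
    have npos: "0 < real n" using n'(2) by simp
    define d where "d = nat \<lfloor>\<delta> * n\<rfloor>"
    have d: "1 \<le> d" "d \<le> \<delta> * n" using n\<delta> by (auto simp: d_def le_nat_floor)
    have d14: "14 * d \<le> n" and d3: "\<kappa> * (3 * d) \<le> n"
    proof -
      have "14 * real d \<le> 14 * \<delta> * n" using d by simp
      also have "\<dots> \<le> 1 * real n" using \<delta>'(1) by (intro mult_right_mono) auto
      finally show "14 * d \<le> n" by linarith
      have "real \<kappa> * (3 * real d) \<le> \<kappa> * (3 * (\<delta> * n))" using d by (intro mult_left_mono) auto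
      also have "\<dots> = \<kappa> * (3 * \<delta>) * n" by simp
      also have "\<dots> \<le> 1 * real n" using \<delta>'(2) by (intro mult_right_mono) auto
      finally have "real (\<kappa> * (3 * d)) \<le> real n" by simp
      then show "\<kappa> * (3 * d) \<le> n" by linarith
    qed
    \<comment> \<open>Stability is stated for at most \<open>k * n\<close> vertices, whereas
      \<open>V\<close> may be larger. It is applied to a subset \<open>W\<close>; the other vertices
      of \<open>V\<close> are compared with the resulting near-cliques only afterwards.\<close>
    have "\<kappa> * (n - 1) \<le> \<kappa> * (r - 1)" using V(2) by (intro mult_le_mono2) simp
    then have "\<kappa> * (n - 1) \<le> card V" using V(3) unfolding \<kappa>_def by linarith
    from ex_subset_card[OF this] obtain W where W: "W \<subseteq> V" "card W = \<kappa> * (n - 1)" by blast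
    have finW: "finite W" using W(1) V(1) finite_subset by blast
    have "\<exists>A. (\<forall>i<k - 1. A i \<subseteq> W \<and> near_clique E (nat \<lfloor>\<delta> * n\<rfloor>) (A i) \<and> (1 - \<delta>) * n \<le> card (A i)) \<and>
        (\<forall>i<k - 1. \<forall>j<k - 1. i \<noteq> j \<longrightarrow> A i \<inter> A j = {} \<and> (\<forall>a \<in> A i. card {y \<in> A j. E a y} \<le> \<delta> * n))"
    proof (rule stab[THEN spec, THEN spec, THEN spec, THEN spec, THEN mp], intro conjI)
      show "\<not> embeds E n p W" using ne embeds_mono W(1) by blast
      have "(1 - \<gamma>) * (real k - 1) * n = \<kappa> * (real n - \<gamma> * n)" using \<kappa>(2) by (simp add: algebra_simps)
      also have "\<dots> \<le> real \<kappa> * (real n - 1)" using n\<gamma> by (intro mult_left_mono) auto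
      also have "\<dots> = card W" using W(2) n'(2) by (simp add: of_nat_diff)
      finally show "(1 - \<gamma>) * (real k - 1) * n \<le> card W" .
      have "\<kappa> * (n - 1) \<le> k * n" using \<kappa>(2) by (intro mult_mono) auto
      then show "real (card W) \<le> real k * real n" using W(2) by (metis of_nat_le_iff of_nat_mult)
      show "\<not> has_parts E (replicate k M) W"
        using has_parts_mono[of E "replicate k M" W V m] np W(1) mM k(2) by (auto simp: list_all2_conv_all_nth)
    qed (use n' p symE finW in auto)
    then obtain A0 where A0: "\<forall>i<\<kappa>. A0 i \<subseteq> W \<and> near_clique E d (A0 i) \<and> (1 - \<delta>) * n \<le> card (A0 i)"
      "\<forall>i<\<kappa>. \<forall>j<\<kappa>. i \<noteq> j \<longrightarrow> A0 i \<inter> A0 j = {} \<and> (\<forall>a \<in> A0 i. card {y \<in> A0 j. E a y} \<le> \<delta> * n)"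
      unfolding \<kappa>_def d_def by blast
    define L where "L = nat \<lceil>(1 - \<delta>) * n\<rceil>"
    have L: "(1 - \<delta>) * n \<le> L" unfolding L_def by (rule real_nat_ceiling_ge)
    have "\<exists>A. A \<subseteq> A0 i \<and> card A = L" if "i < \<kappa>" for i
      using A0(1) that by (intro ex_subset_card) (simp add: L_def nat_le_iff ceiling_le_iff)
    then obtain A where A: "\<And>i. i < \<kappa> \<Longrightarrow> A i \<subseteq> A0 i \<and> card (A i) = L" by metis
    have AV: "A i \<subseteq> V" "near_clique E d (A i)" if "i < \<kappa>" for i
      using A[OF that] A0(1) that W(1) near_clique_subset[of E d "A0 i" "A i"] by blast+
    have finA: "finite (A i)" if "i < \<kappa>" for i using AV(1)[OF that] V(1) finite_subset by blast
    have Adisj: "A i \<inter> A j = {}" if "i < \<kappa>" "j < \<kappa>" "i \<noteq> j" for i j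
      using A0(2) A[OF that(1)] A[OF that(2)] that by blast
    have Across: "card {y \<in> A j. E a y} \<le> d" if ij: "i < \<kappa>" "j < \<kappa>" "i \<noteq> j" "a \<in> A i" for i j a
    proof -
      have "card {y \<in> A j. E a y} \<le> card {y \<in> A0 j. E a y}"
        using A[OF ij(2)] A0(1) ij(2) by (intro card_mono) (auto simp: near_clique_def)
      also have "\<dots> \<le> d" unfolding d_def using A0(2) A[OF ij(1)] ij by (intro le_nat_floor) blast
      finally show ?thesis .
    qed
    have An: "n \<le> card (A i) + d" if "i < \<kappa>" for i
      unfolding d_def using A[OF that] L \<delta>(1) by (intro near_clique_size) auto
    have "\<exists>h. bij_betw h {..<L} (A i)" if "i < \<kappa>" for i
      using finite_same_card_bij[of "{..<L}" "A i"] A[OF that] finA[OF that] by simp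
    then obtain a where a: "\<And>i. i < \<kappa> \<Longrightarrow> bij_betw (a i) {..<L} (A i)" by metis
    have card_im: "card {y \<in> a i ` B. E v y} = card {t \<in> B. E v (a i t)}" "card (a i ` B) = card B" "a i ` B \<subseteq> A i"
      if "i < \<kappa>" "B \<subseteq> {..<L}" for i B v
    proof -
      have inj: "inj_on (a i) B" using a[OF that(1)] that(2) inj_on_subset by (auto simp: bij_betw_def)
      have "{y \<in> a i ` B. E v y} = a i ` {t \<in> B. E v (a i t)}" by auto
      then show "card {y \<in> a i ` B. E v y} = card {t \<in> B. E v (a i t)}"
        using inj_on_subset[OF inj, of "{t \<in> B. E v (a i t)}"] by (simp add: card_image)
      show "card (a i ` B) = card B" using inj by (rule card_image)
      show "a i ` B \<subseteq> A i" using a[OF that(1)] that(2) by (auto simp: bij_betw_def)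
    qed
    have Lhalf: "n / 2 \<le> L"
    proof -
      have "1 / 2 * real n \<le> (1 - \<delta>) * n" using \<delta>(4) by (intro mult_right_mono) auto
      then show ?thesis using L by simp
    qed
    have sizes: "4 * (\<kappa> * M * d) \<le> card B \<and> 2 * (M + z + \<kappa> * M) \<le> card B" if "b * L \<le> card B" for B :: "nat set"
    proof -
      have bL: "b * (n / 2) \<le> card B" using that mult_left_mono[OF Lhalf less_imp_le[OF b\<zeta>(1)]] by linarith
      have "4 * (real \<kappa> * M * d) \<le> 4 * (real \<kappa> * M * (\<delta> * n))" using d by (intro mult_left_mono) auto
      also have "\<dots> = 8 * (\<kappa> * M * \<delta>) * (n / 2)" by simp
      also have "\<dots> \<le> b * (n / 2)" using \<delta>'(4) by (intro mult_right_mono) auto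
      finally have "real (4 * (\<kappa> * M * d)) \<le> real (card B)" using bL by simp
      then have 1: "4 * (\<kappa> * M * d) \<le> card B" by linarith
      have "real (2 * (M + z + \<kappa> * M)) \<le> real (card B)" using nb bL by simp
      then have "2 * (M + z + \<kappa> * M) \<le> card B" by linarith
      with 1 show ?thesis ..
    qed
    have attach: "has_parts E (map card Us0 @ replicate (length js) M) V"
      if Us0: "nonadj_parts E Us0" "\<forall>U \<in> set Us0. U \<subseteq> V" "sum_list (map card Us0) \<le> z"
        and js: "distinct js" "set js \<subseteq> {..<\<kappa>}"
        and Bs: "\<And>j. j \<in> set js \<Longrightarrow> Bs j \<subseteq> {..<L} \<and> b * L \<le> card (Bs j)"
          "\<And>v j. v \<in> \<Union> (set Us0) \<Longrightarrow> j \<in> set js \<Longrightarrow> 4 * z * card {t \<in> Bs j. E v (a j t)} \<le> card (Bs j)"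
      for Us0 js Bs
    proof (rule attach_parts[OF sym V(1) Us0(1,2) _ z1 js(1), where A = A and Bs = "\<lambda>j. a j ` Bs j" and K = \<kappa> and D = d])
      show "card (\<Union> (set Us0)) \<le> z" using card_Union_set_le[of Us0] Us0(3) by simp
      show "length js \<le> \<kappa>" using js card_mono[OF _ js(2)] distinct_card[OF js(1)] by simp
      fix j assume j: "j \<in> set js"
      then have j\<kappa>: "j < \<kappa>" using js(2) by auto
      show "A j \<subseteq> V \<and> a j ` Bs j \<subseteq> A j" using AV(1)[OF j\<kappa>] card_im(3)[OF j\<kappa>] Bs(1)[OF j] by blast
      have "card (a j ` Bs j) = card (Bs j)" using card_im(2)[OF j\<kappa>] Bs(1)[OF j] by blast
      then show "4 * (\<kappa> * M * d) \<le> card (a j ` Bs j)" "2 * (M + z + \<kappa> * M) \<le> card (a j ` Bs j)"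
        using sizes[of "Bs j"] Bs(1)[OF j] by simp_all
      fix v assume "v \<in> \<Union> (set Us0)"
      then show "4 * z * card {y \<in> a j ` Bs j. E v y} \<le> card (a j ` Bs j)"
        using Bs(2)[OF _ j] card_im(1,2)[OF j\<kappa>] Bs(1)[OF j] by simp
    next
      fix i j x assume "i \<in> set js" "j \<in> set js" "i \<noteq> j" "x \<in> A i"
      then show "card {y \<in> A j. E x y} \<le> d" using Across js(2) by blast
    qed
    have "clusters V (\<lambda>v i t. E v (a i t)) \<kappa> L r (m ! 0) z b \<zeta>"
    proof
      show "finite V" "2 \<le> \<kappa>" "1 \<le> m ! 0" "0 \<le> \<zeta>" "1 \<le> r" using V \<kappa> m0 b\<zeta> n' by auto
      show "1 \<le> L" using Lhalf n'(2) by (cases L) auto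
      show "\<kappa> * (r - 1) < card V" using V(3) by (simp add: \<kappa>_def)
    next
      fix v assume v: "v \<in> V"
      have "\<not> n + 5 * d \<le> (\<Sum>i<\<kappa>. card {y \<in> A i. E v y})"
      proof
        assume "n + 5 * d \<le> (\<Sum>i<\<kappa>. card {y \<in> A i. E v y})"
        then have "embeds E n p (insert v (\<Union>i<\<kappa>. A i))"
          using irr AV(2) An Adisj d(1) d14 d3 by (intro embeds_through_vertex[OF p sym, where d = d]) auto
        moreover have "insert v (\<Union>i<\<kappa>. A i) \<subseteq> V" using v AV(1) by blast
        ultimately show False using ne embeds_mono by blast
      qed
      moreover have "(\<Sum>i<\<kappa>. card {y \<in> A i. E v y}) = (\<Sum>i<\<kappa>. card {t \<in> {..<L}. E v (a i t)})"
      proof (intro sum.cong refl)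
        fix i assume "i \<in> {..<\<kappa>}"
        then have i: "i < \<kappa>" by simp
        have "a i ` {..<L} = A i" using a[OF i] by (simp add: bij_betw_def)
        then show "card {y \<in> A i. E v y} = card {t \<in> {..<L}. E v (a i t)}"
          using card_im(1)[OF i subset_refl, of v] by simp
      qed
      ultimately have "(\<Sum>i<\<kappa>. card {t \<in> {..<L}. E v (a i t)}) \<le> n + 5 * d" by linarith
      then have "real (\<Sum>i<\<kappa>. card {t \<in> {..<L}. E v (a i t)}) \<le> real (n + 5 * d)" by (rule of_nat_mono)
      also have "\<dots> \<le> (1 + 5 * \<delta>) * n" using d(2) by (simp add: algebra_simps)
      also have "\<dots> \<le> (1 + \<zeta>) * (1 - \<delta>) * n" using \<delta>'(3) by (intro mult_right_mono) auto
      also have "\<dots> = (1 + \<zeta>) * ((1 - \<delta>) * n)" by simp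
      also have "\<dots> \<le> (1 + \<zeta>) * L" using L b\<zeta>(2) by (intro mult_left_mono) auto
      finally show "real (\<Sum>i<\<kappa>. card {t \<in> {..<L}. E v (a i t)}) \<le> (1 + \<zeta>) * L" .
    next
      fix Z Bs assume Z: "Z \<subseteq> V" "card Z = m ! 0"
        and Bs: "\<And>i. i < \<kappa> \<Longrightarrow> Bs i \<subseteq> {..<L} \<and> b * L \<le> card (Bs i)"
          "\<And>v i. v \<in> Z \<Longrightarrow> i < \<kappa> \<Longrightarrow> 4 * z * card {t \<in> Bs i. E v (a i t)} \<le> card (Bs i)"
      have "has_parts E (map card [Z] @ replicate (length [0..<\<kappa>]) M) V"
        using Z Bs by (intro attach[where Bs = Bs]) (auto simp: z_def)
      then have "has_parts E (m ! 0 # replicate \<kappa> M) V" using Z(2) by simp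
      moreover have "list_all2 (\<le>) m (m ! 0 # replicate \<kappa> M)"
      proof (rule list_all2_all_nthI)
        show "m ! i \<le> (m ! 0 # replicate \<kappa> M) ! i" if "i < length m" for i
          using mM[of i] k(2) \<kappa>(2) that by (cases i) simp_all
      qed (use k(2) \<kappa>(2) in simp)
      ultimately show False using has_parts_mono np by blast
    next
      fix i W Bs assume i: "i < \<kappa>" and W: "W \<subseteq> V" "r \<le> card W"
        and Bs: "\<And>j. j < \<kappa> \<Longrightarrow> j \<noteq> i \<Longrightarrow> Bs j \<subseteq> {..<L} \<and> b * L \<le> card (Bs j)"
          "\<And>v j. v \<in> W \<Longrightarrow> j < \<kappa> \<Longrightarrow> j \<noteq> i \<Longrightarrow> 4 * z * card {t \<in> Bs j. E v (a j t)} \<le> card (Bs j)"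
      have "\<not> embeds E n p W" using ne embeds_mono W(1) by blast
      then have "has_parts E [m ! 0, m ! 1] W" using rW W by blast
      then obtain Us where Us: "map card Us = [m ! 0, m ! 1]" "\<forall>U \<in> set Us. finite U \<and> U \<subseteq> W"
        "nonadj_parts E Us"
        unfolding has_parts_def by (elim exE conjE) (rule that)
      let ?js = "filter (\<lambda>j. j \<noteq> i) [0..<\<kappa>]"
      have "length ?js = card (set ?js)" by (simp only: distinct_card distinct_filter distinct_upt)
      also have "set ?js = {..<\<kappa>} - {i}" by auto
      also have "card \<dots> = \<kappa> - 1" using i by simp
      finally have lenjs: "length ?js = \<kappa> - 1" .
      have "has_parts E (map card Us @ replicate (length ?js) M) V"
      proof (rule attach[where Bs = Bs])
        show "\<forall>U \<in> set Us. U \<subseteq> V" using Us(2) W(1) by blast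
        show "sum_list (map card Us) \<le> z" by (simp add: Us(1) z_def)
        fix v j assume "v \<in> \<Union> (set Us)" "j \<in> set ?js"
        then show "4 * z * card {t \<in> Bs j. E v (a j t)} \<le> card (Bs j)" using Us(2) by (intro Bs(2)) auto
      qed (use Us(3) Bs in auto)
      then have "has_parts E (m ! 0 # m ! 1 # replicate (\<kappa> - 1) M) V" using Us(1) lenjs by simp
      moreover have "list_all2 (\<le>) m (m ! 0 # m ! 1 # replicate (\<kappa> - 1) M)"
      proof (rule list_all2_all_nthI)
        show "m ! i \<le> (m ! 0 # m ! 1 # replicate (\<kappa> - 1) M) ! i" if "i < length m" for i
        proof -
          consider "i = 0" | "i = 1" | j where "i = Suc (Suc j)" by (cases i; cases "i - 1") auto
          then show ?thesis
          proof cases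
            case (3 j)
            then show ?thesis using mM[of i] k(2) \<kappa>(2) that by simp
          qed simp_all
        qed
      qed (use k(2) \<kappa> in simp)
      ultimately show False using has_parts_mono np by blast
    qed
    then show False using noc by blast
  qed
  show ?thesis
    by (rule exI[of _ n0], intro allI impI, elim conjE, rule goal)
qed

section \<open>Translation to colourings and Ramsey numbers\<close>

definition red_adj :: "(nat set \<Rightarrow> colour) \<Rightarrow> nat \<Rightarrow> nat \<Rightarrow> bool" where
  "red_adj c x y \<longleftrightarrow> x \<noteq> y \<and> c {x, y} = Red"

lemma red_adj_sym: "red_adj c x y \<Longrightarrow> red_adj c y x"
  by (auto simp: red_adj_def insert_commute)

lemma red_adj_irrefl: "\<not> red_adj c x x"
  by (simp add: red_adj_def)

lemma colour_class_edges:
  "{x, y} \<in> edges (colour_class (complete_graph N) c q) \<longleftrightarrow> x < N \<and> y < N \<and> x \<noteq> y \<and> c {x, y} = q"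
  by (auto simp: colour_class_def complete_graph_def)

lemma vertices_colour_class [simp]: "vertices (colour_class (complete_graph N) c q) = {..<N}"
  by (simp add: colour_class_def complete_graph_def)

locale ordered_tree =
  fixes T :: "'a sgraph" and n :: nat and \<phi> :: "nat \<Rightarrow> 'a" and p :: "nat \<Rightarrow> nat"
  assumes order: "parent_order n p" and bij: "bij_betw \<phi> {..<n} (vertices T)"
    and parent_edge: "\<And>i. 0 < i \<Longrightarrow> i < n \<Longrightarrow> {\<phi> (p i), \<phi> i} \<in> edges T"
    and edge_parent: "\<And>e. e \<in> edges T \<Longrightarrow> \<exists>i. 0 < i \<and> i < n \<and> e = {\<phi> (p i), \<phi> i}"
begin

lemma contains_copy_if_embeds:
  assumes "embeds (red_adj c) n p {..<N}"
  shows "contains_copy (colour_class (complete_graph N) c Red) T"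
proof -
  from assms obtain f where f: "inj_on f {..<n}" "f ` {..<n} \<subseteq> {..<N}"
    "\<And>i. 0 < i \<Longrightarrow> i < n \<Longrightarrow> red_adj c (f (p i)) (f i)"
    unfolding embeds_def by blast
  let ?\<psi> = "inv_into {..<n} \<phi>"
  have \<psi>: "bij_betw ?\<psi> (vertices T) {..<n}" using bij by (rule bij_betw_inv_into)
  have \<psi>\<phi>: "?\<psi> (\<phi> i) = i" if "i < n" for i using bij that by (simp add: bij_betw_def inv_into_f_f)
  let ?g = "\<lambda>x. f (?\<psi> x)"
  have "inj_on ?g (vertices T)" using comp_inj_on[of ?\<psi> "vertices T" f] \<psi> f(1) by (simp add: bij_betw_def comp_def)
  moreover have "?g ` vertices T \<subseteq> {..<N}" using \<psi> f(2) by (auto simp: bij_betw_def)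
  moreover have "?g ` e \<in> edges (colour_class (complete_graph N) c Red)" if e: "e \<in> edges T" for e
  proof -
    obtain i where i: "0 < i" "i < n" "e = {\<phi> (p i), \<phi> i}" using edge_parent[OF e] by blast
    have pi: "p i < n" using parent_less[OF order i(1,2)] .
    have "?g ` e = {f (p i), f i}" using i \<psi>\<phi> pi by simp
    moreover have "f (p i) < N" "f i < N" using f(2) pi i(2) by auto
    ultimately show ?thesis using f(3)[OF i(1,2)] colour_class_edges by (simp add: red_adj_def)
  qed
  ultimately show ?thesis unfolding contains_copy_def by (intro exI[of _ ?g]) simp
qed

lemma embeds_if_contains_copy:
  assumes "contains_copy (colour_class (complete_graph N) c Red) T"
  shows "embeds (red_adj c) n p {..<N}"
proof -
  from assms obtain f where f: "inj_on f (vertices T)" "f ` vertices T \<subseteq> {..<N}"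
    "\<And>e. e \<in> edges T \<Longrightarrow> f ` e \<in> edges (colour_class (complete_graph N) c Red)"
    unfolding contains_copy_def by auto
  have "inj_on (f \<circ> \<phi>) {..<n}" using bij f(1) by (intro comp_inj_on) (auto simp: bij_betw_def)
  moreover have "(f \<circ> \<phi>) ` {..<n} \<subseteq> {..<N}" using bij f(2) by (auto simp: bij_betw_def)
  moreover have "red_adj c ((f \<circ> \<phi>) (p i)) ((f \<circ> \<phi>) i)" if "0 < i" "i < n" for i
    using f(3)[OF parent_edge[OF that]] colour_class_edges by (simp add: red_adj_def)
  ultimately show ?thesis unfolding embeds_def by blast
qed

end

lemma vertices_multipartite: "vertices (complete_multipartite ms) = {(i, j). i < length ms \<and> j < ms ! i}"
  by (simp add: complete_multipartite_def Let_def)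

lemma edges_multipartiteI:
  assumes "u \<in> vertices (complete_multipartite ms)" "v \<in> vertices (complete_multipartite ms)" "fst u \<noteq> fst v"
  shows "{u, v} \<in> edges (complete_multipartite ms)"
proof -
  have "edges (complete_multipartite ms) = {{u, v} | u v. u \<in> vertices (complete_multipartite ms) \<and>
      v \<in> vertices (complete_multipartite ms) \<and> fst u \<noteq> fst v}"
    by (simp add: complete_multipartite_def Let_def)
  then show ?thesis using assms by blast
qed

lemma has_parts_if_contains_copy:
  assumes "contains_copy (colour_class (complete_graph N) c Blue) (complete_multipartite ms)"
  shows "has_parts (red_adj c) ms {..<N}"
proof -
  let ?V = "vertices (complete_multipartite ms)"
  from assms obtain f where f: "inj_on f ?V" "f ` ?V \<subseteq> {..<N}"
    "\<And>e. e \<in> edges (complete_multipartite ms) \<Longrightarrow> f ` e \<in> edges (colour_class (complete_graph N) c Blue)"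
    unfolding contains_copy_def by auto
  define U where "U i = (\<lambda>j. f (i, j)) ` {..<ms ! i}" for i
  have "card (U i) = ms ! i" if "i < length ms" for i
  proof -
    have "inj_on (\<lambda>j. f (i, j)) {..<ms ! i}"
      using f(1) that by (auto simp: inj_on_def vertices_multipartite)
    then show ?thesis by (simp add: U_def card_image)
  qed
  then have "map card (map U [0..<length ms]) = ms" by (intro nth_equalityI) auto
  moreover have "\<forall>X \<in> set (map U [0..<length ms]). finite X \<and> X \<subseteq> {..<N}"
    using f(2) by (fastforce simp: U_def vertices_multipartite)
  moreover have "nonadj_parts (red_adj c) (map U [0..<length ms])"
    unfolding sorted_wrt_iff_nth_less
  proof (intro allI impI ballI)
    fix i i' x y
    assume i: "i < i'" "i' < length (map U [0..<length ms])" "x \<in> map U [0..<length ms] ! i" "y \<in> map U [0..<length ms] ! i'"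
    then obtain j j' where j: "x = f (i, j)" "j < ms ! i" "y = f (i', j')" "j' < ms ! i'" by (auto simp: U_def)
    have "{(i, j), (i', j')} \<in> edges (complete_multipartite ms)"
      using i j by (intro edges_multipartiteI) (simp_all add: vertices_multipartite)
    from f(3)[OF this] have "{x, y} \<in> edges (colour_class (complete_graph N) c Blue)" using j by simp
    then show "nonadj (red_adj c) x y" unfolding colour_class_edges by (simp add: red_adj_def)
  qed
  ultimately show ?thesis unfolding has_parts_def by blast
qed

lemma contains_copy_if_has_parts:
  assumes "has_parts (red_adj c) ms {..<N}"
  shows "contains_copy (colour_class (complete_graph N) c Blue) (complete_multipartite ms)"
proof -
  let ?V = "vertices (complete_multipartite ms)"
  from assms obtain Us where Us: "map card Us = ms" "\<forall>U \<in> set Us. finite U \<and> U \<subseteq> {..<N}"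
    "nonadj_parts (red_adj c) Us"
    unfolding has_parts_def by blast
  have len: "length Us = length ms" using Us(1) by auto
  have Ui: "finite (Us ! i)" "Us ! i \<subseteq> {..<N}" "card (Us ! i) = ms ! i" if "i < length ms" for i
    using Us(2) nth_mem[of i Us] nth_map[of i Us card] Us(1) that len by auto
  have "\<exists>h. bij_betw h {..<ms ! i} (Us ! i)" if "i < length ms" for i
    using finite_same_card_bij[of "{..<ms ! i}" "Us ! i"] Ui[OF that] by simp
  then obtain h where h: "\<And>i. i < length ms \<Longrightarrow> bij_betw (h i) {..<ms ! i} (Us ! i)" by metis
  let ?f = "\<lambda>(i, j). h i j"
  have mem: "h i j \<in> Us ! i" if "i < length ms" "j < ms ! i" for i j
    using h[OF that(1)] that(2) by (auto simp: bij_betw_def)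
  have nonadj: "nonadj (red_adj c) (h i j) (h i' j')"
    if "i < length ms" "j < ms ! i" "i' < length ms" "j' < ms ! i'" "i \<noteq> i'" for i j i' j'
  proof (cases "i < i'")
    case True
    then show ?thesis using Us(3) mem that len unfolding sorted_wrt_iff_nth_less by simp
  next
    case False
    then have "i' < i" using that(5) by simp
    then have "nonadj (red_adj c) (h i' j') (h i j)"
      using Us(3) mem that len unfolding sorted_wrt_iff_nth_less by simp
    then show ?thesis by (auto dest: red_adj_sym)
  qed
  have "inj_on ?f ?V"
  proof (rule inj_onI)
    fix u v assume uv: "u \<in> ?V" "v \<in> ?V" "?f u = ?f v"
    obtain i j i' j' where e: "u = (i, j)" "v = (i', j')" by (cases u, cases v)
    then have b: "i < length ms" "j < ms ! i" "i' < length ms" "j' < ms ! i'" and eq: "h i j = h i' j'"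
      using uv by (auto simp: vertices_multipartite)
    then have "i = i'" using nonadj by blast
    moreover from this have "j = j'" using b eq h[OF b(1)] by (auto simp: bij_betw_def inj_on_def)
    ultimately show "u = v" using e by simp
  qed
  moreover have "?f ` ?V \<subseteq> {..<N}" using mem Ui(2) by (fastforce simp: vertices_multipartite)
  moreover have "?f ` e \<in> edges (colour_class (complete_graph N) c Blue)"
    if e: "e \<in> edges (complete_multipartite ms)" for e
  proof -
    have "\<exists>u v. e = {u, v} \<and> u \<in> ?V \<and> v \<in> ?V \<and> fst u \<noteq> fst v"
      using e by (auto simp: complete_multipartite_def Let_def)
    then obtain i j i' j' where uv: "e = {(i, j), (i', j')}" "i < length ms" "j < ms ! i" "i' < length ms" "j' < ms ! i'" "i \<noteq> i'"
      by (auto simp: vertices_multipartite)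
    have "h i j < N" "h i' j' < N" using mem uv Ui(2) by blast+
    moreover have "c {h i j, h i' j'} = Blue" "h i j \<noteq> h i' j'"
      using nonadj[OF uv(2-6)] by (auto simp: red_adj_def intro: colour.exhaust[of "c {h i j, h i' j'}"])
    ultimately show ?thesis using uv(1) by (simp add: colour_class_edges)
  qed
  ultimately show ?thesis unfolding contains_copy_def by (intro exI[of _ ?f]) simp
qed

lemma embeds_image:
  assumes "embeds E' n p U" "inj_on g U" "\<And>x y. x \<in> U \<Longrightarrow> y \<in> U \<Longrightarrow> E' x y \<Longrightarrow> E (g x) (g y)" "parent_order n p"
  shows "embeds E n p (g ` U)"
proof -
  from assms(1) obtain f where f: "inj_on f {..<n}" "f ` {..<n} \<subseteq> U" "\<And>i. 0 < i \<Longrightarrow> i < n \<Longrightarrow> E' (f (p i)) (f i)"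
    unfolding embeds_def by blast
  have fU: "f i \<in> U" if "i < n" for i using f(2) that by auto
  have "inj_on (g \<circ> f) {..<n}" using f assms(2) by (intro comp_inj_on) (auto intro: inj_on_subset)
  moreover have "(g \<circ> f) ` {..<n} \<subseteq> g ` U" using f(2) by auto
  moreover have "E ((g \<circ> f) (p i)) ((g \<circ> f) i)" if "0 < i" "i < n" for i
    using assms(3)[OF fU fU] f(3)[OF that] that parent_less[OF assms(4) that] by simp
  ultimately show ?thesis unfolding embeds_def by blast
qed

lemma has_parts_image:
  assumes "has_parts E' ms U" "inj_on g U" "\<And>x y. x \<in> U \<Longrightarrow> y \<in> U \<Longrightarrow> E (g x) (g y) \<Longrightarrow> E' x y"
  shows "has_parts E ms (g ` U)"
proof -
  from assms(1) obtain Us where Us: "map card Us = ms" "\<forall>X \<in> set Us. finite X \<and> X \<subseteq> U"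
    "nonadj_parts E' Us"
    unfolding has_parts_def by blast
  have "map card (map ((`) g) Us) = ms"
  proof -
    have "card (g ` X) = card X" if "X \<in> set Us" for X
      using that Us(2) assms(2) by (intro card_image) (blast intro: inj_on_subset)
    then show ?thesis using Us(1) by (simp cong: map_cong)
  qed
  moreover have "\<forall>X \<in> set (map ((`) g) Us). finite X \<and> X \<subseteq> g ` U" using Us(2) by auto
  moreover have "nonadj_parts E (map ((`) g) Us)"
    unfolding sorted_wrt_map
  proof (rule sorted_wrt_mono_rel[OF _ Us(3)])
    fix X Y assume X: "X \<in> set Us" "Y \<in> set Us" "\<forall>x \<in> X. \<forall>y \<in> Y. nonadj E' x y"
    show "\<forall>x \<in> g ` X. \<forall>y \<in> g ` Y. nonadj E x y"
    proof (intro ballI)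
      fix x y assume "x \<in> g ` X" "y \<in> g ` Y"
      then obtain x' y' where xy: "x = g x'" "x' \<in> X" "y = g y'" "y' \<in> Y" by blast
      then have U: "x' \<in> U" "y' \<in> U" and n: "nonadj E' x' y'" using X Us(2) by blast+
      then show "nonadj E x y" using assms(3)[OF U] inj_onD[OF assms(2) _ U] xy by blast
    qed
  qed
  ultimately show ?thesis unfolding has_parts_def by blast
qed

text \<open>The colouring on \<open>W\<close> is pulled back along an injection of
  \<open>{..<r}\<close> into \<open>W\<close>, and the copy found there is pushed forward.\<close>

lemma (in ordered_tree) ramsey_arrows_on_subset:
  assumes arrows: "ramsey_arrows r T (complete_multipartite ms)" and W: "finite W" "r \<le> card W"
  shows "embeds (red_adj c) n p W \<or> has_parts (red_adj c) ms W"
proof -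
  obtain g where g: "inj_on g {..<r}" "g ` {..<r} \<subseteq> W" using card_le_inj[of "{..<r}" W] W by auto
  define c' where "c' e = c (g ` e)" for e
  have adj: "red_adj c' x y \<longleftrightarrow> red_adj c (g x) (g y)" if "x \<in> {..<r}" "y \<in> {..<r}" for x y
    using inj_on_eq_iff[OF g(1) that] by (simp add: red_adj_def c'_def)
  from arrows have "contains_copy (colour_class (complete_graph r) c' Red) T \<or>
      contains_copy (colour_class (complete_graph r) c' Blue) (complete_multipartite ms)"
    by (simp add: ramsey_arrows_def)
  then show ?thesis
  proof
    assume "contains_copy (colour_class (complete_graph r) c' Red) T"
    from embeds_image[OF embeds_if_contains_copy[OF this] g(1) _ order, of "red_adj c"] adj
    have "embeds (red_adj c) n p (g ` {..<r})" by blast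
    then show ?thesis using embeds_mono g(2) by blast
  next
    assume "contains_copy (colour_class (complete_graph r) c' Blue) (complete_multipartite ms)"
    from has_parts_image[OF has_parts_if_contains_copy[OF this] g(1), of "red_adj c"] adj
    have "has_parts (red_adj c) ms (g ` {..<r})" by blast
    then show ?thesis using has_parts_mono[OF _ g(2) list_all2_refl] by blast
  qed
qed

text \<open>In the colouring without blue edges no two nonempty parts exist, so the tree itself must
  fit into \<open>r\<close> vertices.\<close>

lemma (in ordered_tree) order_le_if_ramsey_arrows:
  assumes "ramsey_arrows r T (complete_multipartite [a, b])" "1 \<le> a" "1 \<le> b"
  shows "n \<le> r"
proof -
  have "has_parts (red_adj (\<lambda>_. Red)) [a, b] {..<r} \<Longrightarrow> False"
  proof -
    assume "has_parts (red_adj (\<lambda>_. Red)) [a, b] {..<r}"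
    then obtain Us where Us: "map card Us = [a, b]"
      "nonadj_parts (red_adj (\<lambda>_. Red)) Us"
      unfolding has_parts_def by (elim exE conjE) (rule that)
    then obtain X Y where XY: "Us = [X, Y]" by (auto simp: map_eq_Cons_conv)
    then have "X \<noteq> {}" "Y \<noteq> {}" using Us(1) assms(2,3) by auto
    then show False using Us(2) XY by (auto simp: red_adj_def)
  qed
  then have "embeds (red_adj (\<lambda>_. Red)) n p {..<r}"
    using ramsey_arrows_on_subset[OF assms(1), of "{..<r}"] by auto
  then obtain f where "inj_on f {..<n}" "f ` {..<n} \<subseteq> {..<r}" unfolding embeds_def by blast
  from card_inj_on_le[OF this] show ?thesis by simp
qed

theorem theorem1p1:
  fixes k :: nat and m :: "nat list"
  assumes "k \<ge> 2" and "length m = k" and "sorted m" and "m ! 0 \<ge> 1"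
  shows "\<exists>n0 :: nat. \<forall>n \<ge> n0. \<forall>T :: 'a sgraph. is_tree T \<and> card (vertices T) = n \<longrightarrow>
           ramsey_number T (complete_multipartite m)
             \<le> (k - 1) * (ramsey_number T (complete_multipartite [m ! 0, m ! 1]) - 1) + m ! 0"
proof (cases "k = 2")
  case True
  \<comment> \<open>For two parts both Ramsey numbers coincide and the bound is immediate. The
    cluster argument is reserved for \<open>3 \<le> k\<close>, where there are at least two
    near-cliques.\<close>
  then have "[m ! 0, m ! 1] = m"
    using assms(2) by (intro nth_equalityI) (auto simp: less_Suc_eq numeral_2_eq_2)
  moreover have "x \<le> (k - 1) * (x - 1) + m ! 0" for x :: nat using True assms(4) by simp
  ultimately show ?thesis by simp
next
  case False
  then have k: "3 \<le> k" using assms(1) by simp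
  have m1: "1 \<le> m ! 1" using sorted_nth_mono[OF assms(3), of 0 1] assms(2,4) k by simp
  obtain n0 where n0: "\<forall>n p E (V :: nat set) r. n0 \<le> n \<and> parent_order n p \<and> (\<forall>x y. E x y \<longrightarrow> E y x) \<and> (\<forall>x. \<not> E x x) \<and>
      finite V \<and> n \<le> r \<and> (k - 1) * (r - 1) < card V \<and>
      (\<forall>W \<subseteq> V. r \<le> card W \<longrightarrow> embeds E n p W \<or> has_parts E [m ! 0, m ! 1] W) \<longrightarrow>
      embeds E n p V \<or> has_parts E m V"
    using tree_or_parts[OF k assms(2,4), where 'v = nat] by (elim exE) (rule that)
  have "ramsey_number T (complete_multipartite m) \<le> (k - 1) * (ramsey_number T (complete_multipartite [m ! 0, m ! 1]) - 1) + m ! 0"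
    if n: "n0 \<le> card (vertices T)" and T: "is_tree T" for T :: "'a sgraph"
  proof -
    define n where "n = card (vertices T)"
    define r where "r = ramsey_number T (complete_multipartite [m ! 0, m ! 1])"
    obtain \<phi> p where op: "parent_order n p" "bij_betw \<phi> {..<n} (vertices T)"
      "\<forall>i. 0 < i \<and> i < n \<longrightarrow> {\<phi> (p i), \<phi> i} \<in> edges T"
      "\<forall>e \<in> edges T. \<exists>i. 0 < i \<and> i < n \<and> e = {\<phi> (p i), \<phi> i}"
      using tree_parent_order[OF T, folded n_def] by (elim exE conjE) (rule that)
    have "ordered_tree T n \<phi> p"
    proof
      show "\<exists>i. 0 < i \<and> i < n \<and> e = {\<phi> (p i), \<phi> i}" if "e \<in> edges T" for e using op(4) that by (rule bspec)
      show "{\<phi> (p i), \<phi> i} \<in> edges T" if "0 < i" "i < n" for i using op(3) that by simp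
    qed (rule op(1,2))+
    then interpret ordered_tree T n \<phi> p .
    have "finite_simple_graph T" using T by (simp add: is_tree_def)
    then have "\<exists>N. ramsey_arrows N T (complete_multipartite [m ! 0, m ! 1])"
      using finite_simple_graph_complete_multipartite by (rule ex_ramsey_arrows)
    then have r: "ramsey_arrows r T (complete_multipartite [m ! 0, m ! 1])"
      unfolding r_def ramsey_number_def by (rule LeastI_ex)
    define N where "N = (k - 1) * (r - 1) + m ! 0"
    have "contains_copy (colour_class (complete_graph N) c Red) T \<or>
        contains_copy (colour_class (complete_graph N) c Blue) (complete_multipartite m)" for c
    proof -
      have "embeds (red_adj c) n p {..<N} \<or> has_parts (red_adj c) m {..<N}"
      proof (rule n0[THEN spec, THEN spec, THEN spec, THEN spec, THEN spec, THEN mp], intro conjI)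
        show "n0 \<le> n" using n by (simp add: n_def)
        show "n \<le> r" using order_le_if_ramsey_arrows[OF r assms(4) m1] .
        show "(k - 1) * (r - 1) < card {..<N}" using assms(4) by (simp add: N_def)
        show "\<forall>W \<subseteq> {..<N}. r \<le> card W \<longrightarrow> embeds (red_adj c) n p W \<or> has_parts (red_adj c) [m ! 0, m ! 1] W"
          using ramsey_arrows_on_subset[OF r] finite_subset[OF _ finite_lessThan] by blast
      qed (use order red_adj_sym red_adj_irrefl in auto)
      then show ?thesis using contains_copy_if_embeds contains_copy_if_has_parts by blast
    qed
    then have "ramsey_arrows N T (complete_multipartite m)" by (simp add: ramsey_arrows_def)
    then show ?thesis unfolding N_def r_def ramsey_number_def[of T "complete_multipartite m"] by (rule Least_le)
  qed
  then show ?thesis by (intro exI[of _ n0]) blast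
qed

end
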